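(* Let $\alpha$ be a strongly continuous action of a locally compact group $G$ on a $C^*$-algebra $A$, and let $\tau$ be a lower semi-continuous trace on $A$ that is $\Delta$-semi-invariant for $\alpha$, with GNS Hilbert space $H_\tau$. Then the formula $U_x(a)=\Delta(x)^{1/2}\alpha_x(a)$ for $a\in\mathcal N_\tau$ defines a unitary representation $U$ of $G$ on $H_\tau$, which is strongly continuous. Furthermore, every element of $\mathcal M_\alpha\cap\mathcal M_\tau$ (viewed as a vector in $H_\tau$) is $U$-bounded. If $\alpha$ is integrable, then $U$ is square-integrable.
   Context: $G$ has a fixed left Haar measure $dx$ and modular function $\Delta$, normalized by $\int f(xy)\,dx=\Delta(y^{-1})\int f(x)\,dx$. A trace is a map $\tau:A^+\to[0,\infty]$ that is additive, positively homogeneous and satisfies $\tau(a^*a)=\tau(aa^* )$; it is $\Delta$-semi-invariant for $\alpha$ if $\tau(\alpha_x(a))=\Delta(x)^{-1}\tau(a)$ for all $a\in A^+$, $x\in G$. Let $\mathcal M_\tau^+=\{a\in A^+:\tau(a)<\infty\}$, $\mathcal M_\tau$ its linear span, $\mathcal N_\tau=\{a:a^*a\in\mathcal M_\tau^+\}$; $H_\tau$ is the Hilbert space completion of $\mathcal N_\tau$ (modulo null vectors) for $\langle a,b\rangle_\tau=\tau(a^*b)$. Let $\mathcal B$ be the set of $\lambda\in L^\infty(G)$ with compact support and $0\le\lambda\le1$, directed pointwise, $p_\lambda(a)=\int\lambda(x)\alpha_x(a)\,dx$; $a\in A^+$ is order-integrable if $\sup_\lambda\|p_\lambda(a)\|<\infty$,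 $\mathcal M_\alpha$ is the linear span of order-integrable elements, and $\alpha$ is integrable if $\mathcal M_\alpha$ is dense. For a unitary representation $U$ on $H$, $c_{\xi\eta}(x)=\langle U_x\xi,\eta\rangle$; $\xi$ is $U$-bounded if $\|c_{\xi\eta}\|_{L^2(G)}\le k_\xi\|\eta\|$ for all $\eta$ for some constant $k_\xi$; $U$ is square-integrable if the $U$-bounded vectors are dense. *)

theory Defs
  imports "HOL-Analysis.Analysis"
begin

text \<open>A complex vector space is modelled as a real normed vector space together with
  a complex scalar multiplication extending the real one, with norm(c v) = |c| norm v.\<close>

definition complex_structure :: "(complex \<Rightarrow> 'v::real_normed_vector \<Rightarrow> 'v) \<Rightarrow> bool" where
  "complex_structure sc \<longleftrightarrow>
     (\<forall>r v. sc (complex_of_real r) v = r *\<^sub>R v) \<and>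
     (\<forall>c d v. sc (c * d) v = sc c (sc d v)) \<and>
     (\<forall>c d v. sc (c + d) v = sc c v + sc d v) \<and>
     (\<forall>c u v. sc c (u + v) = sc c u + sc c v) \<and>
     (\<forall>c v. norm (sc c v) = cmod c * norm v)"

definition cspan :: "(complex \<Rightarrow> 'v \<Rightarrow> 'v::real_normed_vector) \<Rightarrow> 'v set \<Rightarrow> 'v set" where
  "cspan sc S = {x. \<exists>F c. finite F \<and> F \<subseteq> S \<and> x = (\<Sum>s\<in>F. sc (c s) s)}"

definition cstar_algebra ::
  "(complex \<Rightarrow> 'a::{real_normed_algebra,banach} \<Rightarrow> 'a) \<Rightarrow> ('a \<Rightarrow> 'a) \<Rightarrow> bool" where
  "cstar_algebra sc st \<longleftrightarrow>
     complex_structure sc \<and>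
     (\<forall>c x y. sc c (x * y) = sc c x * y \<and> sc c (x * y) = x * sc c y) \<and>
     (\<forall>x. st (st x) = x) \<and>
     (\<forall>x y. st (x + y) = st x + st y) \<and>
     (\<forall>c x. st (sc c x) = sc (cnj c) (st x)) \<and>
     (\<forall>x y. st (x * y) = st y * st x) \<and>
     (\<forall>x. norm (st x * x) = (norm x)\<^sup>2)"

definition positive :: "('a::{real_normed_algebra} \<Rightarrow> 'a) \<Rightarrow> 'a \<Rightarrow> bool" where
  "positive st a \<longleftrightarrow> (\<exists>b. a = st b * b)"

text \<open>Traces A+ \<rightarrow> [0,\<infinity>] (values outside A+ are irrelevant).\<close>
definition is_trace :: "('a::real_normed_algebra \<Rightarrow> 'a) \<Rightarrow> ('a \<Rightarrow> ennreal) \<Rightarrow> bool" where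
  "is_trace st \<tau> \<longleftrightarrow>
     (\<forall>a b. positive st a \<longrightarrow> positive st b \<longrightarrow> \<tau> (a + b) = \<tau> a + \<tau> b) \<and>
     (\<forall>r a. 0 \<le> r \<longrightarrow> positive st a \<longrightarrow> \<tau> (r *\<^sub>R a) = ennreal r * \<tau> a) \<and>
     (\<forall>a. \<tau> (st a * a) = \<tau> (a * st a))"

definition lsc_on_positive :: "('a::real_normed_algebra \<Rightarrow> 'a) \<Rightarrow> ('a \<Rightarrow> ennreal) \<Rightarrow> bool" where
  "lsc_on_positive st \<tau> \<longleftrightarrow>
     (\<forall>t. openin (top_of_set (Collect (positive st))) {a. positive st a \<and> t < \<tau> a})"

definition Mtau_pos :: "('a::real_normed_algebra \<Rightarrow> 'a) \<Rightarrow> ('a \<Rightarrow> ennreal) \<Rightarrow> 'a set" where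
  "Mtau_pos st \<tau> = {a. positive st a \<and> \<tau> a < \<infinity>}"

definition Mtau :: "(complex \<Rightarrow> 'a \<Rightarrow> 'a) \<Rightarrow> ('a::{real_normed_algebra} \<Rightarrow> 'a) \<Rightarrow> ('a \<Rightarrow> ennreal) \<Rightarrow> 'a set" where
  "Mtau sc st \<tau> = cspan sc (Mtau_pos st \<tau>)"

definition Ntau :: "('a::real_normed_algebra \<Rightarrow> 'a) \<Rightarrow> ('a \<Rightarrow> ennreal) \<Rightarrow> 'a set" where
  "Ntau st \<tau> = {a. \<tau> (st a * a) < \<infinity>}"

text \<open>The group G is a type of class topological_group_add (not necessarily abelian;
  group law written additively) that is Hausdorff and locally compact.\<close>

definition left_haar_measure :: "'g::{topological_group_add,t2_space} measure \<Rightarrow> bool" where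
  "left_haar_measure \<mu> \<longleftrightarrow>
     sets \<mu> = sets borel \<and>
     (\<forall>y A. A \<in> sets borel \<longrightarrow> emeasure \<mu> ((\<lambda>x. y + x) ` A) = emeasure \<mu> A) \<and>
     (\<forall>K. compact K \<longrightarrow> emeasure \<mu> K < \<infinity>) \<and>
     (\<forall>U. open U \<longrightarrow> U \<noteq> {} \<longrightarrow> 0 < emeasure \<mu> U) \<and>
     (\<forall>A. A \<in> sets borel \<longrightarrow> emeasure \<mu> A = (INF U \<in> {U. open U \<and> A \<subseteq> U}. emeasure \<mu> U)) \<and>
     (\<forall>U. open U \<longrightarrow> emeasure \<mu> U = (SUP K \<in> {K. compact K \<and> K \<subseteq> U}. emeasure \<mu> K))"

definition modular_function :: "'g::{topological_group_add,t2_space} measure \<Rightarrow> ('g \<Rightarrow> real) \<Rightarrow> bool" where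
  "modular_function \<mu> \<Delta> \<longleftrightarrow>
     (\<forall>y. 0 < \<Delta> y) \<and>
     (\<forall>(f :: 'g \<Rightarrow> real) y. continuous_on UNIV f \<longrightarrow> (\<forall>x. 0 \<le> f x) \<longrightarrow>
        (\<exists>K. compact K \<and> (\<forall>x. x \<notin> K \<longrightarrow> f x = 0)) \<longrightarrow>
        (\<integral>\<^sup>+ x. ennreal (f (x + y)) \<partial>\<mu>) = ennreal (\<Delta> (- y)) * (\<integral>\<^sup>+ x. ennreal (f x) \<partial>\<mu>))"

definition star_automorphism ::
  "(complex \<Rightarrow> 'a \<Rightarrow> 'a) \<Rightarrow> ('a::real_normed_algebra \<Rightarrow> 'a) \<Rightarrow> ('a \<Rightarrow> 'a) \<Rightarrow> bool" where
  "star_automorphism sc st \<phi> \<longleftrightarrow> bij \<phi> \<and>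
     (\<forall>a b. \<phi> (a + b) = \<phi> a + \<phi> b) \<and> (\<forall>c a. \<phi> (sc c a) = sc c (\<phi> a)) \<and>
     (\<forall>a b. \<phi> (a * b) = \<phi> a * \<phi> b) \<and> (\<forall>a. \<phi> (st a) = st (\<phi> a))"

definition strongly_continuous_action ::
  "(complex \<Rightarrow> 'a \<Rightarrow> 'a) \<Rightarrow> ('a::real_normed_algebra \<Rightarrow> 'a) \<Rightarrow> ('g::topological_group_add \<Rightarrow> 'a \<Rightarrow> 'a) \<Rightarrow> bool" where
  "strongly_continuous_action sc st \<alpha> \<longleftrightarrow>
     (\<forall>x. star_automorphism sc st (\<alpha> x)) \<and> \<alpha> 0 = id \<and>
     (\<forall>x y. \<alpha> (x + y) = \<alpha> x \<circ> \<alpha> y) \<and>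
     (\<forall>a. continuous_on UNIV (\<lambda>x. \<alpha> x a))"

definition semi_invariant ::
  "('a::real_normed_algebra \<Rightarrow> 'a) \<Rightarrow> ('a \<Rightarrow> ennreal) \<Rightarrow> ('g \<Rightarrow> real) \<Rightarrow> ('g \<Rightarrow> 'a \<Rightarrow> 'a) \<Rightarrow> bool" where
  "semi_invariant st \<tau> \<Delta> \<alpha> \<longleftrightarrow>
     (\<forall>a x. positive st a \<longrightarrow> \<tau> (\<alpha> x a) = ennreal (inverse (\<Delta> x)) * \<tau> a)"

text \<open>The set \<B>: (representatives of) L\<infinity> functions with compact support and 0 \<le> \<lambda> \<le> 1.\<close>
definition Bset :: "('g::topological_space \<Rightarrow> real) set" where
  "Bset = {l. l \<in> borel_measurable borel \<and> (\<forall>x. 0 \<le> l x \<and> l x \<le> 1) \<and>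
                (\<exists>K. compact K \<and> (\<forall>x. x \<notin> K \<longrightarrow> l x = 0))}"

text \<open>p_\<lambda>(a) = \<integral> \<lambda>(x) \<alpha>_x(a) dx, as a (weak/Pettis) vector-valued integral: the unique
  element b of A with \<phi>(b) = \<integral> \<lambda>(x) \<phi>(\<alpha>_x(a)) dx for every bounded (real-)linear functional \<phi>.
  (Isabelle's Bochner integral is only available for second countable targets; for the
  integrands here both integrals agree.)\<close>
definition p_lambda :: "'g measure \<Rightarrow> ('g \<Rightarrow> 'a \<Rightarrow> 'a::{real_normed_algebra,banach}) \<Rightarrow> ('g \<Rightarrow> real) \<Rightarrow> 'a \<Rightarrow> 'a" where
  "p_lambda \<mu> \<alpha> l a = (THE b. \<forall>\<phi> :: 'a \<Rightarrow> real. bounded_linear \<phi> \<longrightarrow>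
      \<phi> b = (\<integral> x. l x * \<phi> (\<alpha> x a) \<partial>\<mu>))"

definition order_integrable ::
  "('a \<Rightarrow> 'a) \<Rightarrow> 'g::topological_space measure \<Rightarrow> ('g \<Rightarrow> 'a \<Rightarrow> 'a::{real_normed_algebra,banach}) \<Rightarrow> 'a \<Rightarrow> bool" where
  "order_integrable st \<mu> \<alpha> a \<longleftrightarrow> positive st a \<and>
     (\<exists>C. \<forall>l\<in>Bset. norm (p_lambda \<mu> \<alpha> l a) \<le> C)"

definition Malpha ::
  "(complex \<Rightarrow> 'a \<Rightarrow> 'a) \<Rightarrow> ('a \<Rightarrow> 'a) \<Rightarrow> 'g::topological_space measure \<Rightarrow> ('g \<Rightarrow> 'a \<Rightarrow> 'a::{real_normed_algebra,banach}) \<Rightarrow> 'a set" where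
  "Malpha sc st \<mu> \<alpha> = cspan sc {a. order_integrable st \<mu> \<alpha> a}"

definition integrable_action ::
  "(complex \<Rightarrow> 'a \<Rightarrow> 'a) \<Rightarrow> ('a \<Rightarrow> 'a) \<Rightarrow> 'g::topological_space measure \<Rightarrow> ('g \<Rightarrow> 'a \<Rightarrow> 'a::{real_normed_algebra,banach}) \<Rightarrow> bool" where
  "integrable_action sc st \<mu> \<alpha> \<longleftrightarrow> closure (Malpha sc st \<mu> \<alpha>) = UNIV"

text \<open>A complex Hilbert space is a complete real inner product space with a complex
  structure hsc (isometric multiplication by i). Its complex inner product, linear in the
  second and conjugate-linear in the first variable, is:\<close>
definition hinner :: "(complex \<Rightarrow> 'h \<Rightarrow> 'h) \<Rightarrow> 'h::real_inner \<Rightarrow> 'h \<Rightarrow> complex" where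
  "hinner hsc u v = Complex (inner u v) (- inner u (hsc \<i> v))"

definition unitary_op :: "(complex \<Rightarrow> 'h \<Rightarrow> 'h) \<Rightarrow> ('h::real_normed_vector \<Rightarrow> 'h) \<Rightarrow> bool" where
  "unitary_op hsc T \<longleftrightarrow> (\<forall>u v. T (u + v) = T u + T v) \<and> (\<forall>c v. T (hsc c v) = hsc c (T v)) \<and>
     (\<forall>v. norm (T v) = norm v) \<and> surj T"

definition unitary_rep ::
  "(complex \<Rightarrow> 'h \<Rightarrow> 'h) \<Rightarrow> ('g::group_add \<Rightarrow> 'h::real_normed_vector \<Rightarrow> 'h) \<Rightarrow> bool" where
  "unitary_rep hsc U \<longleftrightarrow> (\<forall>x. unitary_op hsc (U x)) \<and> U 0 = id \<and> (\<forall>x y. U (x + y) = U x \<circ> U y)"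

definition strongly_continuous_rep :: "('g::topological_space \<Rightarrow> 'h::topological_space \<Rightarrow> 'h) \<Rightarrow> bool" where
  "strongly_continuous_rep U \<longleftrightarrow> (\<forall>\<xi>. continuous_on UNIV (\<lambda>x. U x \<xi>))"

definition U_bounded ::
  "'g measure \<Rightarrow> (complex \<Rightarrow> 'h \<Rightarrow> 'h) \<Rightarrow> ('g \<Rightarrow> 'h::real_inner \<Rightarrow> 'h) \<Rightarrow> 'h \<Rightarrow> bool" where
  "U_bounded \<mu> hsc U \<xi> \<longleftrightarrow> (\<exists>k\<ge>0. \<forall>\<eta>.
     (\<integral>\<^sup>+ x. ennreal ((cmod (hinner hsc (U x \<xi>) \<eta>))\<^sup>2) \<partial>\<mu>) \<le> ennreal ((k * norm \<eta>)\<^sup>2))"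

definition square_integrable_rep ::
  "'g measure \<Rightarrow> (complex \<Rightarrow> 'h \<Rightarrow> 'h) \<Rightarrow> ('g \<Rightarrow> 'h::real_inner \<Rightarrow> 'h) \<Rightarrow> bool" where
  "square_integrable_rep \<mu> hsc U \<longleftrightarrow> closure {\<xi>. U_bounded \<mu> hsc U \<xi>} = UNIV"

text \<open>GNS space of \<tau>: a Hilbert space H with a complex-linear map \<iota> : N_\<tau> \<rightarrow> H with dense
  range and norm(iota a)^2 = \<tau>(a* a); this is the completion of N_\<tau> modulo null vectors for
  <a,b> = \<tau>(a* b) (the inner product is recovered by polarisation), unique up to unitary
  isomorphism.\<close>
definition gns_space ::
  "(complex \<Rightarrow> 'a \<Rightarrow> 'a) \<Rightarrow> ('a::real_normed_algebra \<Rightarrow> 'a) \<Rightarrow> ('a \<Rightarrow> ennreal) \<Rightarrow>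
   (complex \<Rightarrow> 'h \<Rightarrow> 'h) \<Rightarrow> ('a \<Rightarrow> 'h::{real_inner,complete_space}) \<Rightarrow> bool" where
  "gns_space sc st \<tau> hsc \<iota> \<longleftrightarrow>
     complex_structure hsc \<and>
     (\<forall>a\<in>Ntau st \<tau>. \<forall>b\<in>Ntau st \<tau>. \<iota> (a + b) = \<iota> a + \<iota> b) \<and>
     (\<forall>c. \<forall>a\<in>Ntau st \<tau>. \<iota> (sc c a) = hsc c (\<iota> a)) \<and>
     (\<forall>a\<in>Ntau st \<tau>. ennreal ((norm (\<iota> a))\<^sup>2) = \<tau> (st a * a)) \<and>
     closure (\<iota> ` Ntau st \<tau>) = UNIV"

end

theory Submission
  imports Defs
begin

text \<open>The representation is unitary by semi-invariance of the trace and strongly continuous by the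
  parallelogram law together with lower semicontinuity. A vector \<open>a\<close> is bounded as soon as
  \<open>|\<langle>a, b\<rangle>|\<^sup>2 \<le> \<tau>(b\<^sup>* s b) + \<tau>(b s b\<^sup>*)\<close> for all \<open>b\<close>, where \<open>s\<close> is a positive combination of
  order-integrable elements: replacing \<open>a\<close> by its translates and integrating, the right-hand
  side is controlled by the norms of the integrals of \<open>s\<close>. A self-adjoint \<open>a\<close> in
  \<open>M\<^sub>\<alpha> \<inter> M\<^sub>\<tau>\<close> lies between \<open>-s\<close> and \<open>s\<close> for some such \<open>s\<close>; solving approximately \<open>s y + y s = a\<close>
  gives \<open>y\<close> bounded in operator norm, and the Cauchy-Schwarz inequality for the form \<open>L\<^sub>s + R\<^sub>s\<close>
  bounds \<open>\<langle>a, b\<rangle>\<close> by the pairing of \<open>y\<close> with \<open>a\<close>, which is finite because \<open>a\<close> has finite trace norm.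
  Products \<open>c d\<close> with \<open>c\<close> order-integrable satisfy
  the criterion by the Cauchy-Schwarz inequality alone, and they are total when the action is
  integrable, since left multiplication on the GNS space of a lower semicontinuous trace is
  nondegenerate.\<close>

section \<open>Norming functionals\<close>

text \<open>The two expansions of a self-adjoint \<open>a\<close>, by order-integrable elements and
  by elements of finite trace, need not share positive summands: \<open>s\<close> may have infinite
  trace, and the finite-trace summands need not be order-integrable. So no factorisation of
  \<open>a\<close> or \<open>s\<close> gives the bound at once, which explains the detour through
  \<open>s y + y s = a\<close>. Other obstacles come from generality. The element
  \<open>p_lambda\<close> is a definite description and carries information only once existence and
  uniqueness of weak integrals are known; these rest on norming functionals, obtained from Zorn's
  lemma. Haar measure need not be \<sigma>-finite, so bounds over compact sets are extended to the
  whole group by inner regularity. The algebra may lack a unit, so \<open>1 - t\<close> occurs only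
  applied to elements, and square roots and resolvents are fixed points of contractions; strict
  contractivity costs a factor 2 in operator bounds. The trace stays a map on positive elements: all
  pairings are real inner products in the GNS space.\<close>

definition sublinear_below_norm :: "('v::real_normed_vector \<Rightarrow> real) \<Rightarrow> bool" where
  "sublinear_below_norm p \<longleftrightarrow> (\<forall>x y. p (x + y) \<le> p x + p y) \<and>
     (\<forall>x t. 0 < t \<longrightarrow> p (t *\<^sub>R x) \<le> t * p x) \<and> (\<forall>x. p x \<le> norm x)"

text \<open>Scaling back by \<open>1/t\<close> supplies the reverse inequality; the definition keeps
  one direction because it is easier to check for infima.\<close>

lemma sublinear_below_norm_scaleR:
  assumes "sublinear_below_norm p" "0 < t"
  shows "p (t *\<^sub>R x) = t * p x"
proof (rule antisym)
  have "p ((1/t) *\<^sub>R (t *\<^sub>R x)) \<le> (1/t) * p (t *\<^sub>R x)"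
    using assms unfolding sublinear_below_norm_def by (metis zero_less_divide_1_iff)
  then show "t * p x \<le> p (t *\<^sub>R x)" using assms by (simp add: field_simps)
qed (use assms in \<open>auto simp: sublinear_below_norm_def\<close>)

lemma sublinear_below_norm_zero:
  assumes "sublinear_below_norm p"
  shows "p 0 = 0"
  using sublinear_below_norm_scaleR[OF assms, of 2 0] by simp

text \<open>This keeps infima over chains finite and later makes the minimal functional
  bounded.\<close>

lemma sublinear_below_norm_ge:
  assumes "sublinear_below_norm p"
  shows "- norm x \<le> p x"
proof -
  have "p (x + - x) \<le> p x + p (- x)" "p (- x) \<le> norm (- x)"
    using assms unfolding sublinear_below_norm_def by blast+
  then show ?thesis using sublinear_below_norm_zero[OF assms] by simp
qed

text \<open>Tilting a sublinear functional along a direction makes it smaller; a minimal one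
  is unaffected by every tilt, hence additive.\<close>

definition tilt :: "('v::real_normed_vector \<Rightarrow> real) \<Rightarrow> 'v \<Rightarrow> 'v \<Rightarrow> real" where
  "tilt p v x = (INF t\<in>{0..}. p (x + t *\<^sub>R v) - t * p v)"

text \<open>The term \<open>t * p v\<close> equals \<open>p (t *\<^sub>R v)\<close>, so
  subadditivity, applied with \<open>- x\<close>, gives a bound independent of
  \<open>t\<close>.\<close>

lemma tilt_bdd_below:
  assumes "sublinear_below_norm p"
  shows "bdd_below ((\<lambda>t. p (x + t *\<^sub>R v) - t * p v) ` {0..})"
proof (rule bdd_belowI2)
  fix t :: real assume t: "t \<in> {0..}"
  have "p (t *\<^sub>R v) = t * p v"
    using sublinear_below_norm_scaleR[OF assms, of t v] sublinear_below_norm_zero[OF assms] t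
    by (cases "t = 0") auto
  moreover have "p ((x + t *\<^sub>R v) + - x) \<le> p (x + t *\<^sub>R v) + p (- x)"
    using assms unfolding sublinear_below_norm_def by blast
  moreover have "p (- x) \<le> norm x"
    using assms unfolding sublinear_below_norm_def by (metis norm_minus_cancel)
  ultimately show "- norm x \<le> p (x + t *\<^sub>R v) - t * p v" by simp
qed

lemma tilt_le:
  assumes "sublinear_below_norm p" "0 \<le> t"
  shows "tilt p v x \<le> p (x + t *\<^sub>R v) - t * p v"
  unfolding tilt_def by (rule cINF_lower[OF tilt_bdd_below[OF assms(1)]]) (use assms in auto)

lemma tilt_approx:
  assumes "sublinear_below_norm p" "0 < e"
  obtains t where "0 \<le> t" "p (x + t *\<^sub>R v) - t * p v < tilt p v x + e"
proof -
  have "tilt p v x < tilt p v x + e" using assms by simp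
  then obtain t where "t \<in> {0..}" "p (x + t *\<^sub>R v) - t * p v < tilt p v x + e"
    unfolding tilt_def
    using cINF_less_iff[OF _ tilt_bdd_below[OF assms(1)], of x v "tilt p v x + e"]
    by (auto simp: tilt_def)
  then show ?thesis using that by auto
qed

text \<open>Near-optimal parameters for \<open>x\<close> and \<open>y\<close> add up to an
  admissible parameter for \<open>x + y\<close>, and scaling \<open>x\<close> by \<open>c\<close>
  scales the parameter by \<open>c\<close>.\<close>

lemma sublinear_tilt:
  assumes p: "sublinear_below_norm p"
  shows "sublinear_below_norm (tilt p v)" "tilt p v \<le> p"
proof -
  have le: "tilt p v x \<le> p x" for x using tilt_le[OF p, of 0 v x] by simp
  then show "tilt p v \<le> p" by (simp add: le_fun_def)
  have "tilt p v (x + y) \<le> tilt p v x + tilt p v y" for x y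
  proof (rule field_le_epsilon)
    fix e :: real assume "0 < e"
    then have "0 < e/2" by simp
    obtain t where t: "0 \<le> t" "p (x + t *\<^sub>R v) - t * p v < tilt p v x + e/2"
      using tilt_approx[OF p \<open>0 < e/2\<close>] by blast
    obtain s where s: "0 \<le> s" "p (y + s *\<^sub>R v) - s * p v < tilt p v y + e/2"
      using tilt_approx[OF p \<open>0 < e/2\<close>] by blast
    have "tilt p v (x + y) \<le> p ((x + y) + (t + s) *\<^sub>R v) - (t + s) * p v"
      using tilt_le[OF p] t s by simp
    also have "(x + y) + (t + s) *\<^sub>R v = (x + t *\<^sub>R v) + (y + s *\<^sub>R v)"
      by (simp add: algebra_simps)
    also have "p \<dots> - (t + s) * p v \<le> p (x + t *\<^sub>R v) + p (y + s *\<^sub>R v) - (t + s) * p v"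
      using p unfolding sublinear_below_norm_def by simp
    also have "\<dots> \<le> tilt p v x + tilt p v y + e"
      using t s by (simp add: algebra_simps)
    finally show "tilt p v (x + y) \<le> tilt p v x + tilt p v y + e" .
  qed
  moreover have "tilt p v (c *\<^sub>R x) \<le> c * tilt p v x" if c: "0 < c" for c x
  proof (rule field_le_epsilon)
    fix e :: real assume "0 < e"
    then have "0 < e/c" using c by simp
    obtain t where t: "0 \<le> t" "p (x + t *\<^sub>R v) - t * p v < tilt p v x + e/c"
      using tilt_approx[OF p \<open>0 < e/c\<close>] by blast
    have "tilt p v (c *\<^sub>R x) \<le> p (c *\<^sub>R x + (c * t) *\<^sub>R v) - (c * t) * p v"
      using tilt_le[OF p] t c by simp
    also have "c *\<^sub>R x + (c * t) *\<^sub>R v = c *\<^sub>R (x + t *\<^sub>R v)" by (simp add: algebra_simps)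
    also have "p \<dots> = c * p (x + t *\<^sub>R v)" by (rule sublinear_below_norm_scaleR[OF p c])
    also have "c * p (x + t *\<^sub>R v) - (c * t) * p v = c * (p (x + t *\<^sub>R v) - t * p v)"
      by (simp add: algebra_simps)
    also have "\<dots> \<le> c * (tilt p v x + e/c)" using t c by simp
    also have "\<dots> = c * tilt p v x + e" using c by (simp add: field_simps)
    finally show "tilt p v (c *\<^sub>R x) \<le> c * tilt p v x + e" .
  qed
  moreover have "tilt p v x \<le> norm x" for x
    using le[of x] p unfolding sublinear_below_norm_def by (meson order_trans)
  ultimately show "sublinear_below_norm (tilt p v)" unfolding sublinear_below_norm_def by blast
qed

text \<open>Two near-minimisers taken from a chain can be replaced by the smaller one, which lets
  subadditivity survive the infimum.\<close>

lemma sublinear_chain_Inf: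
  assumes C: "\<And>p. p \<in> C \<Longrightarrow> sublinear_below_norm p" "C \<noteq> {}"
    and chain: "\<And>p q. p \<in> C \<Longrightarrow> q \<in> C \<Longrightarrow> p \<le> q \<or> q \<le> p"
  defines "u \<equiv> \<lambda>x. INF p\<in>C. p x"
  shows "sublinear_below_norm u" "\<And>p. p \<in> C \<Longrightarrow> u \<le> p"
proof -
  have bdd: "bdd_below ((\<lambda>p. p x) ` C)" for x
    by (rule bdd_belowI2[of _ "- norm x"]) (use C sublinear_below_norm_ge in auto)
  have le: "u x \<le> p x" if "p \<in> C" for p x
    unfolding u_def by (rule cINF_lower[OF bdd that])
  then show "u \<le> p" if "p \<in> C" for p using that by (simp add: le_fun_def)
  have approx: "\<exists>p\<in>C. p x < u x + e" if "0 < e" for x e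
    using cINF_less_iff[OF C(2) bdd, of x "u x + e"] that unfolding u_def by auto
  have "u (x + y) \<le> u x + u y" for x y
  proof (rule field_le_epsilon)
    fix e :: real assume "0 < e"
    then have "0 < e/2" by simp
    obtain p q where p: "p \<in> C" "p x < u x + e/2" and q: "q \<in> C" "q y < u y + e/2"
      using approx[OF \<open>0 < e/2\<close>] by metis
    obtain r where r: "r \<in> C" "r \<le> p" "r \<le> q"
      using chain[OF p(1) q(1)] p(1) q(1) by blast
    have "u (x + y) \<le> r (x + y)" using le r by blast
    also have "\<dots> \<le> r x + r y" using C(1)[OF r(1)] unfolding sublinear_below_norm_def by blast
    also have "\<dots> \<le> p x + q y" using r by (simp add: le_funD add_mono)
    finally show "u (x + y) \<le> u x + u y + e" using p q by simp
  qed
  moreover have "u (t *\<^sub>R x) \<le> t * u x" if t: "0 < t" for t x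
  proof (rule field_le_epsilon)
    fix e :: real assume "0 < e"
    then have "0 < e/t" using t by simp
    then obtain p where p: "p \<in> C" "p x < u x + e/t" using approx by blast
    have "u (t *\<^sub>R x) \<le> p (t *\<^sub>R x)" using le p by blast
    also have "\<dots> = t * p x" by (rule sublinear_below_norm_scaleR[OF C(1)[OF p(1)] t])
    also have "\<dots> \<le> t * (u x + e/t)" using p t by simp
    also have "\<dots> = t * u x + e" using t by (simp add: field_simps)
    finally show "u (t *\<^sub>R x) \<le> t * u x + e" .
  qed
  moreover have "u x \<le> norm x" for x
  proof -
    obtain p where "p \<in> C" using C(2) by blast
    then show ?thesis using le[of p x] C(1)[of p] unfolding sublinear_below_norm_def
      by (meson order_trans)
  qed
  ultimately show "sublinear_below_norm u" unfolding sublinear_below_norm_def by blast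
qed

lemma exists_minimal_sublinear:
  assumes q: "sublinear_below_norm q"
  obtains p where "sublinear_below_norm p" "p \<le> q"
    "\<And>r. sublinear_below_norm r \<Longrightarrow> r \<le> p \<Longrightarrow> r = p"
proof -
  define S where "S = {p. sublinear_below_norm p \<and> p \<le> q}"
  \<comment> \<open>The order is reversed, so the maximal element delivered by Zorn's lemma is a
    minimal functional.\<close>
  define P where "P = (\<lambda>a b :: 'a \<Rightarrow> real. b \<le> a)"
  have "\<exists>m\<in>S. \<forall>a\<in>S. P m a \<longrightarrow> a = m"
  proof (rule predicate_Zorn)
    show "partial_order_on S (relation_of P S)"
      by (rule partial_order_on_relation_ofI) (auto simp: P_def)
    fix C assume C: "C \<in> Chains (relation_of P S)"
    then have sub: "C \<subseteq> S" and ch: "\<And>a b. a \<in> C \<Longrightarrow> b \<in> C \<Longrightarrow> a \<le> b \<or> b \<le> a"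
      by (auto simp: Chains_def relation_of_def P_def)
    show "\<exists>u\<in>S. \<forall>a\<in>C. P a u"
    proof (cases "C = {}")
      case True
      then show ?thesis using q by (auto simp: S_def)
    next
      case False
      then obtain a where a: "a \<in> C" by blast
      have slb: "\<And>p. p \<in> C \<Longrightarrow> sublinear_below_norm p" using sub by (auto simp: S_def)
      note inf = sublinear_chain_Inf[OF slb False ch]
      have "(\<lambda>x. INF p\<in>C. p x) \<le> q"
        using inf(2)[OF _ _ _ a] a sub by (auto simp: S_def intro: order_trans)
      then show ?thesis using inf by (auto simp: S_def P_def)
    qed
  qed
  then obtain p where p: "p \<in> S" "\<And>a. a \<in> S \<Longrightarrow> P p a \<Longrightarrow> a = p" by blast
  show ?thesis
  proof (rule that[of p])
    show "sublinear_below_norm p" "p \<le> q" using p(1) by (auto simp: S_def)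
    show "r = p" if "sublinear_below_norm r" "r \<le> p" for r
      using that p by (auto simp: S_def P_def)
  qed
qed

lemma exists_norming_functional:
  fixes v :: "'v::real_normed_vector"
  obtains \<phi> where "bounded_linear \<phi>" "\<And>w. \<bar>\<phi> w\<bar> \<le> norm w" "\<phi> v = norm v"
proof -
  have n: "sublinear_below_norm (norm :: 'v \<Rightarrow> real)"
    by (auto simp: sublinear_below_norm_def norm_triangle_ineq)
  \<comment> \<open>Starting below \<open>tilt norm v\<close> instead of \<open>norm\<close> fixes
    the value at \<open>v\<close>: the parameter 1 gives
    \<open>tilt norm v (- v) \<le> - norm v\<close>.\<close>
  obtain p where p: "sublinear_below_norm p" "p \<le> tilt norm v"
    and min: "\<And>r. sublinear_below_norm r \<Longrightarrow> r \<le> p \<Longrightarrow> r = p"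
    using exists_minimal_sublinear[OF sublinear_tilt(1)[OF n, of v]] by blast
  have add: "p (x + y) = p x + p y" for x y
  proof (rule antisym)
    show "p (x + y) \<le> p x + p y" using p(1) by (auto simp: sublinear_below_norm_def)
    \<comment> \<open>Minimality makes \<open>p\<close> invariant under tilting, and the bound on
      the tilt with parameter 1 is superadditivity.\<close>
    have "tilt p y = p" using min sublinear_tilt[OF p(1)] by blast
    then show "p x + p y \<le> p (x + y)" using tilt_le[OF p(1), of 1 y x] by simp
  qed
  have p0: "p 0 = 0" by (rule sublinear_below_norm_zero[OF p(1)])
  have neg: "p (- x) = - p x" for x using add[of x "- x"] p0 by simp
  have sc: "p (t *\<^sub>R x) = t * p x" for t x
  proof (cases t "0::real" rule: linorder_cases)
    case less
    then have "p ((- t) *\<^sub>R x) = (- t) * p x"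
      by (intro sublinear_below_norm_scaleR[OF p(1)]) simp
    then show ?thesis using neg[of "t *\<^sub>R x"] by simp
  qed (use p0 sublinear_below_norm_scaleR[OF p(1)] in auto)
  have le: "p x \<le> norm x" for x using p(1) by (auto simp: sublinear_below_norm_def)
  have abs: "\<bar>p x\<bar> \<le> norm x" for x using le[of x] sublinear_below_norm_ge[OF p(1), of x] by simp
  show ?thesis
  proof (rule that[of p])
    show "bounded_linear p"
      by (rule bounded_linear_intro[where K = 1]) (use add sc abs in auto)
    show "\<bar>p w\<bar> \<le> norm w" for w by (rule abs)
    have "p (- v) \<le> tilt norm v (- v)" using p(2) by (simp add: le_fun_def)
    also have "\<dots> \<le> - norm v" using tilt_le[OF n, of 1 v "- v"] by simp
    finally show "p v = norm v" using neg[of v] le[of v] by simp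
  qed
qed

section \<open>Weak integrals and integrals of continuous functions\<close>

lemma integrable_Bset_mult:
  fixes g :: "'g::t2_space \<Rightarrow> real"
  assumes \<mu>: "sets \<mu> = sets borel" "\<forall>K. compact K \<longrightarrow> emeasure \<mu> K < \<infinity>"
    and g: "continuous_on UNIV g" and l: "l \<in> Bset"
  shows "integrable \<mu> (\<lambda>x. l x * g x)"
proof -
  obtain K where K: "compact K" "\<And>x. x \<notin> K \<Longrightarrow> l x = 0" and l1: "\<And>x. 0 \<le> l x \<and> l x \<le> 1"
    and lm: "l \<in> borel_measurable borel"
    using l unfolding Bset_def by blast
  have "compact (g ` K)" using compact_continuous_image[OF continuous_on_subset[OF g]] K by auto
  then obtain B where B: "\<And>x. x \<in> K \<Longrightarrow> \<bar>g x\<bar> \<le> B"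
    using compact_imp_bounded[of "g ` K"] unfolding bounded_iff by auto
  have Ks: "K \<in> sets \<mu>" using K(1) \<mu>(1) by (simp add: compact_imp_closed)
  have gm: "g \<in> borel_measurable borel" using g by (rule borel_measurable_continuous_onI)
  have "integrable \<mu> (\<lambda>x. B * indicator K x)"
    using Ks \<mu>(2) K(1) by simp
  moreover have "(\<lambda>x. l x * g x) \<in> borel_measurable \<mu>"
    using lm gm by (simp add: measurable_cong_sets[OF \<mu>(1) refl])
  moreover have "AE x in \<mu>. norm (l x * g x) \<le> norm (B * indicator K x)"
  proof (rule AE_I2)
    fix x
    show "norm (l x * g x) \<le> norm (B * indicator K x)"
    proof (cases "x \<in> K")
      case True
      have "\<bar>l x * g x\<bar> \<le> 1 * \<bar>g x\<bar>" unfolding abs_mult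
        by (rule mult_right_mono) (use l1[of x] in auto)
      then show ?thesis using B[OF True] True by simp
    qed (use K in simp)
  qed
  ultimately show ?thesis by (rule Bochner_Integration.integrable_bound)
qed

lemma Bset_mult_indicator:
  assumes "l \<in> Bset" "S \<in> sets borel"
  shows "(\<lambda>x. l x * indicator S x) \<in> Bset"
  using assms unfolding Bset_def by (auto simp: indicator_def mult_le_one)

text \<open>Induction over a finite net \<open>Y\<close> of points: the part of \<open>l\<close>
  living where \<open>f\<close> is close to \<open>f y\<close> is integrated as if \<open>f\<close>
  were constant there, and the rest goes to the induction hypothesis. A single \<open>b\<close>
  serves all functionals, each with its own bound \<open>M\<close>.\<close>

lemma weak_integral_approx:
  fixes f :: "'g::t2_space \<Rightarrow> 'v::real_normed_vector"
  assumes \<mu>: "sets \<mu> = sets borel" "\<forall>K. compact K \<longrightarrow> emeasure \<mu> K < \<infinity>"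
    and f: "continuous_on UNIV f" and e: "0 \<le> e"
  shows "finite Y \<Longrightarrow> l \<in> Bset \<Longrightarrow> (\<And>x. l x \<noteq> 0 \<Longrightarrow> \<exists>y\<in>Y. norm (f x - f y) < e) \<Longrightarrow>
    \<exists>b. \<forall>\<phi> M. bounded_linear \<phi> \<longrightarrow> 0 \<le> M \<longrightarrow> (\<forall>w. \<bar>\<phi> w\<bar> \<le> M * norm w) \<longrightarrow>
      \<bar>\<phi> b - (\<integral>x. l x * \<phi> (f x) \<partial>\<mu>)\<bar> \<le> M * e * (\<integral>x. l x \<partial>\<mu>)"
proof (induction Y arbitrary: l rule: finite_induct)
  case empty
  then have "l = (\<lambda>x. 0)" by auto
  then show ?case by (intro exI[of _ 0]) (simp add: linear_simps)
next
  case (insert y Y)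
  define S where "S = {x. norm (f x - f y) < e}"
  have "open S" unfolding S_def
    by (intro open_Collect_less continuous_intros f)
  then have S: "S \<in> sets borel" "- S \<in> sets borel" by auto
  define l1 where "l1 = (\<lambda>x. l x * indicator S x)"
  define l2 where "l2 = (\<lambda>x. l x * indicator (- S) x)"
  have l12: "l1 \<in> Bset" "l2 \<in> Bset"
    unfolding l1_def l2_def using Bset_mult_indicator insert.prems(1) S by blast+
  have ll: "l x = l1 x + l2 x" for x by (auto simp: l1_def l2_def indicator_def)
  note int = integrable_Bset_mult[OF \<mu>]
  have il: "integrable \<mu> l1" "integrable \<mu> l2"
    using int[of "\<lambda>x. 1"] l12 by force+
  have "\<exists>z\<in>Y. norm (f x - f z) < e" if "l2 x \<noteq> 0" for x
    using insert.prems(2)[of x] that by (auto simp: l2_def S_def indicator_def split: if_splits)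
  then obtain b where b: "\<And>\<phi> M. bounded_linear \<phi> \<Longrightarrow> 0 \<le> M \<Longrightarrow> (\<And>w. \<bar>\<phi> w\<bar> \<le> M * norm w) \<Longrightarrow>
      \<bar>\<phi> b - (\<integral>x. l2 x * \<phi> (f x) \<partial>\<mu>)\<bar> \<le> M * e * (\<integral>x. l2 x \<partial>\<mu>)"
    using insert.IH[OF l12(2)] by blast
  show ?case
  proof (intro exI[of _ "(\<integral>x. l1 x \<partial>\<mu>) *\<^sub>R f y + b"] allI impI)
    fix \<phi> :: "'v \<Rightarrow> real" and M
    assume \<phi>: "bounded_linear \<phi>" and M0: "0 \<le> M" and M: "\<forall>w. \<bar>\<phi> w\<bar> \<le> M * norm w"
    interpret \<phi>: bounded_linear \<phi> by fact
    have cf: "continuous_on UNIV (\<lambda>x. \<phi> (f x))" using \<phi>.continuous_on[OF f] .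
    have i1: "integrable \<mu> (\<lambda>x. l1 x * \<phi> (f x))" "integrable \<mu> (\<lambda>x. l2 x * \<phi> (f x))"
      using int cf l12 by blast+
    have "(\<integral>x. l1 x * \<phi> (f y) \<partial>\<mu>) - (\<integral>x. l1 x * \<phi> (f x) \<partial>\<mu>)
        = (\<integral>x. l1 x * \<phi> (f y - f x) \<partial>\<mu>)"
      using i1 il by (subst Bochner_Integration.integral_diff[symmetric])
        (auto simp: \<phi>.diff algebra_simps)
    also have "\<bar>\<dots>\<bar> \<le> (\<integral>x. l1 x * (M * e) \<partial>\<mu>)"
    proof (rule integral_abs_bound[THEN order_trans], rule integral_mono)
      show "integrable \<mu> (\<lambda>x. \<bar>l1 x * \<phi> (f y - f x)\<bar>)"
        by (intro Bochner_Integration.integrable_abs int l12 \<phi>.continuous_on continuous_intros f)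
      show "integrable \<mu> (\<lambda>x. l1 x * (M * e))" using il by simp
      fix x
      have "\<bar>\<phi> (f y - f x)\<bar> \<le> M * e" if "l1 x \<noteq> 0"
      proof -
        have n: "norm (f y - f x) < e" using that
          by (auto simp: l1_def S_def indicator_def norm_minus_commute split: if_splits)
        have "M * norm (f y - f x) \<le> M * e"
          using n M0 by (intro mult_left_mono) auto
        then show ?thesis using M order_trans by blast
      qed
      moreover have "0 \<le> l1 x" using l12(1) by (auto simp: Bset_def)
      ultimately show "\<bar>l1 x * \<phi> (f y - f x)\<bar> \<le> l1 x * (M * e)"
        by (cases "l1 x = 0") (auto simp: abs_mult intro!: mult_left_mono)
    qed
    finally have 1: "\<bar>(\<integral>x. l1 x * \<phi> (f y) \<partial>\<mu>) - (\<integral>x. l1 x * \<phi> (f x) \<partial>\<mu>)\<bar>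
        \<le> M * e * (\<integral>x. l1 x \<partial>\<mu>)" by (simp add: mult.commute)
    have "\<phi> ((\<integral>x. l1 x \<partial>\<mu>) *\<^sub>R f y + b) = (\<integral>x. l1 x * \<phi> (f y) \<partial>\<mu>) + \<phi> b"
      by (simp add: \<phi>.add \<phi>.scaleR)
    moreover have "(\<integral>x. l x * \<phi> (f x) \<partial>\<mu>)
        = (\<integral>x. l1 x * \<phi> (f x) \<partial>\<mu>) + (\<integral>x. l2 x * \<phi> (f x) \<partial>\<mu>)"
      using i1 by (simp add: ll distrib_right)
    moreover have "(\<integral>x. l x \<partial>\<mu>) = (\<integral>x. l1 x \<partial>\<mu>) + (\<integral>x. l2 x \<partial>\<mu>)"
      using il by (simp add: ll)
    moreover have "\<bar>\<phi> b - (\<integral>x. l2 x * \<phi> (f x) \<partial>\<mu>)\<bar> \<le> M * e * (\<integral>x. l2 x \<partial>\<mu>)"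
      using b[OF \<phi> M0] M by blast
    ultimately show "\<bar>\<phi> ((\<integral>x. l1 x \<partial>\<mu>) *\<^sub>R f y + b) - (\<integral>x. l x * \<phi> (f x) \<partial>\<mu>)\<bar>
        \<le> M * e * (\<integral>x. l x \<partial>\<mu>)"
      using 1 by (simp add: algebra_simps)
  qed
qed

text \<open>Approximants for errors tending to 0 form a Cauchy sequence, since a norming functional
  sees the full norm of a difference of two of them; the same device gives uniqueness. This makes
  the definite description in \<open>p_lambda\<close> meaningful.\<close>

lemma weak_integral_ex1:
  fixes f :: "'g::t2_space \<Rightarrow> 'v::{real_normed_vector,complete_space}"
  assumes \<mu>: "sets \<mu> = sets borel" "\<forall>K. compact K \<longrightarrow> emeasure \<mu> K < \<infinity>"
    and f: "continuous_on UNIV f" and l: "l \<in> Bset"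
  shows "\<exists>!b. \<forall>\<phi> :: 'v \<Rightarrow> real. bounded_linear \<phi> \<longrightarrow> \<phi> b = (\<integral>x. l x * \<phi> (f x) \<partial>\<mu>)"
proof -
  obtain K where K: "compact K" "\<And>x. x \<notin> K \<Longrightarrow> l x = 0"
    using l unfolding Bset_def by blast
  define I where "I = (\<integral>x. l x \<partial>\<mu>)"
  have I: "0 \<le> I" unfolding I_def using l by (intro integral_nonneg_AE) (auto simp: Bset_def)
  have "\<exists>b. \<forall>\<phi> M. bounded_linear \<phi> \<longrightarrow> 0 \<le> M \<longrightarrow> (\<forall>w. \<bar>\<phi> w\<bar> \<le> M * norm w) \<longrightarrow>
      \<bar>\<phi> b - (\<integral>x. l x * \<phi> (f x) \<partial>\<mu>)\<bar> \<le> M * e * I" if e: "0 < e" for e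
  proof -
    have "open {x. norm (f x - f y) < e}" for y
      by (intro open_Collect_less continuous_intros f)
    moreover have "K \<subseteq> (\<Union>y\<in>K. {x. norm (f x - f y) < e})" using e by auto
    ultimately obtain Y where Y: "Y \<subseteq> K" "finite Y" "K \<subseteq> (\<Union>y\<in>Y. {x. norm (f x - f y) < e})"
      using compactE_image[OF K(1), of K "\<lambda>y. {x. norm (f x - f y) < e}"] by blast
    show ?thesis unfolding I_def
    proof (rule weak_integral_approx[OF \<mu> f])
      show "\<exists>y\<in>Y. norm (f x - f y) < e" if "l x \<noteq> 0" for x
        using that K(2) Y(3) by blast
    qed (use Y l e in auto)
  qed
  then have "\<forall>n. \<exists>b. \<forall>\<phi> M. bounded_linear \<phi> \<longrightarrow> 0 \<le> M \<longrightarrow> (\<forall>w. \<bar>\<phi> w\<bar> \<le> M * norm w) \<longrightarrow>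
      \<bar>\<phi> b - (\<integral>x. l x * \<phi> (f x) \<partial>\<mu>)\<bar> \<le> M * inverse (real (Suc n)) * I"
    by simp
  then obtain b where b: "\<And>n \<phi> M. bounded_linear \<phi> \<Longrightarrow> 0 \<le> M \<Longrightarrow> (\<And>w. \<bar>\<phi> w\<bar> \<le> M * norm w) \<Longrightarrow>
      \<bar>\<phi> (b n) - (\<integral>x. l x * \<phi> (f x) \<partial>\<mu>)\<bar> \<le> M * inverse (real (Suc n)) * I"
    by metis
  have dist: "norm (b n - b m) \<le> (inverse (real (Suc n)) + inverse (real (Suc m))) * I" for n m
  proof -
    obtain \<phi> where \<phi>: "bounded_linear \<phi>" "\<And>w. \<bar>\<phi> w\<bar> \<le> norm w" "\<phi> (b n - b m) = norm (b n - b m)"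
      using exists_norming_functional by blast
    have "norm (b n - b m) = \<phi> (b n) - \<phi> (b m)"
      using \<phi> by (simp add: linear_simps)
    moreover have "\<bar>\<phi> (b k) - (\<integral>x. l x * \<phi> (f x) \<partial>\<mu>)\<bar> \<le> inverse (real (Suc k)) * I" for k
      using b[OF \<phi>(1), of 1 k] \<phi>(2) by simp
    note this[of n] this[of m]
    ultimately show ?thesis by (simp add: distrib_right)
  qed
  have lim0: "(\<lambda>n. M * inverse (real (Suc n)) * I) \<longlonglongrightarrow> 0" for M
    using tendsto_mult[OF tendsto_mult[OF tendsto_const LIMSEQ_inverse_real_of_nat] tendsto_const, of M I]
    by simp
  have "Cauchy b"
  proof (rule metric_CauchyI)
    fix e :: real assume "0 < e"
    then have "\<forall>\<^sub>F n in sequentially. 2 * inverse (real (Suc n)) * I < e"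
      using order_tendstoD(2)[OF lim0[of 2]] by blast
    then obtain N where N: "\<And>n. n \<ge> N \<Longrightarrow> 2 * inverse (real (Suc n)) * I < e"
      unfolding eventually_sequentially by blast
    have "dist (b m) (b n) < e" if "m \<ge> N" "n \<ge> N" for m n
      using dist[of m n] N[OF that(1)] N[OF that(2)] by (simp add: dist_norm algebra_simps)
    then show "\<exists>M. \<forall>m\<ge>M. \<forall>n\<ge>M. dist (b m) (b n) < e" by blast
  qed
  then obtain c where c: "b \<longlonglongrightarrow> c" using Cauchy_convergent convergent_def by blast
  show ?thesis
  proof (rule ex1I[of _ c])
    show "\<forall>\<phi> :: 'v \<Rightarrow> real. bounded_linear \<phi> \<longrightarrow> \<phi> c = (\<integral>x. l x * \<phi> (f x) \<partial>\<mu>)"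
    proof (intro allI impI)
      fix \<phi> :: "'v \<Rightarrow> real" assume \<phi>: "bounded_linear \<phi>"
      then obtain M where M0: "0 \<le> M" and M: "\<And>w. \<bar>\<phi> w\<bar> \<le> M * norm w"
        using bounded_linear.nonneg_bounded[OF \<phi>] by (metis real_norm_def mult.commute)
      have "(\<lambda>n. \<phi> (b n) - (\<integral>x. l x * \<phi> (f x) \<partial>\<mu>)) \<longlonglongrightarrow> 0"
        by (rule Lim_null_comparison[OF _ lim0[of M]]) (use b[OF \<phi> M0 M] in simp)
      moreover have "(\<lambda>n. \<phi> (b n)) \<longlonglongrightarrow> \<phi> c" using bounded_linear.tendsto[OF \<phi> c] .
      ultimately show "\<phi> c = (\<integral>x. l x * \<phi> (f x) \<partial>\<mu>)"
        by (rule LIMSEQ_unique[OF _ Lim_null[THEN iffD2], rotated])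
    qed
    fix d assume d: "\<forall>\<phi> :: 'v \<Rightarrow> real. bounded_linear \<phi> \<longrightarrow> \<phi> d = (\<integral>x. l x * \<phi> (f x) \<partial>\<mu>)"
    note c' = \<open>\<forall>\<phi> :: 'v \<Rightarrow> real. bounded_linear \<phi> \<longrightarrow> \<phi> c = (\<integral>x. l x * \<phi> (f x) \<partial>\<mu>)\<close>
    obtain \<phi> where \<phi>: "bounded_linear \<phi>" "\<phi> (d - c) = norm (d - c)"
      using exists_norming_functional by blast
    have "\<phi> d = \<phi> c" using c' d \<phi>(1) by metis
    then show "d = c" using \<phi> by (simp add: linear_simps)
  qed
qed

text \<open>Without \<sigma>-finiteness a set of positive measure may have only null compact
  subsets. Continuity confines the mass of \<open>f\<close> to the open sets \<open>f > 1/n\<close>: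
  by the bound and inner regularity these have finite measure and are exhausted, up to null sets, by
  countably many compact sets.\<close>

lemma nn_integral_le_of_compact:
  fixes f :: "'g::t2_space \<Rightarrow> real"
  assumes \<mu>: "sets \<mu> = sets borel"
    and inner: "\<forall>U. open U \<longrightarrow> emeasure \<mu> U = (SUP K \<in> {K. compact K \<and> K \<subseteq> U}. emeasure \<mu> K)"
    and f: "continuous_on UNIV f" "\<And>x. 0 \<le> f x"
    and M: "M < \<infinity>" "\<And>K. compact K \<Longrightarrow> (\<integral>\<^sup>+x. ennreal (f x) * indicator K x \<partial>\<mu>) \<le> M"
  shows "(\<integral>\<^sup>+x. ennreal (f x) \<partial>\<mu>) \<le> M"
proof -
  define U where "U n = {x. inverse (real (Suc n)) < f x}" for n
  have oU: "open (U n)" for n unfolding U_def by (intro open_Collect_less continuous_intros f)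
  have Ks: "K \<in> sets \<mu>" if "compact K" for K using that \<mu> by (simp add: compact_imp_closed)
  have Us: "U n \<in> sets \<mu>" for n using oU \<mu> by simp
  have fm[measurable]: "f \<in> borel_measurable \<mu>"
    using borel_measurable_continuous_onI[OF f(1)] by (simp add: measurable_cong_sets[OF \<mu> refl])
  \<comment> \<open>Markov's inequality on compact subsets, combined with inner regularity.\<close>
  have "emeasure \<mu> (U n) \<le> ennreal (real (Suc n)) * M" for n
  proof (subst inner[rule_format, OF oU], rule SUP_least)
    fix K assume "K \<in> {K. compact K \<and> K \<subseteq> U n}"
    then have K: "compact K" "K \<subseteq> U n" by auto
    have "ennreal (inverse (real (Suc n))) * emeasure \<mu> K
        = (\<integral>\<^sup>+x. ennreal (inverse (real (Suc n))) * indicator K x \<partial>\<mu>)"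
      using Ks[OF K(1)] by (simp add: nn_integral_cmult_indicator)
    also have "\<dots> \<le> (\<integral>\<^sup>+x. ennreal (f x) * indicator K x \<partial>\<mu>)"
      using K(2) by (intro nn_integral_mono) (auto simp: indicator_def U_def intro!: ennreal_leI)
    also have "\<dots> \<le> M" by (rule M(2)[OF K(1)])
    finally have "ennreal (real (Suc n)) * (ennreal (inverse (real (Suc n))) * emeasure \<mu> K)
        \<le> ennreal (real (Suc n)) * M" by (rule mult_left_mono) simp
    moreover have "ennreal (real (Suc n)) * ennreal (inverse (real (Suc n))) = 1"
      by (subst ennreal_mult[symmetric]) (auto simp del: of_nat_Suc)
    ultimately show "emeasure \<mu> K \<le> ennreal (real (Suc n)) * M"
      by (simp add: mult.assoc[symmetric])
  qed
  moreover have "ennreal (real (Suc n)) * M < \<infinity>" for n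
    using M(1) by (simp add: ennreal_mult_less_top del: of_nat_Suc)
  ultimately have fin: "emeasure \<mu> (U n) < \<infinity>" for n
    by (meson order_le_less_trans)
  have "\<exists>L :: nat \<Rightarrow> 'g set. (\<forall>j. compact (L j) \<and> L j \<subseteq> U n) \<and> emeasure \<mu> (U n) = (SUP j. emeasure \<mu> (L j))"
    for n
  proof -
    have "{K. compact K \<and> K \<subseteq> U n} \<noteq> {}" by (auto intro: exI[of _ "{}"])
    from ennreal_SUP_countable_SUP[OF this, of "emeasure \<mu>"]
    obtain h :: "nat \<Rightarrow> ennreal" where h: "range h \<subseteq> emeasure \<mu> ` {K. compact K \<and> K \<subseteq> U n}"
      "Sup (emeasure \<mu> ` {K. compact K \<and> K \<subseteq> U n}) = Sup (range h)" by blast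
    then have "\<forall>j. \<exists>K. compact K \<and> K \<subseteq> U n \<and> h j = emeasure \<mu> K" by blast
    then obtain L where L: "\<And>j. compact (L j) \<and> L j \<subseteq> U n \<and> h j = emeasure \<mu> (L j)" by metis
    then have "range h = range (\<lambda>j. emeasure \<mu> (L j))" by auto
    then show ?thesis using L h(2) inner[rule_format, OF oU] by metis
  qed
  then obtain L :: "nat \<Rightarrow> nat \<Rightarrow> 'g set" where L: "\<And>n j. compact (L n j)" "\<And>n j. L n j \<subseteq> U n"
    "\<And>n. emeasure \<mu> (U n) = (SUP j. emeasure \<mu> (L n j))" by metis
  define S where "S n = (\<Union>j. L n j)" for n
  have Ss: "S n \<in> sets \<mu>" for n unfolding S_def using Ks L(1) by auto
  have "emeasure \<mu> (U n - S n) = 0" for n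
  proof -
    have "emeasure \<mu> (S n) = emeasure \<mu> (U n)"
    proof (rule antisym)
      show "emeasure \<mu> (S n) \<le> emeasure \<mu> (U n)"
        by (rule emeasure_mono) (use L(2) Us in \<open>auto simp: S_def\<close>)
      show "emeasure \<mu> (U n) \<le> emeasure \<mu> (S n)" unfolding L(3)
        by (rule SUP_least, rule emeasure_mono) (use Ss in \<open>auto simp: S_def\<close>)
    qed
    moreover have "S n \<subseteq> U n" using L(2) by (auto simp: S_def)
    ultimately show ?thesis using fin[of n] Us Ss
      by (subst emeasure_Diff) (auto simp: less_top)
  qed
  then have "U n - S n \<in> null_sets \<mu>" for n using Us Ss by auto
  then have null: "(\<Union>n. U n - S n) \<in> null_sets \<mu>" by blast
  \<comment> \<open>The doubly indexed compact sets, enumerated by pairs and accumulated into an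
    increasing sequence of compact sets.\<close>
  define P where "P k = (\<Union>p<k. L (fst (prod_decode p)) (snd (prod_decode p)))" for k :: nat
  have Pc: "compact (P k)" for k unfolding P_def by (rule compact_UN) (use L(1) in auto)
  have SP: "\<exists>k. x \<in> P k" if x: "x \<in> S n" for x n
  proof -
    obtain j where "x \<in> L n j" using x by (auto simp: S_def)
    then have "x \<in> P (Suc (prod_encode (n, j)))" unfolding P_def
      by (intro UN_I[of "prod_encode (n, j)"]) auto
    then show ?thesis by blast
  qed
  have incP: "incseq P" unfolding P_def by (intro monoI UN_mono) auto
  have "AE x in \<mu>. ennreal (f x) = (SUP k. ennreal (f x) * indicator (P k) x)"
  proof (rule AE_I'[OF null], rule subsetI, rule ccontr)
    fix x assume x: "x \<in> {x \<in> space \<mu>. ennreal (f x) \<noteq> (SUP k. ennreal (f x) * indicator (P k) x)}"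
      and nx: "x \<notin> (\<Union>n. U n - S n)"
    show False
    proof (cases "f x = 0")
      case True
      then show ?thesis using x by simp
    next
      case False
      then have "0 < f x" using f(2)[of x] by simp
      then obtain n where "x \<in> U n" using reals_Archimedean[of "f x"] by (auto simp: U_def)
      then obtain k where k: "x \<in> P k" using nx SP by blast
      have "(SUP k. ennreal (f x) * indicator (P k) x) = ennreal (f x)"
        by (rule antisym[OF SUP_least SUP_upper2[of k]]) (use k in \<open>auto simp: indicator_def\<close>)
      then show ?thesis using x by simp
    qed
  qed
  then have "(\<integral>\<^sup>+x. ennreal (f x) \<partial>\<mu>) = (\<integral>\<^sup>+x. (SUP k. ennreal (f x) * indicator (P k) x) \<partial>\<mu>)"
    by (rule nn_integral_cong_AE)
  also have "\<dots> = (SUP k. \<integral>\<^sup>+x. ennreal (f x) * indicator (P k) x \<partial>\<mu>)"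
  proof (rule nn_integral_monotone_convergence_SUP)
    show "incseq (\<lambda>k x. ennreal (f x) * indicator (P k) x)"
      using incP by (auto simp: incseq_def le_fun_def indicator_def)
    show "(\<lambda>x. ennreal (f x) * indicator (P k) x) \<in> borel_measurable \<mu>" for k
      using Ks[OF Pc] by measurable
  qed
  also have "\<dots> \<le> M" by (rule SUP_least) (rule M(2)[OF Pc])
  finally show ?thesis .
qed

section \<open>Square roots and resolvents in a C*-algebra\<close>

locale cstar =
  fixes sc :: "complex \<Rightarrow> 'a::{real_normed_algebra,banach} \<Rightarrow> 'a" and st :: "'a \<Rightarrow> 'a"
  assumes cstar: "cstar_algebra sc st"
begin

lemma sc_of_real: "sc (complex_of_real r) v = r *\<^sub>R v"
  and sc_sc: "sc (c * d) v = sc c (sc d v)"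
  and sc_add_left: "sc (c + d) v = sc c v + sc d v"
  and sc_add_right: "sc c (u + v) = sc c u + sc c v"
  and norm_sc: "norm (sc c v) = cmod c * norm v"
  and sc_mult_left: "sc c x * y = sc c (x * y)"
  and sc_mult_right: "x * sc c y = sc c (x * y)"
  and st_st: "st (st x) = x"
  and st_add: "st (x + y) = st x + st y"
  and st_sc: "st (sc c x) = sc (cnj c) (st x)"
  and st_mult: "st (x * y) = st y * st x"
  and norm_st_mult: "norm (st x * x) = (norm x)\<^sup>2"
  using cstar unfolding cstar_algebra_def complex_structure_def by metis+

lemma st_scaleR: "st (r *\<^sub>R x) = r *\<^sub>R st x"
  using st_sc[of "complex_of_real r" x] by (simp add: sc_of_real)

lemma st_minus: "st (- x) = - st x"
  using st_scaleR[of "-1" x] by simp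

lemma st_diff: "st (x - y) = st x - st y"
  using st_add[of x "- y"] by (simp add: st_minus)

lemma st_zero: "st 0 = 0"
  using st_scaleR[of 0 0] by simp

lemma st_sum: "st (sum f F) = (\<Sum>x\<in>F. st (f x))"
  by (induction F rule: infinite_finite_induct) (auto simp: st_zero st_add)

lemma norm_st: "norm (st x) = norm x"
proof -
  have le: "norm y \<le> norm (st y)" for y
  proof (cases "y = 0")
    case False
    have "norm y * norm y \<le> norm (st y) * norm y"
      using norm_st_mult[of y] norm_mult_ineq[of "st y" y] by (simp add: power2_eq_square)
    then show ?thesis using False by simp
  qed simp
  show ?thesis using le[of x] le[of "st x"] by (simp add: st_st)
qed

lemma norm_mult_st: "norm (x * st x) = (norm x)\<^sup>2"
  using norm_st_mult[of "st x"] by (simp add: st_st norm_st)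

lemma norm_sa_square: "st x = x \<Longrightarrow> norm (x * x) = (norm x)\<^sup>2"
  using norm_st_mult[of x] by simp

lemma bounded_linear_st: "bounded_linear st"
  by (rule bounded_linear_intro[where K = 1]) (auto simp: st_add st_scaleR norm_st)

lemmas tendsto_st = bounded_linear.tendsto[OF bounded_linear_st]

lemma positive_st_mult: "positive st (st x * x)" "positive st (x * st x)"
  unfolding positive_def by (blast, metis st_st)

lemma positive_imp_sa: "positive st a \<Longrightarrow> st a = a"
  unfolding positive_def by (auto simp: st_mult st_st)

lemma positive_scaleR:
  assumes "positive st a" "0 \<le> r"
  shows "positive st (r *\<^sub>R a)"
proof -
  obtain b where "a = st b * b" using assms(1) unfolding positive_def by blast
  then have "r *\<^sub>R a = st (sqrt r *\<^sub>R b) * (sqrt r *\<^sub>R b)" using assms(2) by (simp add: st_scaleR)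
  then show ?thesis unfolding positive_def by blast
qed

text \<open>A solution \<open>s\<close> of \<open>2 s = t + s\<^sup>2\<close> makes \<open>1 - s\<close> a square root of \<open>1 - t\<close>; in this form
  the square root needs neither a unit nor functional calculus.\<close>

lemma sqrt_one_minus:
  assumes t: "st t = t" "norm t < 1" "t * k = k * t"
  obtains s where "st s = s" "s * k = k * s" "2 *\<^sub>R s = t + s * s"
proof -
  \<comment> \<open>The radius \<open>norm t\<close> of the ball is also the contraction constant of
    \<open>f\<close> on it. Commutation with \<open>k\<close> is built into the set so that the
    fixed point inherits it.\<close>
  define S where "S = {s. norm s \<le> norm t \<and> st s = s \<and> s * k = k * s}"
  define f where "f s = (1/2) *\<^sub>R (t + s * s)" for s
  have "\<exists>!s\<in>S. f s = s"
  proof (rule Banach_fix[where c = "norm t"])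
    have "closed S" unfolding S_def
      by (intro closed_Collect_conj closed_Collect_le closed_Collect_eq continuous_intros
        bounded_linear.continuous_on[OF bounded_linear_st])
    then show "complete S" by (simp add: complete_eq_closed)
    show "S \<noteq> {}" using t(1,3) by (auto simp: S_def intro!: exI[of _ t])
    show "0 \<le> norm t" "norm t < 1" using t(2) by auto
    show "f ` S \<subseteq> S"
    proof (rule image_subsetI)
      fix s assume s: "s \<in> S"
      have "norm (s * s) \<le> norm s * norm s" by (rule norm_mult_ineq)
      also have "\<dots> \<le> norm t * 1" by (rule mult_mono) (use s t(2) in \<open>auto simp: S_def\<close>)
      finally have "norm (f s) \<le> norm t"
        unfolding f_def using norm_triangle_ineq[of t "s * s"] by simp
      moreover have "s * s * k = k * (s * s)"
        using s by (metis (mono_tags, lifting) S_def mem_Collect_eq mult.assoc)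
      ultimately show "f s \<in> S" using s t
        by (auto simp: S_def f_def st_scaleR st_add st_mult algebra_simps)
    qed
    fix x y assume xy: "x \<in> S" "y \<in> S"
    have "norm (x * x - y * y) = norm (x * (x - y) + (x - y) * y)" by (simp add: algebra_simps)
    also have "\<dots> \<le> norm (x * (x - y)) + norm ((x - y) * y)" by (rule norm_triangle_ineq)
    also have "\<dots> \<le> norm x * norm (x - y) + norm (x - y) * norm y"
      by (intro add_mono norm_mult_ineq)
    also have "\<dots> \<le> norm t * norm (x - y) + norm (x - y) * norm t"
      using xy by (intro add_mono mult_left_mono mult_right_mono) (auto simp: S_def)
    finally have "norm (x * x - y * y) \<le> 2 * (norm t * norm (x - y))" by simp
    moreover have "f x - f y = (1/2) *\<^sub>R (x * x - y * y)"
      unfolding f_def by (simp add: algebra_simps)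
    ultimately show "dist (f x) (f y) \<le> norm t * dist x y" by (simp add: dist_norm)
  qed
  then obtain s where s: "s \<in> S" "f s = s" by blast
  have "2 *\<^sub>R s = 2 *\<^sub>R f s" using s(2) by simp
  then show ?thesis using that[of s] s(1) by (auto simp: S_def f_def)
qed

text \<open>With \<open>s\<close> from \<open>sqrt_one_minus\<close>, the element
  \<open>b - s * b\<close> stands for the square root of \<open>1 - t\<close> applied to
  \<open>b\<close>; its absolute square is the compression of \<open>1 - t\<close>.\<close>

lemma positive_compress_one_minus:
  assumes t: "st t = t" "norm t < 1"
  shows "positive st (st b * b - st b * t * b)"
proof -
  obtain s where s: "st s = s" "2 *\<^sub>R s = t + s * s"
    using sqrt_one_minus[OF t, of 0] by auto
  have ss: "s * s = s + s - t" using s(2) by (simp add: scaleR_2 algebra_simps)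
  have "st (b - s * b) * (b - s * b) = st b * b - st b * s * b - st b * s * b + st b * (s * s) * b"
    by (simp add: st_diff st_mult s(1) algebra_simps)
  also have "\<dots> = st b * b - st b * t * b" by (simp add: ss algebra_simps)
  finally show ?thesis unfolding positive_def by metis
qed

text \<open>With \<open>c\<^sup>2 = 1 - k\<^sup>2\<close>, the elements \<open>c \<plusminus> \<i>k\<close> are unitary, so \<open>c\<close> and \<open>c\<^sup>2\<close> are contractions.\<close>

lemma norm_minus_square_mult_le:
  assumes k: "st k = k" "norm k < 1"
  shows "norm (x - k * k * x) \<le> norm x"
proof -
  have kk: "st (k * k) = k * k" "norm (k * k) < 1"
    using k norm_sa_square[OF k(1)] by (auto simp: st_mult power_less_one_iff)
  obtain s where s: "st s = s" "s * k = k * s" "2 *\<^sub>R s = k * k + s * s"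
    using sqrt_one_minus[OF kk, of k] by (auto simp: mult.assoc)
  have ss: "s * s = s + s - k * k" using s(3) by (simp add: scaleR_2 algebra_simps)
  have u: "norm (x - s * x + sc c (k * x)) = norm x" if c: "cnj c = - c" "c * c = -1" for c x
  proof -
    have c1: "sc c (sc c v) = - v" for v
      using sc_sc[of c c v] c sc_of_real[of "-1" v] by simp
    have cm: "sc (- c) v = - sc c v" for v
      using sc_sc[of "-1" c v] sc_of_real[of "-1" "sc c v"] by simp
    have scm: "sc c (- v) = - sc c v" for v
      using sc_sc[of c "-1" v] sc_of_real[of "-1" v] cm by simp
    have scd: "sc c (u - v) = sc c u - sc c v" for u v
      using sc_add_right[of c u "- v"] scm by simp
    have skx: "st x * s * (k * x) = st x * k * (s * x)"
      by (metis mult.assoc s(2))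
    have ssx: "s * (s * x) = s * x + s * x - k * (k * x)"
      using ss by (metis mult.assoc distrib_right left_diff_distrib)
    have "st (x - s * x + sc c (k * x)) = st x - st x * s - sc c (st x * k)"
      by (simp add: st_diff st_add st_mult st_sc c s(1) k(1) cm)
    then have "st (x - s * x + sc c (k * x)) * (x - s * x + sc c (k * x))
        = (st x - st x * s - sc c (st x * k)) * (x - s * x + sc c (k * x))" by simp
    also have "\<dots> = st x * x - st x * (s * x) - st x * (s * x) + st x * (s * (s * x)) + st x * (k * (k * x))"
      using skx
      by (simp add: algebra_simps sc_mult_left sc_mult_right sc_add_right c1 scd)
    also have "\<dots> = st x * x" by (simp add: ssx algebra_simps)
    finally show ?thesis
      using norm_st_mult[of "x - s * x + sc c (k * x)"] norm_st_mult[of x] by simp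
  qed
  have half: "norm (y - s * y) \<le> norm y" for y
  proof -
    have im: "sc (- \<i>) v = - sc \<i> v" for v
      using sc_sc[of "-1" \<i> v] sc_of_real[of "-1" "sc \<i> v"] by simp
    have "2 *\<^sub>R (y - s * y) = (y - s * y + sc \<i> (k * y)) + (y - s * y + sc (- \<i>) (k * y))"
      by (simp add: im scaleR_2)
    then have "norm (2 *\<^sub>R (y - s * y)) \<le> norm y + norm y"
      using norm_triangle_ineq[of "y - s * y + sc \<i> (k * y)" "y - s * y + sc (- \<i>) (k * y)"]
        u[of \<i> y] u[of "- \<i>" y] by simp
    then show ?thesis by simp
  qed
  \<comment> \<open>\<open>1 - k * k\<close> is the square of \<open>1 - s\<close>, so the
    contraction estimate applies twice.\<close>
  have "s * (s * x) = s * x + s * x - k * k * x"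
    using arg_cong[OF ss, of "\<lambda>v. v * x"] by (simp add: algebra_simps)
  then have "x - k * k * x = (x - s * x) - s * (x - s * x)"
    by (simp add: right_diff_distrib)
  then show ?thesis using half[of "x - s * x"] half[of x] by (metis order_trans)
qed

text \<open>\<open>R\<close> is the operator \<open>e (e + k\<^sup>2)\<^sup>-\<^sup>1\<close> on the algebra.\<close>

lemma resolvent:
  assumes k: "st k = k" "norm k < 1" and e: "0 < e"
  obtains R where "\<And>y. e *\<^sub>R R y + k * k * R y = e *\<^sub>R y" "\<And>y. norm (R y) \<le> norm y"
    "\<And>y z. e *\<^sub>R z + k * k * z = e *\<^sub>R y \<Longrightarrow> z = R y"
proof -
  have contr: "norm (x - k * k * x) \<le> norm x" for x by (rule norm_minus_square_mult_le[OF k])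
  have bound: "norm z \<le> norm y" if "e *\<^sub>R z + k * k * z = e *\<^sub>R y" for y z
  proof -
    \<comment> \<open>Writing the equation in terms of the contraction \<open>1 - k * k\<close>
      yields the norm bound here, and below turns existence into a fixed point problem with constant
      \<open>1 / (1 + e)\<close>.\<close>
    have "(1 + e) *\<^sub>R z = e *\<^sub>R y + (z - k * k * z)" using that by (simp add: algebra_simps)
    then have "norm ((1 + e) *\<^sub>R z) \<le> norm (e *\<^sub>R y) + norm (z - k * k * z)"
      by (metis norm_triangle_ineq)
    also have "\<dots> \<le> e * norm y + norm z" using e contr[of z] by simp
    finally have "(1 + e) * norm z \<le> e * norm y + norm z" using e by simp
    then have "e * norm z \<le> e * norm y" by (simp add: algebra_simps)
    then show ?thesis using e by simp
  qed
  have ex: "\<exists>z. e *\<^sub>R z + k * k * z = e *\<^sub>R y" for y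
  proof -
    define f where "f z = inverse (1 + e) *\<^sub>R (e *\<^sub>R y + (z - k * k * z))" for z
    have "\<exists>!z\<in>UNIV. f z = z"
    proof (rule Banach_fix[where c = "inverse (1 + e)"])
      show "inverse (1 + e) < 1" using e by (simp add: inverse_less_1_iff)
      fix u v :: 'a
      have "f u - f v = inverse (1 + e) *\<^sub>R ((u - v) - k * k * (u - v))"
        unfolding f_def by (simp add: algebra_simps)
      then show "dist (f u) (f v) \<le> inverse (1 + e) * dist u v"
        using contr[of "u - v"] e by (simp add: dist_norm)
    qed (use e in \<open>auto simp: complete_UNIV\<close>)
    then obtain z where z: "f z = z" by blast
    have "(1 + e) *\<^sub>R z = (1 + e) *\<^sub>R f z" using z by simp
    also have "\<dots> = e *\<^sub>R y + (z - k * k * z)" using e by (simp add: f_def)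
    finally show ?thesis by (intro exI[of _ z]) (simp add: algebra_simps)
  qed
  then obtain R where R: "\<And>y. e *\<^sub>R R y + k * k * R y = e *\<^sub>R y" by metis
  have uniq: "z = R y" if "e *\<^sub>R z + k * k * z = e *\<^sub>R y" for y z
  proof -
    have "e *\<^sub>R (z - R y) + k * k * (z - R y) = e *\<^sub>R 0" using R[of y] that by (simp add: algebra_simps)
    from bound[OF this] show ?thesis by simp
  qed
  show ?thesis using that[OF R bound[OF R] uniq] by blast
qed

text \<open>Since \<open>R\<close> commutes with right multiplications, \<open>Z = R d\<close> satisfies
  \<open>Z Z\<^sup>* = R (R (d d\<^sup>*)\<^sup>*)\<close>; iterating this reduces the bound to \<open>R (k\<^sup>2)\<close>, which is of order \<open>e\<close>.\<close>

lemma resolvent_small: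
  assumes k: "st k = k" "norm k < 1" and e: "0 < e" and d: "d * st d = c *\<^sub>R k"
  obtains z where "e *\<^sub>R z + k * k * z = e *\<^sub>R d" "(norm z) ^ 4 \<le> c\<^sup>2 * (2 * e)"
proof -
  obtain R where R: "\<And>y. e *\<^sub>R R y + k * k * R y = e *\<^sub>R y" and bound: "\<And>y. norm (R y) \<le> norm y"
    and uniq: "\<And>y z. e *\<^sub>R z + k * k * z = e *\<^sub>R y \<Longrightarrow> z = R y"
    using resolvent[OF k e] by blast
  have Rmult: "R y * v = R (y * v)" for y v
    by (rule uniq) (use arg_cong[OF R[of y], of "\<lambda>w. w * v"] in \<open>simp add: algebra_simps\<close>)
  have sq: "(norm (R y))\<^sup>2 \<le> norm (R (y * st y))" for y
  proof -
    have "st (R (y * st y)) = y * st (R y)" unfolding Rmult[symmetric] by (simp add: st_mult st_st)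
    then have "R y * st (R y) = R (st (R (y * st y)))" by (simp add: Rmult)
    then show ?thesis using norm_mult_st[of "R y"] bound by (metis norm_st)
  qed
  have "norm (R (k * k)) \<le> 2 * e"
  proof -
    \<comment> \<open>In commuting symbols this is
      \<open>e k\<^sup>2 / (e + k\<^sup>2) = e (1 - e / (e + k\<^sup>2))\<close>. Taking for
      \<open>x\<close> the adjoint of \<open>R (k * k)\<close> turns it into a norm bound through
      the C*-identity.\<close>
    have eq: "R (k * k) * x = e *\<^sub>R (x - R x)" for x
    proof -
      have "e *\<^sub>R (e *\<^sub>R (x - R x)) + k * k * (e *\<^sub>R (x - R x))
          = e *\<^sub>R (e *\<^sub>R x + k * k * x - (e *\<^sub>R R x + k * k * R x))"
        by (simp add: algebra_simps)
      also have "\<dots> = e *\<^sub>R (k * k * x)" by (simp add: R)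
      finally show ?thesis using uniq Rmult by metis
    qed
    have n: "norm (R (k * k) * x) \<le> 2 * e * norm x" for x
    proof -
      have "norm (x - R x) \<le> 2 * norm x"
        using bound[of x] norm_triangle_ineq4[of x "R x"] by simp
      then have "e * norm (x - R x) \<le> e * (2 * norm x)" using e by simp
      then show ?thesis using e by (simp add: eq)
    qed
    have "(norm (R (k * k)))\<^sup>2 \<le> 2 * e * norm (R (k * k))"
      using n[of "st (R (k * k))"] by (simp add: norm_mult_st norm_st)
    then show ?thesis using e by (cases "R (k * k) = 0") (auto simp: power2_eq_square)
  qed
  then have 1: "(norm (R k))\<^sup>2 \<le> 2 * e" using sq[of k] k(1) by simp
  have "R (c *\<^sub>R k) = c *\<^sub>R R k"
    by (rule uniq[symmetric]) (use arg_cong[OF R[of k], of "\<lambda>v. c *\<^sub>R v"] in \<open>simp add: algebra_simps\<close>)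
  then have 2: "(norm (R d))\<^sup>2 \<le> \<bar>c\<bar> * norm (R k)" using sq[of d] d by simp
  \<comment> \<open>The fourth power records two passages to squares: from \<open>R d\<close> to
    \<open>R k\<close>, and from \<open>R k\<close> to \<open>R (k * k)\<close>.\<close>
  have "(norm (R d)) ^ 4 = ((norm (R d))\<^sup>2)\<^sup>2" by simp
  also have "\<dots> \<le> (\<bar>c\<bar> * norm (R k))\<^sup>2" using 2 by (rule power_mono) simp
  also have "\<dots> = c\<^sup>2 * (norm (R k))\<^sup>2" by (simp add: power_mult_distrib)
  also have "\<dots> \<le> c\<^sup>2 * (2 * e)" using 1 by (rule mult_left_mono) simp
  finally show ?thesis using that R by blast
qed

end

section \<open>The GNS space of a trace\<close>

locale gns = cstar sc st
  for sc :: "complex \<Rightarrow> 'a::{real_normed_algebra,banach} \<Rightarrow> 'a" and st :: "'a \<Rightarrow> 'a" +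
  fixes \<tau> :: "'a \<Rightarrow> ennreal"
    and hsc :: "complex \<Rightarrow> 'h::{real_inner,complete_space} \<Rightarrow> 'h" and \<iota> :: "'a \<Rightarrow> 'h"
  assumes trace: "is_trace st \<tau>" and lsc: "lsc_on_positive st \<tau>"
    and gns: "gns_space sc st \<tau> hsc \<iota>"
begin

abbreviation "N \<equiv> Ntau st \<tau>"

lemma trace_add: "positive st a \<Longrightarrow> positive st b \<Longrightarrow> \<tau> (a + b) = \<tau> a + \<tau> b"
  and trace_scaleR: "0 \<le> r \<Longrightarrow> positive st a \<Longrightarrow> \<tau> (r *\<^sub>R a) = ennreal r * \<tau> a"
  and trace_flip: "\<tau> (st x * x) = \<tau> (x * st x)"
  using trace unfolding is_trace_def by blast+

lemma hsc_of_real: "hsc (complex_of_real r) v = r *\<^sub>R v"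
  and hsc_hsc: "hsc (c * d) v = hsc c (hsc d v)"
  and hsc_add_left: "hsc (c + d) v = hsc c v + hsc d v"
  and hsc_add_right: "hsc c (u + v) = hsc c u + hsc c v"
  and norm_hsc: "norm (hsc c v) = cmod c * norm v"
  and \<iota>_add: "a \<in> N \<Longrightarrow> b \<in> N \<Longrightarrow> \<iota> (a + b) = \<iota> a + \<iota> b"
  and \<iota>_sc: "a \<in> N \<Longrightarrow> \<iota> (sc c a) = hsc c (\<iota> a)"
  and norm_\<iota>: "a \<in> N \<Longrightarrow> ennreal ((norm (\<iota> a))\<^sup>2) = \<tau> (st a * a)"
  and dense_\<iota>: "closure (\<iota> ` N) = UNIV"
  using gns unfolding gns_space_def complex_structure_def by metis+

section \<open>Elements of finite square trace\<close>

lemma N_iff: "a \<in> N \<longleftrightarrow> \<tau> (st a * a) < \<infinity>"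
  by (simp add: Ntau_def)

text \<open>Holding in the extended reals, without finiteness, this yields closure of
  \<open>N\<close> under addition.\<close>

lemma trace_parallelogram:
  "\<tau> (st (a + b) * (a + b)) + \<tau> (st (a - b) * (a - b)) = 2 * \<tau> (st a * a) + 2 * \<tau> (st b * b)"
proof -
  have "st (a + b) * (a + b) + st (a - b) * (a - b) = 2 *\<^sub>R (st a * a) + 2 *\<^sub>R (st b * b)"
    by (simp add: st_add st_diff algebra_simps scaleR_2)
  then have "\<tau> (st (a + b) * (a + b) + st (a - b) * (a - b)) = \<tau> (2 *\<^sub>R (st a * a) + 2 *\<^sub>R (st b * b))"
    by simp
  then show ?thesis
    by (simp add: trace_add trace_scaleR positive_st_mult positive_scaleR)
qed

lemma trace_sc: "\<tau> (st (sc c a) * sc c a) = ennreal ((cmod c)\<^sup>2) * \<tau> (st a * a)"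
proof -
  have "st (sc c a) * sc c a = sc (c * cnj c) (st a * a)"
    by (simp add: st_sc sc_mult_left sc_mult_right sc_sc)
  also have "\<dots> = (cmod c)\<^sup>2 *\<^sub>R (st a * a)"
    by (simp add: complex_norm_square[symmetric] sc_of_real del: of_real_power)
  finally show ?thesis by (simp add: trace_scaleR positive_st_mult)
qed

lemma N_sc: "a \<in> N \<Longrightarrow> sc c a \<in> N"
  by (simp add: N_iff trace_sc ennreal_mult_less_top)

lemma N_scaleR: "a \<in> N \<Longrightarrow> r *\<^sub>R a \<in> N"
  using N_sc[of a "complex_of_real r"] by (simp add: sc_of_real)

lemma N_add:
  assumes "a \<in> N" "b \<in> N"
  shows "a + b \<in> N"
proof -
  have "2 * \<tau> (st a * a) + 2 * \<tau> (st b * b) < \<infinity>"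
    using assms by (simp add: N_iff ennreal_mult_less_top)
  then have "\<tau> (st (a + b) * (a + b)) + \<tau> (st (a - b) * (a - b)) < \<infinity>"
    by (simp add: trace_parallelogram)
  then show ?thesis by (simp add: N_iff)
qed

lemma N_minus: "a \<in> N \<Longrightarrow> - a \<in> N"
  using N_scaleR[of a "-1"] by simp

lemma N_diff: "a \<in> N \<Longrightarrow> b \<in> N \<Longrightarrow> a - b \<in> N"
  using N_add[of a "- b"] N_minus[of b] by simp

lemma N_zero: "0 \<in> N"
  using trace_scaleR[of 0 "st 0 * 0"] positive_st_mult(1)[of 0] by (simp add: N_iff)

lemma N_sum: "(\<And>i. i \<in> F \<Longrightarrow> f i \<in> N) \<Longrightarrow> (\<Sum>i\<in>F. f i) \<in> N"
  by (induction F rule: infinite_finite_induct) (auto simp: N_zero N_add)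

lemma \<iota>_scaleR: "a \<in> N \<Longrightarrow> \<iota> (r *\<^sub>R a) = r *\<^sub>R \<iota> a"
  using \<iota>_sc[of a "complex_of_real r"] by (simp add: sc_of_real hsc_of_real)

lemma \<iota>_minus: "a \<in> N \<Longrightarrow> \<iota> (- a) = - \<iota> a"
  using \<iota>_scaleR[of a "-1"] by simp

lemma \<iota>_diff: "a \<in> N \<Longrightarrow> b \<in> N \<Longrightarrow> \<iota> (a - b) = \<iota> a - \<iota> b"
  using \<iota>_add[of a "- b"] N_minus[of b] by (simp add: \<iota>_minus)

lemma \<iota>_zero: "\<iota> 0 = 0"
  using \<iota>_scaleR[OF N_zero, of 0] by simp

lemma \<iota>_sum: "(\<And>i. i \<in> F \<Longrightarrow> f i \<in> N) \<Longrightarrow> \<iota> (\<Sum>i\<in>F. f i) = (\<Sum>i\<in>F. \<iota> (f i))"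
  by (induction F rule: infinite_finite_induct) (auto simp: \<iota>_zero \<iota>_add N_sum)

text \<open>By polarisation, the real inner product of \<open>a\<close> and \<open>b\<close> depends only on the real part of
  \<open>a\<^sup>* b\<close>; this replaces the linear extension of the trace.\<close>

lemma inner_\<iota>_eqI:
  assumes N: "a \<in> N" "b \<in> N" "a' \<in> N" "b' \<in> N"
    and eq: "st a * b + st b * a = st a' * b' + st b' * a'"
  shows "inner (\<iota> a) (\<iota> b) = inner (\<iota> a') (\<iota> b')"
proof -
  \<comment> \<open>Opposite signs are paired on each side, so that the hypothesis equates two sums
    of positive elements and no difference of traces is ever taken.\<close>
  have "st (a + b) * (a + b) + st (a' - b') * (a' - b')
      = st a * a + st b * b + st a' * a' + st b' * b' + (st a * b + st b * a) - (st a' * b' + st b' * a')"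
    by (simp add: st_add st_diff algebra_simps)
  moreover have "st (a' + b') * (a' + b') + st (a - b) * (a - b)
      = st a * a + st b * b + st a' * a' + st b' * b' + (st a' * b' + st b' * a') - (st a * b + st b * a)"
    by (simp add: st_add st_diff algebra_simps)
  ultimately have "\<tau> (st (a + b) * (a + b) + st (a' - b') * (a' - b'))
      = \<tau> (st (a' + b') * (a' + b') + st (a - b) * (a - b))" by (simp add: eq)
  then have "\<tau> (st (a + b) * (a + b)) + \<tau> (st (a' - b') * (a' - b'))
      = \<tau> (st (a' + b') * (a' + b')) + \<tau> (st (a - b) * (a - b))"
    by (simp add: trace_add positive_st_mult)
  then have "ennreal ((norm (\<iota> (a + b)))\<^sup>2 + (norm (\<iota> (a' - b')))\<^sup>2)
      = ennreal ((norm (\<iota> (a' + b')))\<^sup>2 + (norm (\<iota> (a - b)))\<^sup>2)"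
    using N by (simp add: norm_\<iota> N_add N_diff)
  then have "(norm (\<iota> a + \<iota> b))\<^sup>2 + (norm (\<iota> a' - \<iota> b'))\<^sup>2
      = (norm (\<iota> a' + \<iota> b'))\<^sup>2 + (norm (\<iota> a - \<iota> b))\<^sup>2"
    using N by (simp add: \<iota>_add \<iota>_diff flip: ennreal_plus)
  then show ?thesis
    by (simp add: power2_norm_eq_inner inner_simps inner_commute)
qed

lemma N_st: "a \<in> N \<Longrightarrow> st a \<in> N"
  by (simp add: N_iff st_st flip: trace_flip)

lemma norm_\<iota>_st:
  assumes "a \<in> N"
  shows "norm (\<iota> (st a)) = norm (\<iota> a)"
proof -
  have "ennreal ((norm (\<iota> (st a)))\<^sup>2) = ennreal ((norm (\<iota> a))\<^sup>2)"
    using norm_\<iota>[OF N_st[OF assms]] norm_\<iota>[OF assms] by (simp add: st_st trace_flip)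
  then show ?thesis by simp
qed

text \<open>The adjoint is an additive isometry of \<open>N\<close>, so polarisation applies. The
  complex inner product would be conjugated; the real one is preserved.\<close>

lemma inner_\<iota>_st:
  assumes "a \<in> N" "b \<in> N"
  shows "inner (\<iota> (st a)) (\<iota> (st b)) = inner (\<iota> a) (\<iota> b)"
proof -
  have "norm (\<iota> (st a) + \<iota> (st b)) = norm (\<iota> a + \<iota> b)"
    using norm_\<iota>_st[OF N_add[OF assms]] assms by (simp add: st_add \<iota>_add N_st)
  then have "(norm (\<iota> (st a) + \<iota> (st b)))\<^sup>2 = (norm (\<iota> a + \<iota> b))\<^sup>2" by simp
  moreover have "(norm (\<iota> (st a)))\<^sup>2 = (norm (\<iota> a))\<^sup>2" "(norm (\<iota> (st b)))\<^sup>2 = (norm (\<iota> b))\<^sup>2"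
    using assms by (simp_all add: norm_\<iota>_st)
  ultimately show ?thesis
    by (simp add: power2_norm_eq_inner inner_simps inner_commute)
qed

text \<open>\<open>st b * t * b\<close> is dominated by \<open>st b * b\<close> once
  \<open>norm t < 1\<close>, and additivity makes this a trace inequality. The choice of
  \<open>r\<close> gives \<open>norm t = 1/2\<close>; the resulting constant \<open>sqrt 2\<close>
  is rounded up to 2.\<close>

lemma
  assumes b: "b \<in> N"
  shows N_mult_left: "x * b \<in> N" and norm_\<iota>_mult_left: "norm (\<iota> (x * b)) \<le> 2 * norm x * norm (\<iota> b)"
proof -
  have "x * b \<in> N \<and> norm (\<iota> (x * b)) \<le> 2 * norm x * norm (\<iota> b)"
  proof (cases "x = 0")
    case True
    then show ?thesis by (simp add: N_zero \<iota>_zero)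
  next
    case False
    define r where "r = inverse (2 * (norm x)\<^sup>2)"
    have r: "0 < r" using False by (simp add: r_def)
    define t where "t = r *\<^sub>R (st x * x)"
    have "norm t = r * (norm x)\<^sup>2" using r by (simp add: t_def norm_st_mult)
    also have "\<dots> = 1/2" using False by (simp add: r_def)
    finally have "norm t < 1" by simp
    moreover have "st t = t" by (simp add: t_def st_scaleR st_mult st_st)
    ultimately have p: "positive st (st b * b - st b * t * b)" by (rule positive_compress_one_minus[rotated])
    have t: "st b * t * b = r *\<^sub>R (st (x * b) * (x * b))"
      by (simp add: t_def st_mult mult.assoc)
    have "\<tau> (st b * b) = \<tau> (r *\<^sub>R (st (x * b) * (x * b)) + (st b * b - st b * t * b))" by (simp add: t)
    also have "\<dots> = ennreal r * \<tau> (st (x * b) * (x * b)) + \<tau> (st b * b - st b * t * b)"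
      using r p by (simp add: trace_add trace_scaleR positive_scaleR positive_st_mult)
    finally have le: "ennreal r * \<tau> (st (x * b) * (x * b)) \<le> \<tau> (st b * b)" by simp
    then have "ennreal r * \<tau> (st (x * b) * (x * b)) < \<infinity>" using b N_iff le_less_trans by blast
    then have xb: "x * b \<in> N" using r by (auto simp: N_iff ennreal_mult_less_top)
    then have "ennreal (r * (norm (\<iota> (x * b)))\<^sup>2) \<le> ennreal ((norm (\<iota> b))\<^sup>2)"
      using le r by (simp add: norm_\<iota> b ennreal_mult)
    then have "r * (norm (\<iota> (x * b)))\<^sup>2 \<le> (norm (\<iota> b))\<^sup>2" by simp
    then have "(norm (\<iota> (x * b)))\<^sup>2 \<le> 2 * (norm x)\<^sup>2 * (norm (\<iota> b))\<^sup>2"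
      using False by (simp add: r_def field_simps)
    also have "\<dots> \<le> (2 * norm x * norm (\<iota> b))\<^sup>2" by (simp add: power_mult_distrib)
    finally have "norm (\<iota> (x * b)) \<le> 2 * norm x * norm (\<iota> b)" by (rule power2_le_imp_le) simp
    then show ?thesis using xb by blast
  qed
  then show "x * b \<in> N" "norm (\<iota> (x * b)) \<le> 2 * norm x * norm (\<iota> b)" by auto
qed

lemma N_mult_right:
  assumes "b \<in> N"
  shows "b * x \<in> N"
  using N_st[OF N_mult_left[OF N_st[OF assms], of "st x"]] by (simp add: st_mult st_st)

lemma inner_\<iota>_mult_left:
  assumes "a \<in> N" "b \<in> N"
  shows "inner (\<iota> (x * a)) (\<iota> b) = inner (\<iota> a) (\<iota> (st x * b))"
  by (rule inner_\<iota>_eqI) (auto simp: assms N_mult_left st_mult st_st mult.assoc)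

text \<open>The adjoint exchanges right and left multiplication; the trace property enters through
  \<open>inner_\<iota>_st\<close>.\<close>

lemma inner_\<iota>_mult_right:
  assumes "a \<in> N" "b \<in> N"
  shows "inner (\<iota> (a * x)) (\<iota> b) = inner (\<iota> a) (\<iota> (b * st x))"
proof -
  have "inner (\<iota> (a * x)) (\<iota> b) = inner (\<iota> (st x * st a)) (\<iota> (st b))"
    using inner_\<iota>_st[of "a * x" b] assms by (simp add: N_mult_right st_mult)
  also have "\<dots> = inner (\<iota> (st a)) (\<iota> (st (b * st x)))"
    using assms by (simp add: inner_\<iota>_mult_left N_st st_mult)
  also have "\<dots> = inner (\<iota> a) (\<iota> (b * st x))"
    using assms by (simp add: inner_\<iota>_st N_mult_right)
  finally show ?thesis .
qed

lemma inner_\<iota>_positive: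
  assumes "positive st c" "b \<in> N"
  shows "0 \<le> inner (\<iota> b) (\<iota> (c * b))" "0 \<le> inner (\<iota> b) (\<iota> (b * c))"
proof -
  obtain u where u: "c = st u * u" using assms(1) unfolding positive_def by blast
  show "0 \<le> inner (\<iota> b) (\<iota> (c * b))"
    using inner_\<iota>_mult_left[of b "u * b" u] assms(2)
    by (metis N_mult_left inner_ge_zero mult.assoc u)
  have "inner (\<iota> (b * st u)) (\<iota> (b * st u)) = inner (\<iota> b) (\<iota> (b * c))"
    using inner_\<iota>_mult_right[of b "b * st u" "st u"] assms(2) by (simp add: u N_mult_right mult.assoc st_st)
  then show "0 \<le> inner (\<iota> b) (\<iota> (b * c))" by (metis inner_ge_zero)
qed

section \<open>Elements of finite trace and lower semicontinuity\<close>

lemma Mtau_posE: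
  assumes "t \<in> Mtau_pos st \<tau>"
  obtains c where "c \<in> N" "t = st c * c"
  using assms unfolding Mtau_pos_def positive_def by (auto simp: N_iff)

text \<open>An element \<open>st c * c\<close> with \<open>c\<close> in \<open>N\<close> lies in the
  left ideal \<open>N\<close>; this is how elements of finite trace become vectors.\<close>

lemma Mtau_pos_N: "t \<in> Mtau_pos st \<tau> \<Longrightarrow> t \<in> N"
  by (metis Mtau_posE N_mult_left)

lemma Mtau_N: "t \<in> Mtau sc st \<tau> \<Longrightarrow> t \<in> N"
  unfolding Mtau_def cspan_def using Mtau_pos_N by (auto intro!: N_sum N_sc)

lemma trace_lsc:
  assumes v: "(v \<longlongrightarrow> w) F" and t: "t < \<tau> (st w * w)"
  shows "\<forall>\<^sub>F x in F. t < \<tau> (st (v x) * v x)"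
proof -
  have "openin (top_of_set (Collect (positive st))) {a. positive st a \<and> t < \<tau> a}"
    using lsc unfolding lsc_on_positive_def by blast
  then obtain O' where O': "open O'" "{a. positive st a \<and> t < \<tau> a} = Collect (positive st) \<inter> O'"
    unfolding openin_open by blast
  have "((\<lambda>x. st (v x) * v x) \<longlongrightarrow> st w * w) F"
    by (intro tendsto_mult tendsto_st v)
  moreover have "st w * w \<in> O'" using O'(2) t positive_st_mult by blast
  ultimately have "\<forall>\<^sub>F x in F. st (v x) * v x \<in> O'" using O'(1) topological_tendstoD by blast
  then show ?thesis by eventually_elim (use O'(2) positive_st_mult in blast)
qed

text \<open>The map \<open>\<iota>\<close> need not be continuous for the algebra norm; this is the
  form in which lower semicontinuity of the trace replaces continuity.\<close>

lemma norm_\<iota>_lsc: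
  assumes v: "(v \<longlongrightarrow> w) F" and N: "\<And>x. v x \<in> N" "w \<in> N" and t: "t < (norm (\<iota> w))\<^sup>2"
  shows "\<forall>\<^sub>F x in F. t < (norm (\<iota> (v x)))\<^sup>2"
proof (cases "0 \<le> t")
  case True
  then have "ennreal t < \<tau> (st w * w)" using t N by (simp add: ennreal_less_iff flip: norm_\<iota>)
  from trace_lsc[OF v this] show ?thesis
    by eventually_elim (use True N in \<open>simp add: ennreal_less_iff flip: norm_\<iota>\<close>)
next
  case False
  then show ?thesis by (intro always_eventually allI) (smt (verit) zero_le_power2)
qed

text \<open>The vectors \<open>d - R d = e\<^sup>-\<^sup>1 k\<^sup>2 R d\<close> converge to \<open>d\<close> in the algebra, and
  \<open>\<parallel>d - R d\<parallel>\<^sup>2 \<le> \<parallel>d\<parallel>\<^sup>2 - \<parallel>R d\<parallel>\<^sup>2\<close> in the GNS space; lower semicontinuity of the trace forces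
  \<open>R d\<close> to vanish in the limit.\<close>

lemma left_multiplication_nondegenerate:
  assumes d: "d \<in> N" and \<delta>: "0 < \<delta>"
  obtains x z where "z \<in> N" "norm (\<iota> d - \<iota> (x * z)) < \<delta>"
proof -
  \<comment> \<open>The summand 1 gives \<open>norm k < 1\<close> and keeps \<open>c\<close>
    positive when \<open>d = 0\<close>.\<close>
  define c where "c = (norm d)\<^sup>2 + 1"
  have c: "0 < c" by (simp add: c_def add_nonneg_pos)
  define k where "k = inverse c *\<^sub>R (d * st d)"
  have dk: "d * st d = c *\<^sub>R k" using c by (simp add: k_def)
  have "norm k = inverse c * (norm d)\<^sup>2" using c by (simp add: k_def norm_mult_st)
  also have "\<dots> < inverse c * c" using c by (intro mult_strict_left_mono) (auto simp: c_def)
  finally have k: "st k = k" "norm k < 1"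
    using c by (simp_all add: k_def st_scaleR st_mult st_st)
  have kN: "k \<in> N" unfolding k_def by (intro N_scaleR N_mult_right d)
  define e where "e n = inverse (real (Suc n))" for n
  have e: "0 < e n" for n by (simp add: e_def)
  have "\<forall>n. \<exists>z. e n *\<^sub>R z + k * k * z = e n *\<^sub>R d \<and> (norm z) ^ 4 \<le> c\<^sup>2 * (2 * e n)"
    using resolvent_small[OF k e dk] by metis
  then obtain z where z: "\<And>n. e n *\<^sub>R z n + k * k * z n = e n *\<^sub>R d"
    "\<And>n. (norm (z n)) ^ 4 \<le> c\<^sup>2 * (2 * e n)" by metis
  have "(\<lambda>n. c\<^sup>2 * (2 * e n)) \<longlonglongrightarrow> c\<^sup>2 * (2 * 0)"
    unfolding e_def by (intro tendsto_intros LIMSEQ_inverse_real_of_nat)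
  then have lim: "(\<lambda>n. c\<^sup>2 * (2 * e n)) \<longlonglongrightarrow> 0" by simp
  have "(\<lambda>n. (norm (z n)) ^ 4) \<longlonglongrightarrow> 0"
    by (rule Lim_null_comparison[OF _ lim]) (use z(2) in simp)
  from tendsto_real_root[OF this, of 4] have "(\<lambda>n. norm (z n)) \<longlonglongrightarrow> 0"
    by (simp add: real_root_power_cancel)
  then have z0: "z \<longlonglongrightarrow> 0" by (rule tendsto_norm_zero_cancel)
  define x where "x n = inverse (e n) *\<^sub>R (k * k)" for n
  have dz: "d - z n = x n * z n" for n
  proof -
    have "k * k * z n = e n *\<^sub>R (d - z n)" using z(1)[of n] by (simp add: algebra_simps)
    then show ?thesis using e[of n] by (simp add: x_def)
  qed
  have kkz: "k * k * z n \<in> N" for n using N_mult_right[OF kN, of "k * z n"] by (simp add: mult.assoc)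
  then have xz: "x n * z n \<in> N" for n by (simp add: x_def N_scaleR)
  then have zN: "z n \<in> N" for n
    using N_diff[OF d xz[of n]] by (simp flip: dz)
  \<comment> \<open>Pairing the resolvent equation with \<open>z n\<close>: the term with
    \<open>k * k\<close> is nonnegative, being the squared norm of
    \<open>\<iota> (k * z n)\<close>.\<close>
  have "(norm (\<iota> (z n)))\<^sup>2 \<le> inner (\<iota> (z n)) (\<iota> d)" for n
  proof -
    have "e n * inner (\<iota> (z n)) (\<iota> d) = inner (\<iota> (z n)) (\<iota> (e n *\<^sub>R z n + k * k * z n))"
      by (simp add: z(1) \<iota>_scaleR d)
    also have "\<dots> = e n * (norm (\<iota> (z n)))\<^sup>2 + inner (\<iota> (z n)) (\<iota> (k * (k * z n)))"
      using zN kkz by (simp add: \<iota>_add \<iota>_scaleR N_scaleR inner_add_right power2_norm_eq_inner mult.assoc)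
    also have "inner (\<iota> (z n)) (\<iota> (k * (k * z n))) = inner (\<iota> (k * z n)) (\<iota> (k * z n))"
      using inner_\<iota>_mult_left[of "z n" "k * z n" k] zN k by (simp add: N_mult_left)
    finally have "e n * (norm (\<iota> (z n)))\<^sup>2 \<le> e n * inner (\<iota> (z n)) (\<iota> d)"
      using inner_ge_zero[of "\<iota> (k * z n)"] by linarith
    then show ?thesis using e[of n] by simp
  qed
  moreover have "(norm (\<iota> (d - z n)))\<^sup>2
      = (norm (\<iota> d))\<^sup>2 - 2 * inner (\<iota> (z n)) (\<iota> d) + (norm (\<iota> (z n)))\<^sup>2" for n
    using d zN by (simp add: \<iota>_diff power2_norm_eq_inner inner_simps inner_commute)
  ultimately have le: "(norm (\<iota> (d - z n)))\<^sup>2 \<le> (norm (\<iota> d))\<^sup>2 - (norm (\<iota> (z n)))\<^sup>2" for n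
    by (smt (verit))
  have "\<forall>\<^sub>F n in sequentially. (norm (\<iota> d))\<^sup>2 - \<delta>\<^sup>2 < (norm (\<iota> (d - z n)))\<^sup>2"
    by (rule norm_\<iota>_lsc[where w = d]) (use d zN \<delta> tendsto_diff[OF tendsto_const z0, of d] N_diff in auto)
  then obtain n where "(norm (\<iota> d))\<^sup>2 - \<delta>\<^sup>2 < (norm (\<iota> (d - z n)))\<^sup>2"
    using eventually_happens'[OF sequentially_bot] by blast
  then have "(norm (\<iota> (z n)))\<^sup>2 < \<delta>\<^sup>2" using le[of n] by simp
  then have "norm (\<iota> (z n)) < \<delta>" using \<delta> by (simp add: power2_less_imp_less)
  moreover have "\<iota> d - \<iota> (x n * z n) = \<iota> (z n)"
    using dz[of n] d zN xz by (simp flip: \<iota>_diff) (simp flip: dz)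
  ultimately show ?thesis using that[OF zN] by metis
qed

end

section \<open>Pairing with elements of the trace ideal\<close>

text \<open>The discriminant argument; \<open>0 \<le> C\<close> is itself extracted from the
  hypothesis by evaluating at a large \<open>t\<close>, and for \<open>C = 0\<close> a value of
  \<open>t\<close> making the expression \<open>- 1\<close> excludes
  \<open>B \<noteq> 0\<close>.\<close>

lemma cauchy_schwarz_of_nonneg:
  fixes A B C :: real
  assumes "\<And>t. 0 \<le> A + 2 * t * B + t\<^sup>2 * C"
  shows "B\<^sup>2 \<le> A * C"
proof (cases "C = 0")
  case True
  have "B = 0"
  proof (rule ccontr)
    assume "B \<noteq> 0"
    then show False using assms[of "- (A + 1) / (2 * B)"] True by (simp add: field_simps)
  qed
  then show ?thesis using True by simp
next
  case False
  have "0 \<le> C"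
  proof (rule ccontr)
    assume C: "\<not> 0 \<le> C"
    define t where "t = (\<bar>A\<bar> + 2 * \<bar>B\<bar> + 1) / (- C) + 1"
    have "0 \<le> (\<bar>A\<bar> + 2 * \<bar>B\<bar> + 1) / (- C)" using C by (intro divide_nonneg_pos) auto
    then have t: "1 \<le> t" unfolding t_def by linarith
    have tC: "t * C \<le> - (\<bar>A\<bar> + 2 * \<bar>B\<bar> + 1)" using C by (simp add: t_def field_simps)
    have "A + 2 * t * B \<le> \<bar>A\<bar> * t + 2 * t * \<bar>B\<bar>"
      using t by (intro add_mono) (auto intro: order_trans[OF abs_ge_self mult_left_mono[of 1 t "\<bar>A\<bar>", simplified]])
    moreover have "t * (t * C) \<le> t * (- (\<bar>A\<bar> + 2 * \<bar>B\<bar> + 1))"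
      using t tC by (intro mult_left_mono) auto
    ultimately have "A + 2 * t * B + t\<^sup>2 * C \<le> - t" by (simp add: power2_eq_square algebra_simps)
    then show False using assms[of t] t by simp
  qed
  then have C: "0 < C" using False by simp
  have "0 \<le> A + 2 * (- B / C) * B + (- B / C)\<^sup>2 * C" by (rule assms)
  also have "\<dots> = A - B\<^sup>2 / C" using C by (simp add: field_simps power2_eq_square)
  finally show ?thesis using C by (simp add: field_simps)
qed

context gns
begin

text \<open>Phrased for maps on \<open>N\<close>, so that left multiplication by \<open>s\<close>
  and the map \<open>1 - E\<close> below are instances; the form may be degenerate.\<close>

lemma inner_\<iota>_psd_cauchy_schwarz:
  assumes P: "\<And>x. x \<in> N \<Longrightarrow> P x \<in> N" "\<And>x y. x \<in> N \<Longrightarrow> y \<in> N \<Longrightarrow> P (x + y) = P x + P y"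
    "\<And>t x. x \<in> N \<Longrightarrow> P (t *\<^sub>R x) = t *\<^sub>R P x"
    and sym: "\<And>x y. x \<in> N \<Longrightarrow> y \<in> N \<Longrightarrow> inner (\<iota> (P x)) (\<iota> y) = inner (\<iota> x) (\<iota> (P y))"
    and pos: "\<And>x. x \<in> N \<Longrightarrow> 0 \<le> inner (\<iota> x) (\<iota> (P x))"
    and xy: "x \<in> N" "y \<in> N"
  shows "(inner (\<iota> x) (\<iota> (P y)))\<^sup>2 \<le> inner (\<iota> x) (\<iota> (P x)) * inner (\<iota> y) (\<iota> (P y))"
proof (rule cauchy_schwarz_of_nonneg)
  fix t
  have "inner (\<iota> y) (\<iota> (P x)) = inner (\<iota> x) (\<iota> (P y))" using sym[OF xy] by (simp add: inner_commute)
  then have "inner (\<iota> (x + t *\<^sub>R y)) (\<iota> (P (x + t *\<^sub>R y))) =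
      inner (\<iota> x) (\<iota> (P x)) + 2 * t * inner (\<iota> x) (\<iota> (P y)) + t\<^sup>2 * inner (\<iota> y) (\<iota> (P y))"
    using xy by (simp add: P N_scaleR N_add \<iota>_add \<iota>_scaleR inner_simps power2_eq_square algebra_simps)
  then show "0 \<le> inner (\<iota> x) (\<iota> (P x)) + 2 * t * inner (\<iota> x) (\<iota> (P y)) + t\<^sup>2 * inner (\<iota> y) (\<iota> (P y))"
    using pos[of "x + t *\<^sub>R y"] xy by (simp add: N_add N_scaleR)
qed

lemma inner_\<iota>_funpow:
  assumes P: "\<And>x. x \<in> N \<Longrightarrow> P x \<in> N"
    and sym: "\<And>x y. x \<in> N \<Longrightarrow> y \<in> N \<Longrightarrow> inner (\<iota> (P x)) (\<iota> y) = inner (\<iota> x) (\<iota> (P y))"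
    and xy: "x \<in> N" "y \<in> N"
  shows "inner (\<iota> ((P ^^ n) x)) (\<iota> y) = inner (\<iota> x) (\<iota> ((P ^^ n) y))"
  using xy(2)
proof (induction n arbitrary: y)
  case (Suc n)
  have "(P ^^ n) x \<in> N" by (induction n) (auto simp: P xy(1))
  then have "inner (\<iota> ((P ^^ Suc n) x)) (\<iota> y) = inner (\<iota> ((P ^^ n) x)) (\<iota> (P y))"
    using sym Suc.prems by simp
  also have "\<dots> = inner (\<iota> x) (\<iota> ((P ^^ n) (P y)))" using Suc.IH P Suc.prems by blast
  finally show ?case by (simp add: funpow_swap1)
qed simp

text \<open>Let \<open>s\<close> be a small multiple of \<open>\<Sum>\<bar>r c\<bar> c\<close>, so that \<open>a\<close> lies between multiples of \<open>s\<close> and \<open>-s\<close>,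
  let \<open>w = 1 - s\<close> and \<open>E b = w b w\<close>. Then \<open>y = \<Sum>n. E\<^sup>n a\<close> solves \<open>y - E y = a\<close> and is bounded in operator
  norm, because \<open>\<Sum>n. w\<^sup>n s w\<^sup>n\<close> telescopes. The Cauchy-Schwarz inequality for the form of
  \<open>1 - E \<le> L\<^sub>s + R\<^sub>s\<close> then bounds the pairing of \<open>a\<close> with \<open>b\<close> through the pairing of \<open>y\<close> with \<open>a\<close>,
  which is finite since \<open>a\<close> has finite trace norm.\<close>

lemma inner_\<iota>_square_le:
  assumes F: "finite F" "\<And>c. c \<in> F \<Longrightarrow> positive st c" and a1: "a = (\<Sum>c\<in>F. r c *\<^sub>R c)"
    and T: "finite T" "T \<subseteq> Mtau_pos st \<tau>" and a2: "a = (\<Sum>t\<in>T. d t *\<^sub>R t)"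
  obtains K where "0 \<le> K" "\<And>b. b \<in> N \<Longrightarrow> (inner (\<iota> a) (\<iota> b))\<^sup>2
    \<le> K * (\<Sum>c\<in>F. \<bar>r c\<bar> * (inner (\<iota> b) (\<iota> (c * b)) + inner (\<iota> b) (\<iota> (b * c))))"
proof -
  \<comment> \<open>The factor 2 compensates for the constant in
    \<open>norm_\<iota>_mult_left\<close>, so that multiplication by \<open>s\<close> contracts the
    GNS norm; the summand 1 keeps \<open>\<kappa>\<close> positive.\<close>
  define \<kappa> where "\<kappa> = 2 * (\<Sum>c\<in>F. \<bar>r c\<bar> * norm c) + 1"
  have \<kappa>: "0 < \<kappa>" unfolding \<kappa>_def by (intro add_nonneg_pos mult_nonneg_nonneg sum_nonneg) auto
  define s where "s = inverse \<kappa> *\<^sub>R (\<Sum>c\<in>F. \<bar>r c\<bar> *\<^sub>R c)"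
  have ss: "st s = s" using F(2) by (simp add: s_def st_scaleR st_sum positive_imp_sa)
  have ns: "2 * norm s \<le> 1"
  proof -
    have "norm (\<Sum>c\<in>F. \<bar>r c\<bar> *\<^sub>R c) \<le> (\<Sum>c\<in>F. \<bar>r c\<bar> * norm c)"
      by (rule norm_sum[THEN order_trans]) simp
    then have "2 * norm (\<Sum>c\<in>F. \<bar>r c\<bar> *\<^sub>R c) \<le> \<kappa>" unfolding \<kappa>_def by linarith
    then show ?thesis using \<kappa> by (simp add: s_def field_simps)
  qed
  define q where "q b = inner (\<iota> b) (\<iota> (s * b))" for b
  have sum_left: "\<iota> (s * b) = inverse \<kappa> *\<^sub>R (\<Sum>c\<in>F. \<bar>r c\<bar> *\<^sub>R \<iota> (c * b))" if "b \<in> N" for b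
    using that by (simp add: s_def sum_distrib_right \<iota>_scaleR \<iota>_sum N_sum N_scaleR N_mult_left)
  have sum_right: "\<iota> (b * s) = inverse \<kappa> *\<^sub>R (\<Sum>c\<in>F. \<bar>r c\<bar> *\<^sub>R \<iota> (b * c))" if "b \<in> N" for b
    using that by (simp add: s_def sum_distrib_left \<iota>_scaleR \<iota>_sum N_sum N_scaleR N_mult_right)
  have q_eq: "q b = inverse \<kappa> * (\<Sum>c\<in>F. \<bar>r c\<bar> * inner (\<iota> b) (\<iota> (c * b)))" if "b \<in> N" for b
    using that by (simp add: q_def sum_left inner_sum_right)
  have q0: "0 \<le> q b" if "b \<in> N" for b
    unfolding q_eq[OF that] using \<kappa> F(2) that
    by (intro mult_nonneg_nonneg sum_nonneg) (auto simp: inner_\<iota>_positive)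
  have s_sym: "inner (\<iota> (s * x)) (\<iota> y) = inner (\<iota> x) (\<iota> (s * y))" if "x \<in> N" "y \<in> N" for x y
    using inner_\<iota>_mult_left[of x y s] that ss by simp
  have s_le: "norm (\<iota> (s * b)) \<le> norm (\<iota> b)" if "b \<in> N" for b
    using norm_\<iota>_mult_left[OF that, of s] mult_right_mono[OF ns, of "norm (\<iota> b)"] by simp
  \<comment> \<open>The operator inequality \<open>s\<^sup>2 \<le> s\<close>, obtained from
    Cauchy-Schwarz for the form \<open>q\<close> at \<open>b\<close> and \<open>s * b\<close>, as
    \<open>s\<close> is a positive contraction.\<close>
  have s_sq: "(norm (\<iota> (s * b)))\<^sup>2 \<le> q b" if b: "b \<in> N" for b
  proof -
    have sb: "s * b \<in> N" using b by (rule N_mult_left)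
    have "(inner (\<iota> b) (\<iota> (s * (s * b))))\<^sup>2
        \<le> inner (\<iota> b) (\<iota> (s * b)) * inner (\<iota> (s * b)) (\<iota> (s * (s * b)))"
      by (rule inner_\<iota>_psd_cauchy_schwarz)
        (use b sb s_sym q0 in \<open>auto simp: q_def distrib_left intro: N_mult_left\<close>)
    moreover have "inner (\<iota> b) (\<iota> (s * (s * b))) = (norm (\<iota> (s * b)))\<^sup>2"
      using s_sym[OF b sb] by (simp add: power2_norm_eq_inner)
    moreover have "inner (\<iota> (s * b)) (\<iota> (s * (s * b))) \<le> (norm (\<iota> (s * b)))\<^sup>2"
      using norm_cauchy_schwarz[of "\<iota> (s * b)" "\<iota> (s * (s * b))"]
        mult_left_mono[OF s_le[OF sb], of "norm (\<iota> (s * b))"] by (simp add: power2_eq_square)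
    then have "inner (\<iota> b) (\<iota> (s * b)) * inner (\<iota> (s * b)) (\<iota> (s * (s * b)))
        \<le> q b * (norm (\<iota> (s * b)))\<^sup>2"
      using q0[OF b] unfolding q_def by (rule mult_left_mono)
    ultimately have le: "(norm (\<iota> (s * b)))\<^sup>2 * (norm (\<iota> (s * b)))\<^sup>2 \<le> q b * (norm (\<iota> (s * b)))\<^sup>2"
      by (simp add: power2_eq_square[of "(norm (\<iota> (s * b)))\<^sup>2"])
    show ?thesis
    proof (cases "norm (\<iota> (s * b)) = 0")
      case False
      then have "0 < (norm (\<iota> (s * b)))\<^sup>2" by simp
      then show ?thesis using le by (rule mult_right_le_imp_le[rotated])
    qed (use q0[OF b] in simp)
  qed
  define w where "w b = b - s * b" for b
  define v where "v b = b - b * s" for b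
  define E where "E b = w (v b)" for b
  have wN: "w b \<in> N" and vN: "v b \<in> N" if "b \<in> N" for b
    using that by (simp_all add: w_def v_def N_diff N_mult_left N_mult_right)
  then have EN: "E b \<in> N" if "b \<in> N" for b using that by (simp add: E_def)
  \<comment> \<open>Each application of \<open>w\<close> loses at least \<open>q b\<close> of
    squared norm; this is the source of the telescoping sum.\<close>
  have w_norm: "(norm (\<iota> (w b)))\<^sup>2 \<le> (norm (\<iota> b))\<^sup>2 - q b" if b: "b \<in> N" for b
  proof -
    have "(norm (\<iota> (w b)))\<^sup>2 = (norm (\<iota> b))\<^sup>2 - 2 * q b + (norm (\<iota> (s * b)))\<^sup>2"
      using b by (simp add: w_def q_def \<iota>_diff N_mult_left power2_norm_eq_inner inner_simps inner_commute)
    then show ?thesis using s_sq[OF b] by simp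
  qed
  have w_le: "norm (\<iota> (w b)) \<le> norm (\<iota> b)" if "b \<in> N" for b
  proof -
    have "(norm (\<iota> (w b)))\<^sup>2 \<le> (norm (\<iota> b))\<^sup>2" using w_norm[OF that] q0[OF that] by linarith
    then show ?thesis by (rule power2_le_imp_le) simp
  qed
  have v_le: "norm (\<iota> (v b)) \<le> norm (\<iota> b)" if "b \<in> N" for b
  proof -
    have "st (v b) = w (st b)" by (simp add: v_def w_def st_diff st_mult ss)
    then show ?thesis using w_le[OF N_st[OF that]] norm_\<iota>_st[OF vN[OF that]] norm_\<iota>_st[OF that] by simp
  qed
  have E_le: "norm (\<iota> (E b)) \<le> norm (\<iota> b)" if "b \<in> N" for b
    using w_le[OF vN[OF that]] v_le[OF that] by (simp add: E_def)
  have w_sym: "inner (\<iota> (w x)) (\<iota> y) = inner (\<iota> x) (\<iota> (w y))" if "x \<in> N" "y \<in> N" for x y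
    using that s_sym[OF that] by (simp add: w_def \<iota>_diff N_mult_left inner_simps)
  have v_sym: "inner (\<iota> (v x)) (\<iota> y) = inner (\<iota> x) (\<iota> (v y))" if "x \<in> N" "y \<in> N" for x y
    using that inner_\<iota>_mult_right[OF that, of s] by (simp add: v_def \<iota>_diff N_mult_right inner_simps ss)
  have E_sym: "inner (\<iota> (E x)) (\<iota> y) = inner (\<iota> x) (\<iota> (E y))" if "x \<in> N" "y \<in> N" for x y
  proof -
    have "v (w y) = w (v y)" by (simp add: v_def w_def algebra_simps)
    then show ?thesis using that by (simp add: E_def w_sym v_sym wN vN)
  qed
  have E_add: "E (x + y) = E x + E y" and E_scaleR: "E (t *\<^sub>R x) = t *\<^sub>R E x" for x y t
    by (simp_all add: E_def w_def v_def algebra_simps)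
  have E_sum: "E (\<Sum>i\<in>I. f i) = (\<Sum>i\<in>I. E (f i))" if "finite I" for f and I :: "nat set"
    using that E_scaleR[of 0 0] by (induction I rule: finite_induct) (auto simp: E_add)
  have En: "(E ^^ n) x \<in> N" if "x \<in> N" for n x
    using that by (induction n) (auto simp: EN)
  have wn: "(w ^^ n) x \<in> N" if "x \<in> N" for n x
    using that by (induction n) (auto simp: wN)
  have wn_sym: "inner (\<iota> ((w ^^ n) x)) (\<iota> y) = inner (\<iota> x) (\<iota> ((w ^^ n) y))" if "x \<in> N" "y \<in> N" for n x y
    using wN w_sym that by (rule inner_\<iota>_funpow)
  have En_sym: "inner (\<iota> ((E ^^ n) x)) (\<iota> y) = inner (\<iota> x) (\<iota> ((E ^^ n) y))" if "x \<in> N" "y \<in> N" for n x y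
    using EN E_sym that by (rule inner_\<iota>_funpow)
  \<comment> \<open>\<open>(E ^^ n) x\<close> is \<open>w\<^sup>n x w\<^sup>n\<close>; after
    multiplication by \<open>c\<close>, its right-hand factor acts on \<open>c\<close> from the
    left.\<close>
  have En_mult: "(E ^^ n) x * c = (w ^^ n) (x * (w ^^ n) c)" for n x c
  proof (induction n arbitrary: c)
    case (Suc n)
    have "(E ^^ Suc n) x * c = w ((E ^^ n) x * w c)"
      by (simp add: E_def w_def v_def algebra_simps)
    also have "\<dots> = w ((w ^^ n) (x * (w ^^ n) (w c)))" using Suc[of "w c"] by simp
    finally show ?case by (simp add: funpow_swap1)
  qed simp
  \<comment> \<open>\<open>1 - E = L\<^sub>s + R\<^sub>s - L\<^sub>s R\<^sub>s\<close>, and the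
    product of these commuting positive operators is nonnegative.\<close>
  have form_le: "(norm (\<iota> b))\<^sup>2 - inner (\<iota> b) (\<iota> (E b))
      \<le> inverse \<kappa> * (\<Sum>c\<in>F. \<bar>r c\<bar> * (inner (\<iota> b) (\<iota> (c * b)) + inner (\<iota> b) (\<iota> (b * c))))"
    if b: "b \<in> N" for b
  proof -
    have "0 \<le> inner (\<iota> b) (\<iota> (s * b * c))" if c: "c \<in> F" for c
    proof -
      obtain u where u: "c = st u * u" using F(2)[OF c] unfolding positive_def by blast
      have "q (b * st u) = inner (\<iota> b) (\<iota> (s * b * c))"
        using inner_\<iota>_mult_right[of b "s * (b * st u)" "st u"] b
        by (simp add: q_def u st_st mult.assoc N_mult_left N_mult_right)
      then show ?thesis using q0[OF N_mult_right[OF b], of "st u"] by simp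
    qed
    then have "0 \<le> inner (\<iota> b) (\<iota> ((s * b) * s))"
      using \<kappa> b by (subst sum_right) (auto simp: N_mult_left inner_sum_right intro!: sum_nonneg mult_nonneg_nonneg)
    moreover have "E b = b - s * b - b * s + s * b * s"
      by (simp add: E_def w_def v_def algebra_simps)
    then have "(norm (\<iota> b))\<^sup>2 - inner (\<iota> b) (\<iota> (E b))
        = inner (\<iota> b) (\<iota> (s * b)) + inner (\<iota> b) (\<iota> (b * s)) - inner (\<iota> b) (\<iota> (s * b * s))"
      using b by (simp add: \<iota>_add \<iota>_diff N_diff N_mult_left N_mult_right inner_simps power2_norm_eq_inner)
    ultimately have "(norm (\<iota> b))\<^sup>2 - inner (\<iota> b) (\<iota> (E b))
        \<le> inner (\<iota> b) (\<iota> (s * b)) + inner (\<iota> b) (\<iota> (b * s))" by simp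
    also have "\<dots> = inverse \<kappa> * (\<Sum>c\<in>F. \<bar>r c\<bar> * (inner (\<iota> b) (\<iota> (c * b)) + inner (\<iota> b) (\<iota> (b * c))))"
      using b by (simp add: sum_left sum_right inner_sum_right sum.distrib distrib_left)
    finally show ?thesis .
  qed
  have aN: "a \<in> N" unfolding a2 using T Mtau_pos_N by (intro N_sum N_scaleR) auto
  have "\<forall>t\<in>T. \<exists>c. c \<in> N \<and> t = st c * c" using T(2) Mtau_posE by blast
  then obtain c where c: "\<And>t. t \<in> T \<Longrightarrow> c t \<in> N" "\<And>t. t \<in> T \<Longrightarrow> t = st (c t) * c t" by metis
  \<comment> \<open>For a summand \<open>t = st c * c\<close> of finite trace, pairing
    \<open>(E ^^ n) a\<close> with \<open>t\<close> amounts to pairing \<open>a * g\<close> with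
    \<open>g\<close>, where \<open>g = (w ^^ n) (st c)\<close>. Since \<open>a\<close> lies between
    \<open>- \<kappa> s\<close> and \<open>\<kappa> s\<close>, the result is at most
    \<open>\<kappa> * q g\<close> in absolute value.\<close>
  define \<beta> where "\<beta> n = (\<Sum>t\<in>T. \<bar>d t\<bar> * (\<kappa> * q ((w ^^ n) (st (c t)))))" for n
  have \<beta>0: "0 \<le> \<beta> n" for n
    unfolding \<beta>_def using \<kappa> c(1) by (intro sum_nonneg mult_nonneg_nonneg q0 wn N_st) auto
  have \<beta>: "\<bar>inner (\<iota> ((E ^^ n) a)) (\<iota> a)\<bar> \<le> \<beta> n" for n
  proof -
    have "\<bar>inner (\<iota> ((E ^^ n) a)) (\<iota> t)\<bar> \<le> \<kappa> * q ((w ^^ n) (st (c t)))" if t: "t \<in> T" for t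
    proof -
      define g where "g = (w ^^ n) (st (c t))"
      have g: "g \<in> N" unfolding g_def by (intro wn N_st c t)
      have ct: "st (c t) \<in> N" by (intro N_st c t)
      have "inner (\<iota> ((E ^^ n) a)) (\<iota> t) = inner (\<iota> ((E ^^ n) a)) (\<iota> (st (c t) * st (st (c t))))"
        using c(2)[OF t] by (simp add: st_st)
      also have "\<dots> = inner (\<iota> ((E ^^ n) a * st (c t))) (\<iota> (st (c t)))"
        using inner_\<iota>_mult_right[OF En[OF aN] ct] by simp
      also have "\<dots> = inner (\<iota> (a * g)) (\<iota> g)"
        unfolding En_mult g_def by (intro wn_sym N_mult_left ct wn)
      also have "\<iota> (a * g) = (\<Sum>x\<in>F. r x *\<^sub>R \<iota> (x * g))"
        using g by (simp add: a1 sum_distrib_right \<iota>_sum \<iota>_scaleR N_scaleR N_mult_left)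
      finally have "\<bar>inner (\<iota> ((E ^^ n) a)) (\<iota> t)\<bar> = \<bar>\<Sum>x\<in>F. r x * inner (\<iota> g) (\<iota> (x * g))\<bar>"
        by (simp add: inner_sum_right inner_commute)
      also have "\<dots> \<le> (\<Sum>x\<in>F. \<bar>r x\<bar> * inner (\<iota> g) (\<iota> (x * g)))"
        by (rule sum_abs[THEN order_trans]) (use F(2) g in \<open>auto simp: abs_mult inner_\<iota>_positive\<close>)
      also have "\<dots> = \<kappa> * q g" using \<kappa> by (simp add: q_eq[OF g])
      finally show ?thesis by (simp add: g_def)
    qed
    note bnd = this
    have "\<iota> a = (\<Sum>t\<in>T. d t *\<^sub>R \<iota> t)"
      unfolding a2 using T(2) Mtau_pos_N by (subst \<iota>_sum) (auto simp: \<iota>_scaleR N_scaleR subset_iff)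
    then have "\<bar>inner (\<iota> ((E ^^ n) a)) (\<iota> a)\<bar> \<le> (\<Sum>t\<in>T. \<bar>d t * inner (\<iota> ((E ^^ n) a)) (\<iota> t)\<bar>)"
      by (simp add: inner_sum_right sum_abs)
    also have "\<dots> \<le> \<beta> n"
      unfolding \<beta>_def by (intro sum_mono) (auto simp: abs_mult intro!: mult_left_mono bnd)
    finally show ?thesis .
  qed
  define K0 where "K0 = (\<Sum>t\<in>T. \<bar>d t\<bar> * (\<kappa> * (norm (\<iota> (st (c t))))\<^sup>2))"
  have K0: "0 \<le> K0" unfolding K0_def using \<kappa> by (intro sum_nonneg mult_nonneg_nonneg) auto
  have \<beta>_sum: "(\<Sum>n<M. \<beta> n) \<le> K0" for M
  proof -
    \<comment> \<open>The losses recorded in \<open>w_norm\<close>, summed along the orbit of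
      \<open>x\<close> under \<open>w\<close>.\<close>
    have tele: "(\<Sum>n<M. q ((w ^^ n) x)) \<le> (norm (\<iota> x))\<^sup>2" if x: "x \<in> N" for x
    proof -
      have "(\<Sum>n<M. q ((w ^^ n) x)) \<le> (norm (\<iota> x))\<^sup>2 - (norm (\<iota> ((w ^^ M) x)))\<^sup>2" for M
      proof (induction M)
        case (Suc M)
        then show ?case using w_norm[OF wn[OF x], of M] by simp
      qed simp
      then show ?thesis by (smt (verit) zero_le_power2)
    qed
    have "(\<Sum>n<M. \<beta> n) = (\<Sum>t\<in>T. \<bar>d t\<bar> * (\<kappa> * (\<Sum>n<M. q ((w ^^ n) (st (c t))))))"
      unfolding \<beta>_def by (subst sum.swap) (simp add: sum_distrib_left)
    also have "\<dots> \<le> K0" unfolding K0_def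
      using \<kappa> c(1) by (intro sum_mono mult_left_mono tele N_st) auto
    finally show ?thesis .
  qed
  have "summable \<beta>"
    using \<beta>0 by (rule bounded_imp_summable[where B = K0]) (metis \<beta>_sum lessThan_Suc_atMost)
  then have "\<beta> \<longlonglongrightarrow> 0" by (rule summable_LIMSEQ_zero)
  \<comment> \<open>Even indices occur because \<open>E\<close> is symmetric: the squared norm of
    \<open>(E ^^ n) a\<close> is the pairing of \<open>(E ^^ (2 * n)) a\<close> with
    \<open>a\<close>.\<close>
  then have "(\<lambda>n. \<beta> (2 * n)) \<longlonglongrightarrow> 0"
    by (rule LIMSEQ_subseq_LIMSEQ[unfolded o_def]) (auto simp: strict_mono_def)
  have En_comm: "inner (\<iota> ((E ^^ M) a)) (\<iota> ((E ^^ n) a)) = inner (\<iota> ((E ^^ (n + M)) a)) (\<iota> a)" for M n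
    using En_sym[OF En[OF aN] aN, of n M] by (simp add: funpow_add inner_commute)
  have sqE: "(norm (\<iota> ((E ^^ n) a)))\<^sup>2 \<le> \<beta> (2 * n)" for n
    using En_comm[of n n] \<beta>[of "2 * n"] by (simp add: power2_norm_eq_inner mult_2)
  have "(\<lambda>n. (norm (\<iota> ((E ^^ n) a)))\<^sup>2) \<longlonglongrightarrow> 0"
    by (rule Lim_null_comparison[OF _ \<open>(\<lambda>n. \<beta> (2 * n)) \<longlonglongrightarrow> 0\<close>]) (use sqE in simp)
  from tendsto_real_sqrt[OF this] have "(\<lambda>n. norm (\<iota> ((E ^^ n) a))) \<longlonglongrightarrow> 0" by simp
  then have lim: "(\<lambda>n. \<iota> ((E ^^ n) a)) \<longlonglongrightarrow> 0" by (rule tendsto_norm_zero_cancel)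
  \<comment> \<open>Only partial sums of the series are formed; the estimates below are uniform in
    \<open>M\<close>.\<close>
  define y where "y M = (\<Sum>n<M. (E ^^ n) a)" for M
  have yN: "y M \<in> N" for M unfolding y_def by (intro N_sum En aN)
  have yE: "y M - E (y M) = a - (E ^^ M) a" for M
  proof -
    have "y M - E (y M) = (\<Sum>n<M. (E ^^ n) a - (E ^^ Suc n) a)"
      by (simp add: y_def E_sum sum_subtractf)
    also have "\<dots> = a - (E ^^ M) a" by (induction M) simp_all
    finally show ?thesis .
  qed
  \<comment> \<open>Expanding the pairing gives the terms with index below \<open>M\<close> minus
    those from \<open>M\<close> to \<open>2 M - 1\<close>; both groups together are bounded by one
    partial sum of \<open>\<beta>\<close>.\<close>
  have fyy: "inner (\<iota> (y M)) (\<iota> (y M - E (y M))) \<le> K0" for M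
  proof -
    have "inner (\<iota> (y M)) (\<iota> (y M - E (y M)))
        = (\<Sum>n<M. inner (\<iota> ((E ^^ n) a)) (\<iota> a)) - (\<Sum>n<M. inner (\<iota> ((E ^^ (M + n)) a)) (\<iota> a))"
    proof -
      have "inner (\<iota> (y M)) u = (\<Sum>n<M. inner (\<iota> ((E ^^ n) a)) u)" for u
        by (simp add: y_def \<iota>_sum En aN inner_sum_left)
      then show ?thesis by (simp add: yE \<iota>_diff aN En inner_diff_right En_comm)
    qed
    also have "\<dots> \<le> (\<Sum>n<M. \<beta> n) + (\<Sum>n<M. \<beta> (M + n))"
    proof -
      have "(\<Sum>n<M. inner (\<iota> ((E ^^ n) a)) (\<iota> a)) \<le> (\<Sum>n<M. \<beta> n)"
        using \<beta> by (intro sum_mono) (smt (verit))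
      moreover have "- (\<Sum>n<M. inner (\<iota> ((E ^^ (M + n)) a)) (\<iota> a)) \<le> (\<Sum>n<M. \<beta> (M + n))"
        unfolding sum_negf[symmetric] using \<beta> by (intro sum_mono) (smt (verit))
      ultimately show ?thesis by simp
    qed
    also have "\<dots> = (\<Sum>n<M + M. \<beta> n)"
    proof -
      have "(\<Sum>n<M. \<beta> n) + (\<Sum>n<k. \<beta> (M + n)) = (\<Sum>n<M + k. \<beta> n)" for k
        by (induction k) auto
      then show ?thesis .
    qed
    also have "\<dots> \<le> K0" by (rule \<beta>_sum)
    finally show ?thesis .
  qed
  have E_form: "0 \<le> inner (\<iota> x) (\<iota> (x - E x))" if x: "x \<in> N" for x
  proof -
    have "inner (\<iota> x) (\<iota> (E x)) \<le> norm (\<iota> x) * norm (\<iota> (E x))" by (rule norm_cauchy_schwarz)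
    also have "\<dots> \<le> norm (\<iota> x) * norm (\<iota> x)" by (intro mult_left_mono E_le x) simp
    finally show ?thesis
      using x by (simp add: \<iota>_diff EN inner_diff_right power2_norm_eq_inner[symmetric] power2_eq_square)
  qed
  \<comment> \<open>Cauchy-Schwarz pairs \<open>b\<close> with
    \<open>y M - E (y M) = a - (E ^^ M) a\<close>, and the last term disappears in the
    limit.\<close>
  have main: "(inner (\<iota> a) (\<iota> b))\<^sup>2 \<le> K0 * inner (\<iota> b) (\<iota> (b - E b))" if b: "b \<in> N" for b
  proof (rule LIMSEQ_le_const2)
    show "(\<lambda>M. (inner (\<iota> b) (\<iota> a) - inner (\<iota> b) (\<iota> ((E ^^ M) a)))\<^sup>2) \<longlonglongrightarrow> (inner (\<iota> a) (\<iota> b))\<^sup>2"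
      using tendsto_power[OF tendsto_diff[OF tendsto_const tendsto_inner[OF tendsto_const lim]],
          of "inner (\<iota> b) (\<iota> a)" "\<iota> b" 2] by (simp add: inner_commute)
    have "(inner (\<iota> b) (\<iota> a) - inner (\<iota> b) (\<iota> ((E ^^ M) a)))\<^sup>2 \<le> K0 * inner (\<iota> b) (\<iota> (b - E b))" for M
    proof -
      have "(inner (\<iota> b) (\<iota> (y M - E (y M))))\<^sup>2
          \<le> inner (\<iota> b) (\<iota> (b - E b)) * inner (\<iota> (y M)) (\<iota> (y M - E (y M)))"
        by (rule inner_\<iota>_psd_cauchy_schwarz)
          (use b yN E_form EN in \<open>auto simp: N_diff E_add E_scaleR \<iota>_diff E_sym inner_simps scaleR_diff_right\<close>)
      also have "\<dots> \<le> inner (\<iota> b) (\<iota> (b - E b)) * K0"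
        by (intro mult_left_mono fyy E_form b)
      finally show ?thesis
        by (simp add: yE \<iota>_diff aN En inner_diff_right mult.commute)
    qed
    then show "\<exists>m. \<forall>M\<ge>m. (inner (\<iota> b) (\<iota> a) - inner (\<iota> b) (\<iota> ((E ^^ M) a)))\<^sup>2
        \<le> K0 * inner (\<iota> b) (\<iota> (b - E b))" by blast
  qed
  show ?thesis
  proof (rule that[of "K0 * inverse \<kappa>"])
    show "0 \<le> K0 * inverse \<kappa>" using K0 \<kappa> by simp
    fix b assume b: "b \<in> N"
    have "inner (\<iota> b) (\<iota> (b - E b)) = (norm (\<iota> b))\<^sup>2 - inner (\<iota> b) (\<iota> (E b))"
      using b by (simp add: \<iota>_diff EN inner_diff_right power2_norm_eq_inner)
    then have "K0 * inner (\<iota> b) (\<iota> (b - E b)) \<le> K0 * (inverse \<kappa> *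
        (\<Sum>c\<in>F. \<bar>r c\<bar> * (inner (\<iota> b) (\<iota> (c * b)) + inner (\<iota> b) (\<iota> (b * c)))))"
      using form_le[OF b] K0 by (simp add: mult_left_mono)
    then show "(inner (\<iota> a) (\<iota> b))\<^sup>2 \<le> K0 * inverse \<kappa> *
        (\<Sum>c\<in>F. \<bar>r c\<bar> * (inner (\<iota> b) (\<iota> (c * b)) + inner (\<iota> b) (\<iota> (b * c))))"
      using main[OF b] by (simp add: mult.assoc)
  qed
qed

end

section \<open>The unitary representation\<close>

lemma continuous_on_UNIV_iff_tendsto_nhds:
  fixes f :: "'x::t2_space \<Rightarrow> 'y::topological_space"
  shows "continuous_on UNIV f \<longleftrightarrow> (\<forall>x. (f \<longlongrightarrow> f x) (nhds x))"
proof -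
  have "isCont f x \<longleftrightarrow> (f \<longlongrightarrow> f x) (nhds x)" for x
    unfolding isCont_def by (rule tendsto_at_iff_tendsto_nhds)
  then show ?thesis by (simp add: continuous_on_eq_continuous_at)
qed

context gns
begin

section \<open>Complex structure and isometric extension from the dense range\<close>

lemma hsc_scaleR: "hsc c (r *\<^sub>R v) = r *\<^sub>R hsc c v"
  by (metis hsc_hsc hsc_of_real mult.commute)

lemma bounded_linear_hsc: "bounded_linear (hsc c)"
  by (rule bounded_linear_intro[where K = "cmod c"])
    (auto simp: hsc_add_right hsc_scaleR norm_hsc mult.commute)

lemma hsc_ii: "hsc \<i> (hsc \<i> v) = - v"
  using hsc_hsc[of \<i> \<i> v] hsc_of_real[of "-1" v] by simp

lemma hsc_Complex: "hsc c v = Re c *\<^sub>R v + Im c *\<^sub>R hsc \<i> v"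
proof -
  have "hsc c v = hsc (complex_of_real (Re c) + complex_of_real (Im c) * \<i>) v"
    by (metis complex_eq mult.commute)
  then show ?thesis by (simp only: hsc_add_left hsc_hsc hsc_of_real)
qed

lemma inner_isometry:
  fixes V :: "'h \<Rightarrow> 'h"
  assumes "\<And>u v. V (u + v) = V u + V v" "\<And>v. norm (V v) = norm v"
  shows "inner (V u) (V v) = inner u v"
proof -
  have "(norm (V u + V v))\<^sup>2 = (norm (u + v))\<^sup>2" using assms by metis
  moreover have "(norm (V u))\<^sup>2 = (norm u)\<^sup>2" "(norm (V v))\<^sup>2 = (norm v)\<^sup>2" using assms(2) by simp_all
  ultimately show ?thesis by (simp add: power2_norm_eq_inner inner_simps inner_commute)
qed

lemma inner_hsc_ii: "inner (hsc \<i> u) v = - inner u (hsc \<i> v)"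
proof -
  have "inner (hsc \<i> u) (hsc \<i> (hsc \<i> v)) = inner u (hsc \<i> v)"
    by (rule inner_isometry) (auto simp: hsc_add_right norm_hsc)
  then show ?thesis by (simp add: hsc_ii)
qed

lemma \<iota>_dense_induct:
  assumes "closed {x. P x}" "\<And>a. a \<in> N \<Longrightarrow> P (\<iota> a)"
  shows "P x"
proof -
  have "closure (\<iota> ` N) \<subseteq> {x. P x}" using assms by (intro closure_minimal) auto
  then show ?thesis using dense_\<iota> by auto
qed

text \<open>Since \<open>\<iota>\<close> need not be injective, \<open>f\<close> must first be shown
  to factor through it, which the equality of norms provides. The induced map is isometric, hence
  extends by uniform continuity, and each identity holds on a closed set containing the dense
  range.\<close>

lemma extend_isometry:
  assumes f_add: "\<And>a b. a \<in> N \<Longrightarrow> b \<in> N \<Longrightarrow> f (a + b) = f a + f b"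
    and f_sc: "\<And>c a. a \<in> N \<Longrightarrow> f (sc c a) = hsc c (f a)"
    and f_norm: "\<And>a. a \<in> N \<Longrightarrow> norm (f a) = norm (\<iota> a)"
  obtains V where "\<And>a. a \<in> N \<Longrightarrow> V (\<iota> a) = f a" "\<And>u v. V (u + v) = V u + V v"
    "\<And>c v. V (hsc c v) = hsc c (V v)" "\<And>v. norm (V v) = norm v"
proof -
  have f_diff: "f (a - b) = f a - f b" if "a \<in> N" "b \<in> N" for a b
    using f_add[OF N_diff[OF that] that(2)] by simp
  define g where "g h = f (SOME a. a \<in> N \<and> \<iota> a = h)" for h
  have g: "g (\<iota> a) = f a" if a: "a \<in> N" for a
  proof -
    define b where "b = (SOME b. b \<in> N \<and> \<iota> b = \<iota> a)"
    have "b \<in> N \<and> \<iota> b = \<iota> a" unfolding b_def by (rule someI[of _ a]) (use a in simp)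
    then have b: "b \<in> N" "\<iota> b = \<iota> a" by auto
    have "norm (f b - f a) = norm (\<iota> (b - a))" using f_norm[OF N_diff[OF b(1) a]] f_diff[OF b(1) a] by simp
    then show ?thesis using b a by (simp add: g_def \<iota>_diff flip: b_def)
  qed
  have "dist (g u) (g v) = dist u v" if uv: "u \<in> \<iota> ` N" "v \<in> \<iota> ` N" for u v
  proof -
    obtain a b where ab: "a \<in> N" "u = \<iota> a" "b \<in> N" "v = \<iota> b" using uv by blast
    then show ?thesis using f_norm[OF N_diff[OF ab(1,3)]] by (simp add: g dist_norm f_diff \<iota>_diff)
  qed
  then have "uniformly_continuous_on (\<iota> ` N) g"
    unfolding uniformly_continuous_on_def by metis
  then obtain V where V: "uniformly_continuous_on UNIV V" "\<And>x. x \<in> \<iota> ` N \<Longrightarrow> g x = V x"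
    using uniformly_continuous_on_extension_on_closure[of "\<iota> ` N" g] dense_\<iota> by metis
  have cont: "continuous_on UNIV V" by (rule uniformly_continuous_imp_continuous[OF V(1)])
  note contV = continuous_on_compose2[OF cont _ subset_UNIV]
  have V\<iota>: "V (\<iota> a) = f a" if "a \<in> N" for a using V(2) g that by (metis imageI)
  show ?thesis
  proof (rule that[OF V\<iota>])
    have 1: "V (u + \<iota> b) = V u + V (\<iota> b)" if b: "b \<in> N" for u b
    proof (rule \<iota>_dense_induct[of "\<lambda>u. V (u + \<iota> b) = V u + V (\<iota> b)"])
      show "closed {u. V (u + \<iota> b) = V u + V (\<iota> b)}"
        by (intro closed_Collect_eq continuous_intros contV)
      show "V (\<iota> a + \<iota> b) = V (\<iota> a) + V (\<iota> b)" if a: "a \<in> N" for a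
        using V\<iota>[OF N_add[OF a b]] a b by (simp add: V\<iota> f_add \<iota>_add)
    qed
    show "V (u + v) = V u + V v" for u v
    proof (rule \<iota>_dense_induct[of "\<lambda>v. V (u + v) = V u + V v"])
      show "closed {v. V (u + v) = V u + V v}"
        by (intro closed_Collect_eq continuous_intros contV)
    qed (rule 1)
    show "V (hsc c v) = hsc c (V v)" for c v
    proof (rule \<iota>_dense_induct[of "\<lambda>v. V (hsc c v) = hsc c (V v)"])
      show "closed {v. V (hsc c v) = hsc c (V v)}"
        by (intro closed_Collect_eq contV cont bounded_linear.continuous_on[OF bounded_linear_hsc] continuous_intros)
      show "V (hsc c (\<iota> a)) = hsc c (V (\<iota> a))" if a: "a \<in> N" for a
        using V\<iota>[OF N_sc[OF a], of c] a by (simp add: V\<iota> f_sc \<iota>_sc)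
    qed
    show "norm (V v) = norm v" for v
    proof (rule \<iota>_dense_induct[of "\<lambda>v. norm (V v) = norm v"])
      show "closed {v. norm (V v) = norm v}"
        by (intro closed_Collect_eq continuous_intros cont)
    qed (simp add: V\<iota> f_norm)
  qed
qed

end

locale semi_invariant_action = gns sc st \<tau> hsc \<iota>
  for sc :: "complex \<Rightarrow> 'a::{real_normed_algebra,banach} \<Rightarrow> 'a" and st :: "'a \<Rightarrow> 'a"
    and \<tau> :: "'a \<Rightarrow> ennreal"
    and hsc :: "complex \<Rightarrow> 'h::{real_inner,complete_space} \<Rightarrow> 'h" and \<iota> :: "'a \<Rightarrow> 'h" +
  fixes \<mu> :: "'g::{topological_group_add,t2_space} measure" and \<Delta> :: "'g \<Rightarrow> real"
    and \<alpha> :: "'g \<Rightarrow> 'a \<Rightarrow> 'a"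
  assumes haar: "left_haar_measure \<mu>" and modular: "modular_function \<mu> \<Delta>"
    and action: "strongly_continuous_action sc st \<alpha>"
    and semi_inv: "semi_invariant st \<tau> \<Delta> \<alpha>"
begin

section \<open>Translates, and the modular function seen through the trace\<close>

lemma \<Delta>_pos: "0 < \<Delta> x"
  using modular unfolding modular_function_def by blast

lemma \<alpha>_add: "\<alpha> x (a + b) = \<alpha> x a + \<alpha> x b"
  and \<alpha>_sc: "\<alpha> x (sc c a) = sc c (\<alpha> x a)"
  and \<alpha>_mult: "\<alpha> x (a * b) = \<alpha> x a * \<alpha> x b"
  and \<alpha>_st: "\<alpha> x (st a) = st (\<alpha> x a)"
  and \<alpha>_zero: "\<alpha> 0 a = a"
  and \<alpha>_plus: "\<alpha> (x + y) a = \<alpha> x (\<alpha> y a)"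
  and continuous_\<alpha>: "continuous_on UNIV (\<lambda>x. \<alpha> x a)"
  using action unfolding strongly_continuous_action_def star_automorphism_def by auto

lemma \<alpha>_uminus: "\<alpha> (- x) (\<alpha> x a) = a"
  by (simp add: \<alpha>_zero flip: \<alpha>_plus)

lemma positive_\<alpha>: "positive st a \<Longrightarrow> positive st (\<alpha> x a)"
  unfolding positive_def by (metis \<alpha>_mult \<alpha>_st)

lemma trace_\<alpha>: "\<tau> (st (\<alpha> x a) * \<alpha> x a) = ennreal (inverse (\<Delta> x)) * \<tau> (st a * a)"
  using semi_inv positive_st_mult(1)[of a] unfolding semi_invariant_def
  by (metis \<alpha>_mult \<alpha>_st)

lemma \<alpha>_N: "a \<in> N \<Longrightarrow> \<alpha> x a \<in> N"
  by (simp add: N_iff trace_\<alpha> ennreal_mult_less_top)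

lemma norm_\<iota>_\<alpha>:
  assumes "a \<in> N"
  shows "(norm (\<iota> (\<alpha> x a)))\<^sup>2 = inverse (\<Delta> x) * (norm (\<iota> a))\<^sup>2"
proof -
  have "ennreal ((norm (\<iota> (\<alpha> x a)))\<^sup>2) = ennreal (inverse (\<Delta> x) * (norm (\<iota> a))\<^sup>2)"
    using assms \<Delta>_pos[of x] by (simp add: norm_\<iota> \<alpha>_N trace_\<alpha> ennreal_mult)
  then show ?thesis using \<Delta>_pos[of x] by simp
qed

text \<open>As soon as some vector is nonzero, semi-invariance and lower semicontinuity of the trace make
  \<open>\<Delta>\<close> a continuous homomorphism.\<close>

lemma \<Delta>_plus:
  assumes "a \<in> N" "\<iota> a \<noteq> 0"
  shows "\<Delta> (x + y) = \<Delta> x * \<Delta> y"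
proof -
  have "inverse (\<Delta> (x + y)) * (norm (\<iota> a))\<^sup>2 = inverse (\<Delta> x) * inverse (\<Delta> y) * (norm (\<iota> a))\<^sup>2"
    using norm_\<iota>_\<alpha>[OF assms(1), of "x + y"] norm_\<iota>_\<alpha>[OF \<alpha>_N[OF assms(1)], of x y] norm_\<iota>_\<alpha>[OF assms(1), of y]
    by (simp only: \<alpha>_plus mult.assoc)
  then show ?thesis using assms(2) \<Delta>_pos[of x] \<Delta>_pos[of y] \<Delta>_pos[of "x + y"]
    by (simp add: field_simps)
qed

lemma \<Delta>_zero:
  assumes "a \<in> N" "\<iota> a \<noteq> 0"
  shows "\<Delta> 0 = 1"
  using \<Delta>_plus[OF assms, of 0 0] \<Delta>_pos[of 0] by simp

text \<open>Lower semicontinuity of the norm along \<open>\<alpha> x a\<close> makes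
  \<open>1 / \<Delta>\<close> lower semicontinuous; the homomorphism property, applied to
  \<open>x\<close> and \<open>- x\<close>, does the same for \<open>\<Delta>\<close>. Together these
  are continuity.\<close>

lemma \<Delta>_tendsto:
  assumes a: "a \<in> N" "\<iota> a \<noteq> 0"
  shows "(\<Delta> \<longlongrightarrow> \<Delta> x0) (nhds x0)"
proof -
  have lsc: "\<forall>\<^sub>F x in nhds y. t < inverse (\<Delta> x)" if t: "t < inverse (\<Delta> y)" for t y
  proof -
    have lim: "((\<lambda>x. \<alpha> x a) \<longlongrightarrow> \<alpha> y a) (nhds y)"
      by (rule continuous_on_UNIV_iff_tendsto_nhds[THEN iffD1, rule_format, OF continuous_\<alpha>])
    have pos: "0 < (norm (\<iota> a))\<^sup>2" using a(2) by simp
    have "t * (norm (\<iota> a))\<^sup>2 < (norm (\<iota> (\<alpha> y a)))\<^sup>2"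
      using mult_strict_right_mono[OF t pos] by (simp add: norm_\<iota>_\<alpha> a)
    from norm_\<iota>_lsc[OF lim \<alpha>_N[OF a(1)] \<alpha>_N[OF a(1)] this]
    show ?thesis by eventually_elim (use pos in \<open>simp add: norm_\<iota>_\<alpha> a\<close>)
  qed
  show ?thesis
  proof (rule order_tendstoI)
    fix t assume t: "t < \<Delta> x0"
    have inv: "\<Delta> x = inverse (\<Delta> (- x))" for x
      using \<Delta>_plus[OF a, of x "- x"] \<Delta>_zero[OF a] \<Delta>_pos[of "- x"] by (simp add: field_simps)
    have "\<forall>\<^sub>F y in nhds (- x0). t < inverse (\<Delta> y)" by (rule lsc) (use t inv[of x0] in simp)
    moreover have "filterlim uminus (nhds (- x0)) (nhds x0)"
      by (intro tendsto_minus filterlim_ident)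
    ultimately have "\<forall>\<^sub>F x in nhds x0. t < inverse (\<Delta> (- x))"
      by (rule eventually_compose_filterlim)
    then show "\<forall>\<^sub>F x in nhds x0. t < \<Delta> x" by (simp flip: inv)
  next
    fix t assume t: "\<Delta> x0 < t"
    then have "0 < t" using \<Delta>_pos[of x0] by simp
    have "\<forall>\<^sub>F x in nhds x0. inverse t < inverse (\<Delta> x)"
      by (rule lsc) (use t \<Delta>_pos[of x0] in simp)
    then show "\<forall>\<^sub>F x in nhds x0. \<Delta> x < t"
    proof eventually_elim
      case (elim x)
      then show ?case using \<Delta>_pos[of x] \<open>0 < t\<close> by (simp add: inverse_less_iff)
    qed
  qed
qed

text \<open>The choice is unambiguous: an additive isometry is determined by its values on the dense
  range of \<open>\<iota>\<close>.\<close>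

definition U :: "'g \<Rightarrow> 'h \<Rightarrow> 'h" where
  "U x = (SOME V. (\<forall>a\<in>N. V (\<iota> a) = sqrt (\<Delta> x) *\<^sub>R \<iota> (\<alpha> x a)) \<and> (\<forall>u v. V (u + v) = V u + V v) \<and>
    (\<forall>c v. V (hsc c v) = hsc c (V v)) \<and> (\<forall>v. norm (V v) = norm v))"

lemma U_\<iota>: "a \<in> N \<Longrightarrow> U x (\<iota> a) = sqrt (\<Delta> x) *\<^sub>R \<iota> (\<alpha> x a)"
  and U_add: "U x (u + v) = U x u + U x v"
  and U_hsc: "U x (hsc c v) = hsc c (U x v)"
  and norm_U: "norm (U x v) = norm v"
proof -
  have "\<exists>V. (\<forall>a\<in>N. V (\<iota> a) = sqrt (\<Delta> x) *\<^sub>R \<iota> (\<alpha> x a)) \<and> (\<forall>u v. V (u + v) = V u + V v) \<and>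
    (\<forall>c v. V (hsc c v) = hsc c (V v)) \<and> (\<forall>v. norm (V v) = norm v)"
  proof (rule extend_isometry[of "\<lambda>a. sqrt (\<Delta> x) *\<^sub>R \<iota> (\<alpha> x a)"])
    show "sqrt (\<Delta> x) *\<^sub>R \<iota> (\<alpha> x (a + b)) = sqrt (\<Delta> x) *\<^sub>R \<iota> (\<alpha> x a) + sqrt (\<Delta> x) *\<^sub>R \<iota> (\<alpha> x b)"
      if "a \<in> N" "b \<in> N" for a b using that by (simp add: \<alpha>_add \<iota>_add \<alpha>_N scaleR_add_right)
    show "sqrt (\<Delta> x) *\<^sub>R \<iota> (\<alpha> x (sc c a)) = hsc c (sqrt (\<Delta> x) *\<^sub>R \<iota> (\<alpha> x a))"
      if "a \<in> N" for c a using that by (simp add: \<alpha>_sc \<iota>_sc \<alpha>_N hsc_scaleR)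
    show "norm (sqrt (\<Delta> x) *\<^sub>R \<iota> (\<alpha> x a)) = norm (\<iota> a)" if a: "a \<in> N" for a
    proof -
      have "(norm (sqrt (\<Delta> x) *\<^sub>R \<iota> (\<alpha> x a)))\<^sup>2 = (norm (\<iota> a))\<^sup>2"
        using \<Delta>_pos[of x] by (simp add: power_mult_distrib norm_\<iota>_\<alpha>[OF a])
      then show ?thesis by (simp add: power2_eq_iff_nonneg)
    qed
  qed blast
  from someI_ex[OF this, folded U_def]
  show "a \<in> N \<Longrightarrow> U x (\<iota> a) = sqrt (\<Delta> x) *\<^sub>R \<iota> (\<alpha> x a)"
    and "U x (u + v) = U x u + U x v" and "U x (hsc c v) = hsc c (U x v)" and "norm (U x v) = norm v"
    by blast+
qed

lemma U_scaleR: "U x (r *\<^sub>R v) = r *\<^sub>R U x v"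
  using U_hsc[of x "complex_of_real r" v] by (simp add: hsc_of_real)

lemma bounded_linear_U: "bounded_linear (U x)"
  by (rule bounded_linear_intro[where K = 1]) (auto simp: U_add U_scaleR norm_U)

lemma inner_U: "inner (U x u) (U x v) = inner u v"
  by (rule inner_isometry) (auto simp: U_add norm_U)

lemma U_zero: "U 0 v = v"
proof (rule \<iota>_dense_induct[of "\<lambda>v. U 0 v = v"])
  show "closed {v. U 0 v = v}"
    by (intro closed_Collect_eq bounded_linear.continuous_on[OF bounded_linear_U] continuous_on_id)
  \<comment> \<open>If \<open>\<iota> a = 0\<close>, the vector gives no information on
    \<open>\<Delta> 0\<close>, but isometry forces both sides to vanish.\<close>
  show "U 0 (\<iota> a) = \<iota> a" if a: "a \<in> N" for a
    using \<Delta>_zero[OF a] norm_U[of 0 "\<iota> a"] by (cases "\<iota> a = 0") (auto simp: U_\<iota> a \<alpha>_zero)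
qed

lemma U_plus: "U (x + y) v = U x (U y v)"
proof (rule \<iota>_dense_induct[of "\<lambda>v. U (x + y) v = U x (U y v)"])
  show "closed {v. U (x + y) v = U x (U y v)}"
    by (intro closed_Collect_eq bounded_linear.continuous_on[OF bounded_linear_U] continuous_on_id)
  show "U (x + y) (\<iota> a) = U x (U y (\<iota> a))" if a: "a \<in> N" for a
  proof (cases "\<iota> a = 0")
    case True
    then show ?thesis using norm_U[of _ 0] by (metis norm_eq_zero)
  next
    case False
    then show ?thesis using a
      by (simp add: U_\<iota> U_scaleR \<alpha>_N \<alpha>_plus \<Delta>_plus[OF a False] real_sqrt_mult mult.commute)
  qed
qed

lemma unitary_rep_U: "unitary_rep hsc U"
proof -
  have "surj (U x)" for x
    by (rule surjI[of _ "U (- x)"]) (simp add: U_zero flip: U_plus)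
  then show ?thesis
    unfolding unitary_rep_def unitary_op_def
    using U_add U_hsc norm_U U_zero U_plus by (auto simp: fun_eq_iff)
qed

text \<open>By the parallelogram law the squared distance is
  \<open>4 (norm (\<iota> a))\<^sup>2\<close> minus the squared norm of the sum. The sum tends to
  \<open>2 (p x0)\<close> in the algebra, so lower semicontinuity keeps its squared norm above
  \<open>4 (norm (\<iota> a))\<^sup>2 - e\<^sup>2\<close>.\<close>

lemma U_tendsto_\<iota>:
  assumes a: "a \<in> N"
  shows "((\<lambda>x. U x (\<iota> a)) \<longlongrightarrow> U x0 (\<iota> a)) (nhds x0)"
proof (cases "\<iota> a = 0")
  case True
  then have "U x (\<iota> a) = 0" for x using norm_U[of x "\<iota> a"] by simp
  then show ?thesis by simp
next
  case False
  define p where "p x = sqrt (\<Delta> x) *\<^sub>R \<alpha> x a" for x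
  have pN: "p x \<in> N" for x by (simp add: p_def N_scaleR \<alpha>_N a)
  have p: "\<iota> (p x) = U x (\<iota> a)" for x by (simp add: p_def \<iota>_scaleR \<alpha>_N a U_\<iota>)
  have "((\<lambda>x. \<alpha> x a) \<longlongrightarrow> \<alpha> x0 a) (nhds x0)"
    by (rule continuous_on_UNIV_iff_tendsto_nhds[THEN iffD1, rule_format, OF continuous_\<alpha>])
  then have lim: "((\<lambda>x. p x + p x0) \<longlongrightarrow> p x0 + p x0) (nhds x0)"
    unfolding p_def by (intro tendsto_intros \<Delta>_tendsto[OF a False])
  show ?thesis
  proof (rule tendstoI)
    fix e :: real assume e: "0 < e"
    have "(norm (\<iota> (p x0 + p x0)))\<^sup>2 = 4 * (norm (\<iota> a))\<^sup>2"
      using pN[of x0] norm_U[of x0 "\<iota> a"]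
      by (simp add: \<iota>_scaleR p power_mult_distrib flip: scaleR_2)
    then have "4 * (norm (\<iota> a))\<^sup>2 - e\<^sup>2 < (norm (\<iota> (p x0 + p x0)))\<^sup>2" using e by simp
    from norm_\<iota>_lsc[OF lim N_add[OF pN pN] N_add[OF pN pN] this]
    show "\<forall>\<^sub>F x in nhds x0. dist (U x (\<iota> a)) (U x0 (\<iota> a)) < e"
    proof eventually_elim
      case (elim x)
      have "(norm (U x (\<iota> a) + U x0 (\<iota> a)))\<^sup>2 + (norm (U x (\<iota> a) - U x0 (\<iota> a)))\<^sup>2
          = 2 * (norm (U x (\<iota> a)))\<^sup>2 + 2 * (norm (U x0 (\<iota> a)))\<^sup>2"
        by (simp add: power2_norm_eq_inner inner_simps inner_commute)
      then have "(norm (U x (\<iota> a) - U x0 (\<iota> a)))\<^sup>2 < e\<^sup>2"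
        using elim pN by (simp add: \<iota>_add p norm_U)
      then show ?case using e by (simp add: dist_norm power2_less_imp_less)
    qed
  qed
qed

lemma strongly_continuous_U: "strongly_continuous_rep U"
  unfolding strongly_continuous_rep_def
proof (intro allI)
  fix \<xi>
  have "((\<lambda>x. U x \<xi>) \<longlongrightarrow> U x0 \<xi>) (nhds x0)" for x0
  proof (rule tendstoI)
    fix e :: real assume "0 < e"
    then have e: "0 < e / 3" by simp
    then obtain a where a: "a \<in> N" "dist (\<iota> a) \<xi> < e / 3"
      using dense_\<iota> closure_approachable[of \<xi> "\<iota> ` N"] by (metis UNIV_I imageE)
    have d: "dist (U x \<xi>) (U x (\<iota> a)) = dist \<xi> (\<iota> a)" for x
      using norm_U[of x "\<xi> - \<iota> a"] bounded_linear.linear[OF bounded_linear_U, of x]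
      by (simp add: dist_norm linear_diff)
    from tendstoD[OF U_tendsto_\<iota>[OF a(1)] e]
    show "\<forall>\<^sub>F x in nhds x0. dist (U x \<xi>) (U x0 \<xi>) < e"
    proof eventually_elim
      case (elim x)
      then show ?case using d[of x] d[of x0] a(2)
          dist_triangle[of "U x \<xi>" "U x0 \<xi>" "U x (\<iota> a)"]
          dist_triangle[of "U x (\<iota> a)" "U x0 \<xi>" "U x0 (\<iota> a)"]
        by (simp add: dist_commute)
    qed
  qed
  then show "continuous_on UNIV (\<lambda>x. U x \<xi>)"
    by (simp add: continuous_on_UNIV_iff_tendsto_nhds)
qed

lemma continuous_U: "continuous_on UNIV (\<lambda>x. U x \<xi>)"
  using strongly_continuous_U unfolding strongly_continuous_rep_def by blast

end

section \<open>Bounded vectors\<close>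

context gns
begin

section \<open>Real and imaginary parts\<close>

lemma complex_combination_split:
  assumes "finite F" "\<And>c. c \<in> F \<Longrightarrow> st c = c"
  shows "(\<Sum>c\<in>F. sc (z c) c) = (\<Sum>c\<in>F. Re (z c) *\<^sub>R c) + sc \<i> (\<Sum>c\<in>F. Im (z c) *\<^sub>R c)"
    "st (\<Sum>c\<in>F. Re (z c) *\<^sub>R c) = (\<Sum>c\<in>F. Re (z c) *\<^sub>R c)"
    "st (\<Sum>c\<in>F. Im (z c) *\<^sub>R c) = (\<Sum>c\<in>F. Im (z c) *\<^sub>R c)"
proof -
  have "sc (z c) c = Re (z c) *\<^sub>R c + sc \<i> (Im (z c) *\<^sub>R c)" for c
  proof -
    have "sc (z c) c = sc (complex_of_real (Re (z c)) + \<i> * complex_of_real (Im (z c))) c"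
      by (simp only: complex_eq[symmetric])
    then show ?thesis by (simp only: sc_add_left sc_sc sc_of_real)
  qed
  moreover have sc0: "sc \<i> 0 = 0" using norm_sc[of \<i> 0] by simp
  have "sc \<i> (\<Sum>c\<in>F. Im (z c) *\<^sub>R c) = (\<Sum>c\<in>F. sc \<i> (Im (z c) *\<^sub>R c))"
    using assms(1) by (induction F rule: finite_induct) (auto simp: sc_add_right sc0)
  ultimately show "(\<Sum>c\<in>F. sc (z c) c) = (\<Sum>c\<in>F. Re (z c) *\<^sub>R c) + sc \<i> (\<Sum>c\<in>F. Im (z c) *\<^sub>R c)"
    by (simp add: sum.distrib)
qed (use assms(2) in \<open>auto simp: st_sum st_scaleR\<close>)

text \<open>Applying \<open>st\<close> conjugates the imaginary unit, so both parts can be recovered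
  from the sum. This identifies the parts computed from two unrelated expansions.\<close>

lemma cartesian_decomposition_unique:
  assumes "st X = X" "st Y = Y" "st X' = X'" "st Y' = Y'" and eq: "X + sc \<i> Y = X' + sc \<i> Y'"
  shows "X = X'" "Y = Y'"
proof -
  have im: "sc (- \<i>) v = - sc \<i> v" for v
    using sc_sc[of "-1" \<i> v] sc_of_real[of "-1" "sc \<i> v"] by simp
  have "X - sc \<i> Y = X' - sc \<i> Y'"
    using arg_cong[OF eq, of st] by (simp add: st_add st_sc assms(1-4) im)
  then have "(X + sc \<i> Y) + (X - sc \<i> Y) = (X' + sc \<i> Y') + (X' - sc \<i> Y')" using eq by simp
  then have "2 *\<^sub>R X = 2 *\<^sub>R X'" by (simp add: scaleR_2)
  then show X: "X = X'" by simp
  then have "sc (- \<i>) (sc \<i> Y) = sc (- \<i>) (sc \<i> Y')" using eq by simp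
  then show "Y = Y'" using sc_of_real[of 1] by (simp flip: sc_sc)
qed

end

context semi_invariant_action
begin

section \<open>Integrals of translates of an order-integrable element\<close>

lemmas sets_\<mu> = haar[unfolded left_haar_measure_def, THEN conjunct1]
  and finite_compact = haar[unfolded left_haar_measure_def, THEN conjunct2, THEN conjunct2, THEN conjunct1]
  and inner_regular = haar[unfolded left_haar_measure_def, THEN conjunct2, THEN conjunct2, THEN conjunct2,
    THEN conjunct2, THEN conjunct2]

lemma continuous_measurable:
  fixes f :: "'g \<Rightarrow> real"
  assumes "continuous_on UNIV f"
  shows "f \<in> borel_measurable \<mu>"
  using borel_measurable_continuous_onI[OF assms] by (simp add: measurable_cong_sets[OF sets_\<mu> refl])

lemma p_lambda_functional:
  assumes "l \<in> Bset" "bounded_linear \<phi>"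
  shows "\<phi> (p_lambda \<mu> \<alpha> l a) = (\<integral>x. l x * \<phi> (\<alpha> x a) \<partial>\<mu>)"
  using theI'[OF weak_integral_ex1[OF sets_\<mu> finite_compact continuous_\<alpha> assms(1), of a], folded p_lambda_def,
      rule_format, OF assms(2)] .

lemma bounded_linear_inner_\<iota>_mult:
  assumes b: "b \<in> N"
  shows "bounded_linear (\<lambda>y. inner (\<iota> b) (\<iota> (y * b)))"
proof (rule bounded_linear_intro[where K = "2 * (norm (\<iota> b))\<^sup>2"])
  fix y
  have "\<bar>inner (\<iota> b) (\<iota> (y * b))\<bar> \<le> norm (\<iota> b) * norm (\<iota> (y * b))" by (rule Cauchy_Schwarz_ineq2)
  also have "\<dots> \<le> norm (\<iota> b) * (2 * norm y * norm (\<iota> b))"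
    by (intro mult_left_mono norm_\<iota>_mult_left b) simp
  finally show "norm (inner (\<iota> b) (\<iota> (y * b))) \<le> norm y * (2 * (norm (\<iota> b))\<^sup>2)"
    by (simp add: power2_eq_square mult_ac)
qed (use b in \<open>auto simp: distrib_right \<iota>_add \<iota>_scaleR N_mult_left inner_add_right\<close>)

lemma measurable_inner_\<iota>_\<alpha>:
  assumes "b \<in> N"
  shows "(\<lambda>x. inner (\<iota> b) (\<iota> (\<alpha> x c * b))) \<in> borel_measurable \<mu>"
  by (rule continuous_measurable[OF bounded_linear.continuous_on[OF bounded_linear_inner_\<iota>_mult[OF assms] continuous_\<alpha>]])

text \<open>Indicators of compact sets belong to \<open>Bset\<close>, so testing
  \<open>p_lambda\<close> with the vector functional of \<open>b\<close> bounds the integral over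
  every compact set, with one constant \<open>C\<close> for all \<open>b\<close>; nonnegativity
  permits passing to the whole group.\<close>

lemma nn_integral_order_integrable:
  assumes c: "order_integrable st \<mu> \<alpha> c"
  obtains C where "0 \<le> C" "\<And>b. b \<in> N \<Longrightarrow>
    (\<integral>\<^sup>+x. ennreal (inner (\<iota> b) (\<iota> (\<alpha> x c * b))) \<partial>\<mu>) \<le> ennreal (C * (norm (\<iota> b))\<^sup>2)"
proof -
  have pos: "positive st c" using c unfolding order_integrable_def by blast
  obtain C0 where C0: "\<And>l. l \<in> Bset \<Longrightarrow> norm (p_lambda \<mu> \<alpha> l c) \<le> C0"
    using c unfolding order_integrable_def by blast
  show ?thesis
  proof (rule that[of "2 * \<bar>C0\<bar>"])
    fix b assume b: "b \<in> N"
    define \<phi> where "\<phi> y = inner (\<iota> b) (\<iota> (y * b))" for y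
    have \<phi>: "bounded_linear \<phi>" unfolding \<phi>_def by (rule bounded_linear_inner_\<iota>_mult[OF b])
    have cont: "continuous_on UNIV (\<lambda>x. \<phi> (\<alpha> x c))"
      by (rule bounded_linear.continuous_on[OF \<phi> continuous_\<alpha>])
    have nonneg: "0 \<le> \<phi> (\<alpha> x c)" for x
      unfolding \<phi>_def by (intro inner_\<iota>_positive positive_\<alpha> pos b)
    have "(\<integral>\<^sup>+x. ennreal (\<phi> (\<alpha> x c)) \<partial>\<mu>) \<le> ennreal (2 * \<bar>C0\<bar> * (norm (\<iota> b))\<^sup>2)"
    proof (rule nn_integral_le_of_compact[OF sets_\<mu> inner_regular cont nonneg])
      fix K :: "'g set" assume K: "compact K"
      then have "K \<in> sets borel" by (simp add: compact_imp_closed)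
      then have l: "(indicator K :: 'g \<Rightarrow> real) \<in> Bset"
        using K unfolding Bset_def by (auto simp: indicator_def)
      have "(\<integral>\<^sup>+x. ennreal (\<phi> (\<alpha> x c)) * indicator K x \<partial>\<mu>)
          = (\<integral>\<^sup>+x. ennreal (indicator K x * \<phi> (\<alpha> x c)) \<partial>\<mu>)"
        by (intro nn_integral_cong) (auto simp: indicator_def)
      also have "\<dots> = ennreal (\<integral>x. indicator K x * \<phi> (\<alpha> x c) \<partial>\<mu>)"
        by (intro nn_integral_eq_integral integrable_Bset_mult[OF sets_\<mu> finite_compact cont l])
          (auto simp: nonneg)
      also have "(\<integral>x. indicator K x * \<phi> (\<alpha> x c) \<partial>\<mu>) = \<phi> (p_lambda \<mu> \<alpha> (indicator K) c)"
        by (rule p_lambda_functional[OF l \<phi>, symmetric])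
      also have "\<dots> \<le> 2 * \<bar>C0\<bar> * (norm (\<iota> b))\<^sup>2"
      proof -
        have "\<phi> (p_lambda \<mu> \<alpha> (indicator K) c)
            \<le> norm (\<iota> b) * norm (\<iota> (p_lambda \<mu> \<alpha> (indicator K) c * b))"
          unfolding \<phi>_def by (rule norm_cauchy_schwarz)
        also have "\<dots> \<le> norm (\<iota> b) * (2 * norm (p_lambda \<mu> \<alpha> (indicator K) c) * norm (\<iota> b))"
          by (intro mult_left_mono norm_\<iota>_mult_left b) simp
        also have "\<dots> \<le> norm (\<iota> b) * (2 * \<bar>C0\<bar> * norm (\<iota> b))"
          using C0[OF l] by (intro mult_left_mono mult_right_mono) auto
        finally show ?thesis by (simp add: power2_eq_square mult_ac)
      qed
      finally show "(\<integral>\<^sup>+x. ennreal (\<phi> (\<alpha> x c)) * indicator K x \<partial>\<mu>)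
          \<le> ennreal (2 * \<bar>C0\<bar> * (norm (\<iota> b))\<^sup>2)" by (simp add: ennreal_leI)
    next
      show "ennreal (2 * \<bar>C0\<bar> * (norm (\<iota> b))\<^sup>2) < \<infinity>"
        unfolding infinity_ennreal_def by (rule ennreal_less_top)
    qed
    then show "(\<integral>\<^sup>+x. ennreal (inner (\<iota> b) (\<iota> (\<alpha> x c * b))) \<partial>\<mu>) \<le> ennreal (2 * \<bar>C0\<bar> * (norm (\<iota> b))\<^sup>2)"
      by (simp add: \<phi>_def)
  qed simp
qed

text \<open>Real parts of coefficients suffice, as replacing \<open>\<eta>\<close> by its multiple
  by \<open>\<i>\<close> gives the imaginary parts. The constant \<open>k\<close> takes the place of
  a squared bound.\<close>

definition real_bounded :: "'h \<Rightarrow> bool" where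
  "real_bounded \<xi> \<longleftrightarrow> (\<exists>k\<ge>0. \<forall>\<eta>.
     (\<integral>\<^sup>+x. ennreal ((inner (U x \<xi>) \<eta>)\<^sup>2) \<partial>\<mu>) \<le> ennreal (k * (norm \<eta>)\<^sup>2))"

lemma measurable_coefficient[measurable]: "(\<lambda>x. inner (U x \<xi>) \<eta>) \<in> borel_measurable \<mu>"
  by (rule continuous_measurable[OF continuous_on_inner[OF continuous_U continuous_on_const]])

section \<open>Bounded vectors form a complex subspace\<close>

lemma real_bounded_add:
  assumes "real_bounded \<xi>" "real_bounded \<zeta>"
  shows "real_bounded (\<xi> + \<zeta>)"
proof -
  obtain k where k: "0 \<le> k" "\<And>\<eta>. (\<integral>\<^sup>+x. ennreal ((inner (U x \<xi>) \<eta>)\<^sup>2) \<partial>\<mu>) \<le> ennreal (k * (norm \<eta>)\<^sup>2)"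
    using assms(1) unfolding real_bounded_def by blast
  obtain m where m: "0 \<le> m" "\<And>\<eta>. (\<integral>\<^sup>+x. ennreal ((inner (U x \<zeta>) \<eta>)\<^sup>2) \<partial>\<mu>) \<le> ennreal (m * (norm \<eta>)\<^sup>2)"
    using assms(2) unfolding real_bounded_def by blast
  show ?thesis unfolding real_bounded_def
  proof (intro exI[of _ "2 * k + 2 * m"] conjI allI)
    show "0 \<le> 2 * k + 2 * m" using k m by simp
    fix \<eta>
    have "(\<integral>\<^sup>+x. ennreal ((inner (U x (\<xi> + \<zeta>)) \<eta>)\<^sup>2) \<partial>\<mu>)
        \<le> (\<integral>\<^sup>+x. 2 * ennreal ((inner (U x \<xi>) \<eta>)\<^sup>2) + 2 * ennreal ((inner (U x \<zeta>) \<eta>)\<^sup>2) \<partial>\<mu>)"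
    proof (intro nn_integral_mono)
      fix x
      have "(inner (U x (\<xi> + \<zeta>)) \<eta>)\<^sup>2 \<le> 2 * (inner (U x \<xi>) \<eta>)\<^sup>2 + 2 * (inner (U x \<zeta>) \<eta>)\<^sup>2"
        unfolding U_add inner_add_left
        using zero_le_power2[of "inner (U x \<xi>) \<eta> - inner (U x \<zeta>) \<eta>"]
        by (simp add: power2_eq_square algebra_simps)
      then have "ennreal ((inner (U x (\<xi> + \<zeta>)) \<eta>)\<^sup>2)
          \<le> ennreal (2 * (inner (U x \<xi>) \<eta>)\<^sup>2 + 2 * (inner (U x \<zeta>) \<eta>)\<^sup>2)" by (rule ennreal_leI)
      then show "ennreal ((inner (U x (\<xi> + \<zeta>)) \<eta>)\<^sup>2)
          \<le> 2 * ennreal ((inner (U x \<xi>) \<eta>)\<^sup>2) + 2 * ennreal ((inner (U x \<zeta>) \<eta>)\<^sup>2)"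
        by (simp add: ennreal_mult)
    qed
    also have "\<dots> = 2 * (\<integral>\<^sup>+x. ennreal ((inner (U x \<xi>) \<eta>)\<^sup>2) \<partial>\<mu>) + 2 * (\<integral>\<^sup>+x. ennreal ((inner (U x \<zeta>) \<eta>)\<^sup>2) \<partial>\<mu>)"
      by (simp add: nn_integral_add nn_integral_cmult)
    also have "\<dots> \<le> 2 * ennreal (k * (norm \<eta>)\<^sup>2) + 2 * ennreal (m * (norm \<eta>)\<^sup>2)"
      by (intro add_mono mult_left_mono k m) auto
    also have "\<dots> = ennreal ((2 * k + 2 * m) * (norm \<eta>)\<^sup>2)"
      using k(1) m(1) by (simp add: ennreal_mult distrib_right mult.assoc)
    finally show "(\<integral>\<^sup>+x. ennreal ((inner (U x (\<xi> + \<zeta>)) \<eta>)\<^sup>2) \<partial>\<mu>) \<le> ennreal ((2 * k + 2 * m) * (norm \<eta>)\<^sup>2)" .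
  qed
qed

lemma real_bounded_scaleR:
  assumes "real_bounded \<xi>"
  shows "real_bounded (r *\<^sub>R \<xi>)"
proof -
  obtain k where k: "0 \<le> k" "\<And>\<eta>. (\<integral>\<^sup>+x. ennreal ((inner (U x \<xi>) \<eta>)\<^sup>2) \<partial>\<mu>) \<le> ennreal (k * (norm \<eta>)\<^sup>2)"
    using assms(1) unfolding real_bounded_def by blast
  have "(\<integral>\<^sup>+x. ennreal ((inner (U x (r *\<^sub>R \<xi>)) \<eta>)\<^sup>2) \<partial>\<mu>) \<le> ennreal (k * r\<^sup>2 * (norm \<eta>)\<^sup>2)" for \<eta>
    using k(2)[of "r *\<^sub>R \<eta>"] by (simp add: U_scaleR power_mult_distrib mult.assoc)
  then show ?thesis
    using k(1) unfolding real_bounded_def by (intro exI[of _ "k * r\<^sup>2"]) simp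
qed

lemma real_bounded_hsc_ii:
  assumes "real_bounded \<xi>"
  shows "real_bounded (hsc \<i> \<xi>)"
proof -
  obtain k where k: "0 \<le> k" "\<And>\<eta>. (\<integral>\<^sup>+x. ennreal ((inner (U x \<xi>) \<eta>)\<^sup>2) \<partial>\<mu>) \<le> ennreal (k * (norm \<eta>)\<^sup>2)"
    using assms(1) unfolding real_bounded_def by blast
  have "(\<integral>\<^sup>+x. ennreal ((inner (U x (hsc \<i> \<xi>)) \<eta>)\<^sup>2) \<partial>\<mu>) \<le> ennreal (k * (norm \<eta>)\<^sup>2)" for \<eta>
    using k(2)[of "hsc \<i> \<eta>"] by (simp add: U_hsc inner_hsc_ii norm_hsc)
  then show ?thesis using k(1) unfolding real_bounded_def by blast
qed

lemma real_bounded_hsc: "real_bounded \<xi> \<Longrightarrow> real_bounded (hsc c \<xi>)"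
  unfolding hsc_Complex[of c] by (intro real_bounded_add real_bounded_scaleR real_bounded_hsc_ii)

lemma real_bounded_zero: "real_bounded 0"
proof -
  have "U x 0 = 0" for x using U_scaleR[of x 0 0] by simp
  then show ?thesis unfolding real_bounded_def by (intro exI[of _ 0]) simp
qed

lemma real_bounded_sum: "(\<And>i. i \<in> F \<Longrightarrow> real_bounded (f i)) \<Longrightarrow> real_bounded (\<Sum>i\<in>F. f i)"
  by (induction F rule: infinite_finite_induct) (auto simp: real_bounded_zero real_bounded_add)

lemma real_bounded_imp_U_bounded:
  assumes "real_bounded \<xi>"
  shows "U_bounded \<mu> hsc U \<xi>"
proof -
  obtain k where k: "0 \<le> k" "\<And>\<eta>. (\<integral>\<^sup>+x. ennreal ((inner (U x \<xi>) \<eta>)\<^sup>2) \<partial>\<mu>) \<le> ennreal (k * (norm \<eta>)\<^sup>2)"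
    using assms(1) unfolding real_bounded_def by blast
  show ?thesis unfolding U_bounded_def
  \<comment> \<open>Real and imaginary parts of the coefficient contribute \<open>k\<close> each,
    and \<open>U_bounded\<close> squares its constant.\<close>
  proof (intro exI[of _ "sqrt (2 * k)"] conjI allI)
    show "0 \<le> sqrt (2 * k)" using k(1) by simp
    fix \<eta>
    have "(\<integral>\<^sup>+x. ennreal ((cmod (hinner hsc (U x \<xi>) \<eta>))\<^sup>2) \<partial>\<mu>)
        = (\<integral>\<^sup>+x. ennreal ((inner (U x \<xi>) \<eta>)\<^sup>2) + ennreal ((inner (U x \<xi>) (hsc \<i> \<eta>))\<^sup>2) \<partial>\<mu>)"
      by (intro nn_integral_cong) (simp add: hinner_def cmod_power2)
    also have "\<dots> = (\<integral>\<^sup>+x. ennreal ((inner (U x \<xi>) \<eta>)\<^sup>2) \<partial>\<mu>) + (\<integral>\<^sup>+x. ennreal ((inner (U x \<xi>) (hsc \<i> \<eta>))\<^sup>2) \<partial>\<mu>)"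
      by (rule nn_integral_add) auto
    also have "\<dots> \<le> ennreal (k * (norm \<eta>)\<^sup>2) + ennreal (k * (norm (hsc \<i> \<eta>))\<^sup>2)"
      by (intro add_mono k)
    also have "\<dots> = ennreal ((sqrt (2 * k) * norm \<eta>)\<^sup>2)"
      using k(1) by (simp add: norm_hsc power_mult_distrib flip: ennreal_plus)
    finally show "(\<integral>\<^sup>+x. ennreal ((cmod (hinner hsc (U x \<xi>) \<eta>))\<^sup>2) \<partial>\<mu>) \<le> ennreal ((sqrt (2 * k) * norm \<eta>)\<^sup>2)" .
  qed
qed

text \<open>Fatou's lemma along a sequence from the dense range, on which the coefficients converge
  pointwise.\<close>

lemma real_bounded_denseI:
  assumes k: "0 \<le> k" "\<And>b. b \<in> N \<Longrightarrow> (\<integral>\<^sup>+x. ennreal ((inner (U x \<xi>) (\<iota> b))\<^sup>2) \<partial>\<mu>) \<le> ennreal (k * (norm (\<iota> b))\<^sup>2)"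
  shows "real_bounded \<xi>"
  unfolding real_bounded_def
proof (intro exI[of _ k] conjI allI k(1))
  fix \<eta>
  have "\<eta> \<in> closure (\<iota> ` N)" by (simp add: dense_\<iota>)
  then obtain h where h: "\<And>n. h n \<in> \<iota> ` N" "h \<longlonglongrightarrow> \<eta>"
    unfolding closure_sequential by blast
  have lim: "liminf (\<lambda>n. ennreal ((inner (U x \<xi>) (h n))\<^sup>2)) = ennreal ((inner (U x \<xi>) \<eta>)\<^sup>2)" for x
    by (rule lim_imp_Liminf[OF sequentially_bot tendsto_ennrealI])
      (intro tendsto_power tendsto_inner tendsto_const h(2))
  have le: "(\<integral>\<^sup>+x. ennreal ((inner (U x \<xi>) (h n))\<^sup>2) \<partial>\<mu>) \<le> ennreal (k * (norm (h n))\<^sup>2)" for n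
  proof -
    obtain b where "b \<in> N" "h n = \<iota> b" using h(1)[of n] by blast
    then show ?thesis using k(2) by simp
  qed
  have "(\<integral>\<^sup>+x. ennreal ((inner (U x \<xi>) \<eta>)\<^sup>2) \<partial>\<mu>)
      = (\<integral>\<^sup>+x. liminf (\<lambda>n. ennreal ((inner (U x \<xi>) (h n))\<^sup>2)) \<partial>\<mu>)" by (simp add: lim)
  also have "\<dots> \<le> liminf (\<lambda>n. \<integral>\<^sup>+x. ennreal ((inner (U x \<xi>) (h n))\<^sup>2) \<partial>\<mu>)"
    by (rule nn_integral_liminf) measurable
  also have "\<dots> \<le> liminf (\<lambda>n. ennreal (k * (norm (h n))\<^sup>2))"
    by (rule Liminf_mono[OF always_eventually]) (rule allI, rule le)
  also have "\<dots> = ennreal (k * (norm \<eta>)\<^sup>2)"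
    by (rule lim_imp_Liminf[OF sequentially_bot tendsto_ennrealI])
      (intro tendsto_mult tendsto_power tendsto_norm tendsto_const h(2))
  finally show "(\<integral>\<^sup>+x. ennreal ((inner (U x \<xi>) \<eta>)\<^sup>2) \<partial>\<mu>) \<le> ennreal (k * (norm \<eta>)\<^sup>2)" .
qed

text \<open>Moving \<open>U x\<close> across the inner product produces a factor
  \<open>\<Delta> (- x)\<close>, which is absorbed by semi-invariance when
  \<open>\<alpha> (- x)\<close> is removed on the right-hand side. What remains is
  \<open>\<alpha> x c\<close> next to the fixed element \<open>b\<close>, the integrand controlled
  by order-integrability.\<close>

lemma real_bounded_of_dominated:
  assumes a: "a \<in> N" and F: "finite F" "\<And>c. c \<in> F \<Longrightarrow> order_integrable st \<mu> \<alpha> c" "\<And>c. c \<in> F \<Longrightarrow> 0 \<le> p c"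
    and dom: "\<And>b. b \<in> N \<Longrightarrow> (inner (\<iota> a) (\<iota> b))\<^sup>2
      \<le> (\<Sum>c\<in>F. p c * (inner (\<iota> b) (\<iota> (c * b)) + inner (\<iota> b) (\<iota> (b * c))))"
  shows "real_bounded (\<iota> a)"
proof -
  have pos: "positive st c" if "c \<in> F" for c using F(2)[OF that] unfolding order_integrable_def by blast
  have "\<forall>c\<in>F. \<exists>C\<ge>0. \<forall>b\<in>N. (\<integral>\<^sup>+x. ennreal (inner (\<iota> b) (\<iota> (\<alpha> x c * b))) \<partial>\<mu>) \<le> ennreal (C * (norm (\<iota> b))\<^sup>2)"
    using nn_integral_order_integrable[OF F(2)] by metis
  then obtain C where C: "\<And>c. c \<in> F \<Longrightarrow> 0 \<le> C c"
    "\<And>c b. c \<in> F \<Longrightarrow> b \<in> N \<Longrightarrow> (\<integral>\<^sup>+x. ennreal (inner (\<iota> b) (\<iota> (\<alpha> x c * b))) \<partial>\<mu>) \<le> ennreal (C c * (norm (\<iota> b))\<^sup>2)"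
    by metis
  show ?thesis
  proof (rule real_bounded_denseI)
    show "0 \<le> (\<Sum>c\<in>F. p c * (2 * C c))" using F(3) C(1) by (intro sum_nonneg mult_nonneg_nonneg) auto
    fix b assume b: "b \<in> N"
    define f where "f c x = inner (\<iota> b) (\<iota> (\<alpha> x c * b))" for c x
    \<comment> \<open>Taking adjoints turns \<open>b * \<alpha> x c\<close> into a left
      multiplication on \<open>st b\<close>, so one integral estimate covers both terms.\<close>
    define g where "g c x = inner (\<iota> (st b)) (\<iota> (\<alpha> x c * st b))" for c x
    have meas[measurable]: "f c \<in> borel_measurable \<mu>" "g c \<in> borel_measurable \<mu>" for c
      unfolding f_def g_def using b by (simp_all add: measurable_inner_\<iota>_\<alpha> N_st)
    have nonneg: "0 \<le> f c x" "0 \<le> g c x" if "c \<in> F" for c x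
      unfolding f_def g_def by (intro inner_\<iota>_positive positive_\<alpha> pos that N_st b)+
    have le: "(inner (U x (\<iota> a)) (\<iota> b))\<^sup>2 \<le> (\<Sum>c\<in>F. p c * (f c x + g c x))" for x
    proof -
      define b' where "b' = \<alpha> (- x) b"
      have b': "b' \<in> N" unfolding b'_def by (rule \<alpha>_N[OF b])
      have tr: "\<Delta> (- x) * inner (\<iota> b') (\<iota> (\<alpha> (- x) y)) = inner (\<iota> b) (\<iota> y)" if y: "y \<in> N" for y
        using inner_U[of "- x" "\<iota> b" "\<iota> y"] b y \<Delta>_pos[of "- x"]
        by (simp add: U_\<iota> b'_def flip: mult.assoc)
      have left: "\<Delta> (- x) * inner (\<iota> b') (\<iota> (c * b')) = f c x" for c
        using tr[of "\<alpha> x c * b"] b by (simp add: N_mult_left \<alpha>_mult \<alpha>_uminus f_def b'_def)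
      have right: "\<Delta> (- x) * inner (\<iota> b') (\<iota> (b' * c)) = g c x" if c: "c \<in> F" for c
      proof -
        have "\<Delta> (- x) * inner (\<iota> b') (\<iota> (b' * c)) = inner (\<iota> b) (\<iota> (b * \<alpha> x c))"
          using tr[of "b * \<alpha> x c"] b by (simp add: N_mult_right \<alpha>_mult \<alpha>_uminus b'_def)
        also have "\<dots> = g c x"
          using inner_\<iota>_st[of b "b * \<alpha> x c"] b positive_imp_sa[OF pos[OF c]]
          by (simp add: N_mult_right st_mult g_def flip: \<alpha>_st)
        finally show ?thesis .
      qed
      have "inner (U x (\<iota> a)) (\<iota> b) = inner (U x (\<iota> a)) (U x (U (- x) (\<iota> b)))"
        by (simp add: U_zero flip: U_plus)
      also have "\<dots> = sqrt (\<Delta> (- x)) * inner (\<iota> a) (\<iota> b')"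
        using b by (simp add: inner_U) (simp add: U_\<iota> b'_def)
      finally have "(inner (U x (\<iota> a)) (\<iota> b))\<^sup>2 = \<Delta> (- x) * (inner (\<iota> a) (\<iota> b'))\<^sup>2"
        using \<Delta>_pos[of "- x"] by (simp add: power_mult_distrib)
      also have "\<dots> \<le> \<Delta> (- x) * (\<Sum>c\<in>F. p c * (inner (\<iota> b') (\<iota> (c * b')) + inner (\<iota> b') (\<iota> (b' * c))))"
        using dom[OF b'] \<Delta>_pos[of "- x"] by (intro mult_left_mono) auto
      also have "\<dots> = (\<Sum>c\<in>F. p c * (\<Delta> (- x) * inner (\<iota> b') (\<iota> (c * b')) + \<Delta> (- x) * inner (\<iota> b') (\<iota> (b' * c))))"
        by (simp add: sum_distrib_left algebra_simps)
      also have "\<dots> = (\<Sum>c\<in>F. p c * (f c x + g c x))"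
        by (intro sum.cong) (auto simp: left right)
      finally show ?thesis .
    qed
    have "(\<integral>\<^sup>+x. ennreal ((inner (U x (\<iota> a)) (\<iota> b))\<^sup>2) \<partial>\<mu>)
        \<le> (\<integral>\<^sup>+x. (\<Sum>c\<in>F. ennreal (p c) * (ennreal (f c x) + ennreal (g c x))) \<partial>\<mu>)"
    proof (intro nn_integral_mono)
      fix x
      have "ennreal ((inner (U x (\<iota> a)) (\<iota> b))\<^sup>2) \<le> ennreal (\<Sum>c\<in>F. p c * (f c x + g c x))"
        using le by (rule ennreal_leI)
      also have "\<dots> = (\<Sum>c\<in>F. ennreal (p c * (f c x + g c x)))"
        using F(3) nonneg by (intro sum_ennreal[symmetric] mult_nonneg_nonneg add_nonneg_nonneg) auto
      also have "\<dots> = (\<Sum>c\<in>F. ennreal (p c) * (ennreal (f c x) + ennreal (g c x)))"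
        using F(3) nonneg by (intro sum.cong) (auto simp: ennreal_mult)
      finally show "ennreal ((inner (U x (\<iota> a)) (\<iota> b))\<^sup>2)
          \<le> (\<Sum>c\<in>F. ennreal (p c) * (ennreal (f c x) + ennreal (g c x)))" .
    qed
    also have "\<dots> = (\<Sum>c\<in>F. ennreal (p c) * ((\<integral>\<^sup>+x. ennreal (f c x) \<partial>\<mu>) + (\<integral>\<^sup>+x. ennreal (g c x) \<partial>\<mu>)))"
      by (simp add: nn_integral_sum nn_integral_cmult nn_integral_add)
    also have "\<dots> \<le> (\<Sum>c\<in>F. ennreal (p c) * (ennreal (C c * (norm (\<iota> b))\<^sup>2) + ennreal (C c * (norm (\<iota> b))\<^sup>2)))"
      using C(2)[OF _ b] C(2)[OF _ N_st[OF b]] b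
      by (intro sum_mono mult_left_mono add_mono) (auto simp: f_def g_def norm_\<iota>_st)
    also have "\<dots> = (\<Sum>c\<in>F. ennreal (p c * (2 * C c) * (norm (\<iota> b))\<^sup>2))"
      using F(3) C(1) by (intro sum.cong refl) (simp add: mult.assoc flip: ennreal_mult ennreal_plus)
    also have "\<dots> = ennreal ((\<Sum>c\<in>F. p c * (2 * C c)) * (norm (\<iota> b))\<^sup>2)"
      using F(3) C(1) by (subst sum_ennreal) (auto simp: sum_distrib_right)
    finally show "(\<integral>\<^sup>+x. ennreal ((inner (U x (\<iota> a)) (\<iota> b))\<^sup>2) \<partial>\<mu>)
        \<le> ennreal ((\<Sum>c\<in>F. p c * (2 * C c)) * (norm (\<iota> b))\<^sup>2)" .
  qed
qed

lemma real_bounded_real_combination: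
  assumes F: "finite F" "\<And>c. c \<in> F \<Longrightarrow> order_integrable st \<mu> \<alpha> c" and a1: "a = (\<Sum>c\<in>F. r c *\<^sub>R c)"
    and T: "finite T" "T \<subseteq> Mtau_pos st \<tau>" and a2: "a = (\<Sum>t\<in>T. d t *\<^sub>R t)"
  shows "a \<in> N" "real_bounded (\<iota> a)"
proof -
  show aN: "a \<in> N" unfolding a2 using T Mtau_pos_N by (intro N_sum N_scaleR) auto
  have pos: "positive st c" if "c \<in> F" for c using F(2)[OF that] unfolding order_integrable_def by blast
  obtain K where K: "0 \<le> K" "\<And>b. b \<in> N \<Longrightarrow> (inner (\<iota> a) (\<iota> b))\<^sup>2
    \<le> K * (\<Sum>c\<in>F. \<bar>r c\<bar> * (inner (\<iota> b) (\<iota> (c * b)) + inner (\<iota> b) (\<iota> (b * c))))"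
    using inner_\<iota>_square_le[OF F(1) pos a1 T a2] by blast
  show "real_bounded (\<iota> a)"
  proof (rule real_bounded_of_dominated[OF aN F, where p = "\<lambda>c. K * \<bar>r c\<bar>"])
    show "0 \<le> K * \<bar>r c\<bar>" for c using K(1) by simp
    show "(inner (\<iota> a) (\<iota> b))\<^sup>2
      \<le> (\<Sum>c\<in>F. K * \<bar>r c\<bar> * (inner (\<iota> b) (\<iota> (c * b)) + inner (\<iota> b) (\<iota> (b * c))))" if "b \<in> N" for b
      using K(2)[OF that] by (simp add: sum_distrib_left mult.assoc)
  qed
qed

lemma real_bounded_Malpha_Mtau:
  assumes "a \<in> Malpha sc st \<mu> \<alpha>" "a \<in> Mtau sc st \<tau>"
  shows "real_bounded (\<iota> a)"
proof -
  obtain F z where F: "finite F" "F \<subseteq> {c. order_integrable st \<mu> \<alpha> c}" "a = (\<Sum>c\<in>F. sc (z c) c)"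
    using assms(1) unfolding Malpha_def cspan_def by blast
  obtain T y where T: "finite T" "T \<subseteq> Mtau_pos st \<tau>" "a = (\<Sum>t\<in>T. sc (y t) t)"
    using assms(2) unfolding Mtau_def cspan_def by blast
  have oi: "order_integrable st \<mu> \<alpha> c" if "c \<in> F" for c using F(2) that by blast
  have saF: "st c = c" if "c \<in> F" for c
    using oi[OF that] positive_imp_sa unfolding order_integrable_def by blast
  have saT: "st t = t" if "t \<in> T" for t
    using T(2) that positive_imp_sa unfolding Mtau_pos_def by blast
  define X where "X = (\<Sum>c\<in>F. Re (z c) *\<^sub>R c)"
  define Y where "Y = (\<Sum>c\<in>F. Im (z c) *\<^sub>R c)"
  note split = complex_combination_split[OF F(1) saF, of z, folded X_def Y_def]
    complex_combination_split[OF T(1) saT, of y]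
  have a: "a = X + sc \<i> Y" using split(1) F(3) by simp
  have XY: "X = (\<Sum>t\<in>T. Re (y t) *\<^sub>R t)" "Y = (\<Sum>t\<in>T. Im (y t) *\<^sub>R t)"
    using cartesian_decomposition_unique[OF split(2,3,5,6)] a split(4) T(3) by auto
  note X = real_bounded_real_combination[OF F(1) oi X_def T(1,2) XY(1)]
  note Y = real_bounded_real_combination[OF F(1) oi Y_def T(1,2) XY(2)]
  show ?thesis unfolding a using X Y
    by (simp add: \<iota>_add \<iota>_sc N_sc real_bounded_add real_bounded_hsc)
qed

text \<open>Writing \<open>c = st u * u\<close> moves one factor to each side of the pairing. The
  product \<open>c * d\<close> need not lie in \<open>Malpha\<close>, so this enlarges the supply of
  bounded vectors for the density argument.\<close>

lemma real_bounded_order_integrable_mult: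
  assumes c: "order_integrable st \<mu> \<alpha> c" and d: "d \<in> N"
  shows "real_bounded (\<iota> (c * d))"
proof -
  have pos: "positive st c" using c unfolding order_integrable_def by blast
  then obtain u where u: "c = st u * u" unfolding positive_def by blast
  show ?thesis
  proof (rule real_bounded_of_dominated[where F = "{c}" and p = "\<lambda>_. (norm (\<iota> (u * d)))\<^sup>2"])
    show "c * d \<in> N" by (rule N_mult_left[OF d])
    fix b assume b: "b \<in> N"
    have "inner (\<iota> (c * d)) (\<iota> b) = inner (\<iota> (u * d)) (\<iota> (u * b))"
      using inner_\<iota>_mult_left[of "u * d" b "st u"] b d by (simp add: u N_mult_left mult.assoc st_st)
    then have "(inner (\<iota> (c * d)) (\<iota> b))\<^sup>2 \<le> (norm (\<iota> (u * d)))\<^sup>2 * (norm (\<iota> (u * b)))\<^sup>2"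
      using Cauchy_Schwarz_ineq[of "\<iota> (u * d)" "\<iota> (u * b)"] by (simp add: power2_norm_eq_inner)
    also have "(norm (\<iota> (u * b)))\<^sup>2 = inner (\<iota> b) (\<iota> (c * b))"
      using inner_\<iota>_mult_left[of b "u * b" u] b by (simp add: u N_mult_left mult.assoc power2_norm_eq_inner)
    also have "\<dots> \<le> inner (\<iota> b) (\<iota> (c * b)) + inner (\<iota> b) (\<iota> (b * c))"
      using inner_\<iota>_positive(2)[OF pos b] by simp
    finally show "(inner (\<iota> (c * d)) (\<iota> b))\<^sup>2 \<le> (\<Sum>x\<in>{c}. (norm (\<iota> (u * d)))\<^sup>2 *
        (inner (\<iota> b) (\<iota> (x * b)) + inner (\<iota> b) (\<iota> (b * x))))"
      by (simp add: mult_left_mono)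
  qed (use c in auto)
qed

lemma square_integrable_U:
  assumes "integrable_action sc st \<mu> \<alpha>"
  shows "square_integrable_rep \<mu> hsc U"
proof -
  have "\<xi> \<in> closure {\<xi>. U_bounded \<mu> hsc U \<xi>}" for \<xi>
    unfolding closure_approachable
  proof (intro allI impI)
    fix e :: real assume "0 < e"
    then have e: "0 < e / 3" by simp
    obtain a where a: "a \<in> N" "dist (\<iota> a) \<xi> < e / 3"
      using dense_\<iota> closure_approachable[of \<xi> "\<iota> ` N"] e by (metis UNIV_I imageE)
    \<comment> \<open>Approximation in the algebra norm controls the GNS norm only after
      multiplication by a fixed element of \<open>N\<close>; hence \<open>a\<close> is replaced by a
      product before \<open>x\<close> is approximated.\<close>
    obtain x z where z: "z \<in> N" "norm (\<iota> a - \<iota> (x * z)) < e / 3"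
      using left_multiplication_nondegenerate[OF a(1) e] by blast
    \<comment> \<open>The 2 is the constant of \<open>norm_\<iota>_mult_left\<close>; the summand 1
      keeps \<open>D\<close> positive when \<open>\<iota> z = 0\<close>.\<close>
    define D where "D = 2 * norm (\<iota> z) + 1"
    have D: "0 < D" unfolding D_def by (simp add: add_nonneg_pos)
    define \<delta> where "\<delta> = e / 3 / D"
    have \<delta>: "0 < \<delta>" using e D by (simp add: \<delta>_def)
    obtain m where m: "m \<in> Malpha sc st \<mu> \<alpha>" "dist m x < \<delta>"
      using assms \<delta> closure_approachable[of x "Malpha sc st \<mu> \<alpha>"]
      unfolding integrable_action_def by (metis UNIV_I)
    obtain F y where F: "finite F" "F \<subseteq> {c. order_integrable st \<mu> \<alpha> c}" "m = (\<Sum>c\<in>F. sc (y c) c)"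
      using m(1) unfolding Malpha_def cspan_def by blast
    have "\<iota> (m * z) = (\<Sum>c\<in>F. hsc (y c) (\<iota> (c * z)))"
      using z(1) by (simp add: F(3) sum_distrib_right sc_mult_left \<iota>_sum N_sc N_mult_left \<iota>_sc)
    also have "real_bounded \<dots>"
      using F(2) z(1) by (intro real_bounded_sum real_bounded_hsc real_bounded_order_integrable_mult) auto
    finally have mem: "\<iota> (m * z) \<in> {\<xi>. U_bounded \<mu> hsc U \<xi>}" using real_bounded_imp_U_bounded by simp
    have "norm (\<iota> (m * z) - \<iota> (x * z)) = norm (\<iota> ((m - x) * z))"
      using z(1) by (simp add: \<iota>_diff N_mult_left left_diff_distrib)
    also have "\<dots> \<le> 2 * norm (m - x) * norm (\<iota> z)" by (rule norm_\<iota>_mult_left[OF z(1)])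
    also have "\<dots> \<le> \<delta> * (2 * norm (\<iota> z))"
      using mult_right_mono[of "norm (m - x)" \<delta> "2 * norm (\<iota> z)"] m(2) by (simp add: dist_norm mult_ac)
    also have "\<dots> < \<delta> * D" using \<delta> by (simp add: D_def)
    also have "\<dots> = e / 3" using D by (simp add: \<delta>_def)
    finally have "norm (\<iota> (m * z) - \<iota> (x * z)) < e / 3" .
    moreover have "norm (\<iota> (m * z) - \<xi>) \<le> norm (\<iota> (m * z) - \<iota> (x * z)) + norm (\<iota> a - \<iota> (x * z)) + norm (\<iota> a - \<xi>)"
    proof -
      have eq: "\<iota> (m * z) - \<xi> = (\<iota> (m * z) - \<iota> (x * z)) - (\<iota> a - \<iota> (x * z)) + (\<iota> a - \<xi>)" by simp
      show ?thesis
        unfolding eq using norm_triangle_ineq[of "(\<iota> (m * z) - \<iota> (x * z)) - (\<iota> a - \<iota> (x * z))" "\<iota> a - \<xi>"]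
          norm_triangle_ineq4[of "\<iota> (m * z) - \<iota> (x * z)" "\<iota> a - \<iota> (x * z)"] by linarith
    qed
    ultimately have "dist (\<iota> (m * z)) \<xi> < e" using a(2) z(2) by (simp add: dist_norm)
    then show "\<exists>y\<in>{\<xi>. U_bounded \<mu> hsc U \<xi>}. dist y \<xi> < e" using mem by blast
  qed
  then show ?thesis unfolding square_integrable_rep_def by blast
qed

end

theorem theorem7p18:
  fixes \<mu> :: "'g::{topological_group_add,t2_space} measure"
    and \<Delta> :: "'g \<Rightarrow> real"
    and sc :: "complex \<Rightarrow> 'a::{real_normed_algebra,banach} \<Rightarrow> 'a"
    and st :: "'a \<Rightarrow> 'a"
    and \<alpha> :: "'g \<Rightarrow> 'a \<Rightarrow> 'a"
    and \<tau> :: "'a \<Rightarrow> ennreal"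
    and hsc :: "complex \<Rightarrow> 'h::{real_inner,complete_space} \<Rightarrow> 'h"
    and \<iota> :: "'a \<Rightarrow> 'h"
  assumes "locally_compact_space (euclidean :: 'g topology)"
    and "left_haar_measure \<mu>"
    and "modular_function \<mu> \<Delta>"
    and "cstar_algebra sc st"
    and "strongly_continuous_action sc st \<alpha>"
    and "is_trace st \<tau>"
    and "lsc_on_positive st \<tau>"
    and "semi_invariant st \<tau> \<Delta> \<alpha>"
    and "gns_space sc st \<tau> hsc \<iota>"
  shows "(\<forall>x. \<forall>a\<in>Ntau st \<tau>. \<alpha> x a \<in> Ntau st \<tau>) \<and>
    (\<exists>U :: 'g \<Rightarrow> 'h \<Rightarrow> 'h.
       (\<forall>x. \<forall>a\<in>Ntau st \<tau>. U x (\<iota> a) = sqrt (\<Delta> x) *\<^sub>R \<iota> (\<alpha> x a)) \<and>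
       unitary_rep hsc U \<and>
       strongly_continuous_rep U \<and>
       (\<forall>a \<in> Malpha sc st \<mu> \<alpha> \<inter> Mtau sc st \<tau>. a \<in> Ntau st \<tau> \<and> U_bounded \<mu> hsc U (\<iota> a)) \<and>
       (integrable_action sc st \<mu> \<alpha> \<longrightarrow> square_integrable_rep \<mu> hsc U))"
proof -
  interpret semi_invariant_action sc st \<tau> hsc \<iota> \<mu> \<Delta> \<alpha>
    by unfold_locales fact+
  show ?thesis
  proof (intro conjI exI[of _ U])
    show "\<forall>x. \<forall>a\<in>Ntau st \<tau>. \<alpha> x a \<in> Ntau st \<tau>" by (intro allI ballI \<alpha>_N)
    show "\<forall>x. \<forall>a\<in>Ntau st \<tau>. U x (\<iota> a) = sqrt (\<Delta> x) *\<^sub>R \<iota> (\<alpha> x a)" by (intro allI ballI U_\<iota>)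
    show "unitary_rep hsc U" by (rule unitary_rep_U)
    show "strongly_continuous_rep U" by (rule strongly_continuous_U)
    show "\<forall>a \<in> Malpha sc st \<mu> \<alpha> \<inter> Mtau sc st \<tau>. a \<in> Ntau st \<tau> \<and> U_bounded \<mu> hsc U (\<iota> a)"
      by (intro ballI conjI) (auto intro!: Mtau_N real_bounded_imp_U_bounded real_bounded_Malpha_Mtau)
    show "integrable_action sc st \<mu> \<alpha> \<longrightarrow> square_integrable_rep \<mu> hsc U"
      by (rule impI, rule square_integrable_U)
  qed
qed

end
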